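(* Let $n\ge2$ and let $\mathcal{Q}=\mathcal{Q}_1\otimes\cdots\otimes\mathcal{Q}_n$ be a doubly commuting quotient module of the Bergman module $L^2_a(\mathbb{D}^n)$, where each $\mathcal{Q}_i$ is a quotient module of $L^2_a(\mathbb{D})$. Then $\mathcal{Q}$ is essentially normal if and only if one of the following holds: (i) $\mathcal{Q}$ is finite dimensional. (ii) There exists $i\in\{1,\dots,n\}$ such that $\mathcal{Q}_i$ is infinite dimensional with $\dim(\mathcal{S}_i\ominus z\mathcal{S}_i)<\infty$, where $\mathcal{S}_i=L^2_a(\mathbb{D})\ominus\mathcal{Q}_i$, and $\mathcal{Q}_j\cong\mathbb{C}$ (i.e. $\dim\mathcal{Q}_j=1$) for all $j\ne i$.
   Context: $L^2_a(\mathbb{D})$ is the Bergman space of the unit disc (reproducing kernel $(1-z\bar w)^{-2}$) and $L^2_a(\mathbb{D}^n)=L^2_a(\mathbb{D})\otimes\cdots\otimes L^2_a(\mathbb{D})$, with coordinate multiplication operators $M_{z_i}$. A quotient module is a closed subspace $\mathcal{Q}$ whose orthogonal complement is invariant under all $M_{z_i}$; put $C_{z_i}=P_{\mathcal{Q}}M_{z_i}|_{\mathcal{Q}}$. $\mathcal{Q}$ is doubly commuting if $[C_{z_i},C_{z_j}^*]=0$ for all $1\le i<j\le n$, which is known to be equivalent to $\mathcal{Q}=\mathcal{Q}_1\otimes\cdots\otimes\mathcal{Q}_n$ with $\mathcal{Q}_i$ quotient modules of $L^2_a(\mathbb{D})$. $\mathcal{Q}$ is essentially normal if $[C_{z_i},C_{z_j}^*]$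 is compact for all $1\le i,j\le n$. *)

theory Defs
  imports "HOL-Complex_Analysis.Complex_Analysis" "HOL-Library.Function_Algebras"
begin

global_interpretation cfun: vector_space "\<lambda>(c::complex) (f::'a \<Rightarrow> complex) x. c * f x"
  by unfold_locales (auto simp: fun_eq_iff algebra_simps)

(* cfun.dim is 0 for infinite-dimensional subspaces, so finiteness is expressed separately. *)
definition finite_dim :: "('a \<Rightarrow> complex) set \<Rightarrow> bool" where
  "finite_dim V \<longleftrightarrow> (\<exists>B. finite B \<and> V \<subseteq> cfun.span B)"

text \<open>
  A Hilbert space is given by a measure \<open>M\<close> and a carrier \<open>H\<close> of square integrable functions on
  which functions that agree almost everywhere are equal. Operators are functions whose values
  matter only on the carrier in question.
\<close>

definition l2_inner :: "'a measure \<Rightarrow> ('a \<Rightarrow> complex) \<Rightarrow> ('a \<Rightarrow> complex) \<Rightarrow> complex" where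
  "l2_inner M f g = (LINT x|M. f x * cnj (g x))"

definition l2_norm :: "'a measure \<Rightarrow> ('a \<Rightarrow> complex) \<Rightarrow> real" where
  "l2_norm M f = sqrt (LINT x|M. (cmod (f x))\<^sup>2)"

definition l2_tendsto :: "'a measure \<Rightarrow> (nat \<Rightarrow> 'a \<Rightarrow> complex) \<Rightarrow> ('a \<Rightarrow> complex) \<Rightarrow> bool" where
  "l2_tendsto M s f \<longleftrightarrow> (\<lambda>k. l2_norm M (s k - f)) \<longlonglongrightarrow> 0"

definition l2_closure ::
  "'a measure \<Rightarrow> ('a \<Rightarrow> complex) set \<Rightarrow> ('a \<Rightarrow> complex) set \<Rightarrow> ('a \<Rightarrow> complex) set" where
  "l2_closure M H A = {f \<in> H. \<exists>s. (\<forall>k. s k \<in> A) \<and> l2_tendsto M s f}"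

definition closed_subspace ::
  "'a measure \<Rightarrow> ('a \<Rightarrow> complex) set \<Rightarrow> ('a \<Rightarrow> complex) set \<Rightarrow> bool" where
  "closed_subspace M H Q \<longleftrightarrow> Q \<subseteq> H \<and> cfun.subspace Q \<and> l2_closure M H Q \<subseteq> Q"

definition ominus ::
  "'a measure \<Rightarrow> ('a \<Rightarrow> complex) set \<Rightarrow> ('a \<Rightarrow> complex) set \<Rightarrow> ('a \<Rightarrow> complex) set" where
  "ominus M A B = {f \<in> A. \<forall>g\<in>B. l2_inner M f g = 0}"

definition mult_op :: "('a \<Rightarrow> complex) \<Rightarrow> ('a \<Rightarrow> complex) \<Rightarrow> 'a \<Rightarrow> complex" where
  "mult_op \<phi> f = (\<lambda>x. \<phi> x * f x)"

definition proj ::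
  "'a measure \<Rightarrow> ('a \<Rightarrow> complex) set \<Rightarrow> ('a \<Rightarrow> complex) \<Rightarrow> 'a \<Rightarrow> complex" where
  "proj M Q f = (THE q. q \<in> Q \<and> (\<forall>g\<in>Q. l2_inner M (f - q) g = 0))"

definition adjoint_on ::
  "'a measure \<Rightarrow> ('a \<Rightarrow> complex) set \<Rightarrow> (('a \<Rightarrow> complex) \<Rightarrow> 'a \<Rightarrow> complex)
    \<Rightarrow> ('a \<Rightarrow> complex) \<Rightarrow> 'a \<Rightarrow> complex" where
  "adjoint_on M Q T g = (THE h. h \<in> Q \<and> (\<forall>f\<in>Q. l2_inner M (T f) g = l2_inner M f h))"

definition commutator ::
  "(('a \<Rightarrow> complex) \<Rightarrow> 'a \<Rightarrow> complex) \<Rightarrow> (('a \<Rightarrow> complex) \<Rightarrow> 'a \<Rightarrow> complex)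
    \<Rightarrow> ('a \<Rightarrow> complex) \<Rightarrow> 'a \<Rightarrow> complex" where
  "commutator S T = (\<lambda>f. S (T f) - T (S f))"

definition compact_op ::
  "'a measure \<Rightarrow> ('a \<Rightarrow> complex) set \<Rightarrow> (('a \<Rightarrow> complex) \<Rightarrow> 'a \<Rightarrow> complex) \<Rightarrow> bool" where
  "compact_op M Q T \<longleftrightarrow>
    (\<forall>s. (\<forall>k. s k \<in> Q) \<and> (\<exists>B. \<forall>k. l2_norm M (s k) \<le> B) \<longrightarrow>
      (\<exists>r g. strict_mono (r :: nat \<Rightarrow> nat) \<and> g \<in> Q \<and> l2_tendsto M (\<lambda>k. T (s (r k))) g))"

definition quotient_module ::
  "'a measure \<Rightarrow> ('a \<Rightarrow> complex) set \<Rightarrow> ('a \<Rightarrow> complex) set \<Rightarrow> ('a \<Rightarrow> complex) set \<Rightarrow> bool" where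
  "quotient_module M H \<Phi> Q \<longleftrightarrow>
    closed_subspace M H Q \<and> (\<forall>\<phi>\<in>\<Phi>. mult_op \<phi> ` ominus M H Q \<subseteq> ominus M H Q)"

definition compression ::
  "'a measure \<Rightarrow> ('a \<Rightarrow> complex) set \<Rightarrow> ('a \<Rightarrow> complex) \<Rightarrow> ('a \<Rightarrow> complex) \<Rightarrow> 'a \<Rightarrow> complex" where
  "compression M Q \<phi> = (\<lambda>f. proj M Q (mult_op \<phi> f))"

text \<open>
  Functions on the disc and on the polydisc are extended by 0 to total functions, so that equality
  of elements is equality in HOL. The measures are normalized to total mass 1, which makes
  \<open>(1 - z * cnj w) powi (-2)\<close> and the product of such factors the reproducing kernels.
\<close>

definition disc_measure :: "complex measure" where
  "disc_measure = uniform_measure lborel (ball 0 1)"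

definition bergman_disc :: "(complex \<Rightarrow> complex) set" where
  "bergman_disc = {f. f holomorphic_on ball 0 1 \<and> (\<forall>z. z \<notin> ball 0 1 \<longrightarrow> f z = 0) \<and>
     integrable disc_measure (\<lambda>z. (cmod (f z))\<^sup>2)}"

definition polydisc :: "(complex ^ 'n) set" where
  "polydisc = {z. \<forall>i. z $ i \<in> ball 0 1}"

definition polydisc_measure :: "(complex ^ 'n) measure" where
  "polydisc_measure = uniform_measure lborel polydisc"

definition holomorphic_several_on :: "(complex ^ 'n \<Rightarrow> complex) \<Rightarrow> (complex ^ 'n) set \<Rightarrow> bool" where
  "holomorphic_several_on f U \<longleftrightarrow>
    (\<forall>z\<in>U. \<exists>D. (f has_derivative D) (at z) \<and> (\<forall>c v. D (c *s v) = c * D v))"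

definition bergman_polydisc :: "(complex ^ 'n \<Rightarrow> complex) set" where
  "bergman_polydisc = {f. holomorphic_several_on f polydisc \<and> (\<forall>z. z \<notin> polydisc \<longrightarrow> f z = 0) \<and>
     integrable polydisc_measure (\<lambda>z. (cmod (f z))\<^sup>2)}"

definition coord :: "'n \<Rightarrow> complex ^ 'n \<Rightarrow> complex" where
  "coord i = (\<lambda>z. z $ i)"

definition disc_quotient_module :: "(complex \<Rightarrow> complex) set \<Rightarrow> bool" where
  "disc_quotient_module = quotient_module disc_measure bergman_disc {\<lambda>z. z}"

definition polydisc_quotient_module :: "(complex ^ 'n \<Rightarrow> complex) set \<Rightarrow> bool" where
  "polydisc_quotient_module = quotient_module polydisc_measure bergman_polydisc (range coord)"

text \<open>
  The Hilbert space tensor product inside the Bergman space of the polydisc, where the elementary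
  tensor of the \<open>f i\<close> is the function \<open>z \<mapsto> (\<Prod>i\<in>UNIV. f i (z $ i))\<close>; it vanishes off the polydisc
  because each \<open>f i\<close> vanishes off the disc.
\<close>

definition tensor_prod :: "('n \<Rightarrow> (complex \<Rightarrow> complex) set) \<Rightarrow> (complex ^ 'n \<Rightarrow> complex) set" where
  "tensor_prod Qs = l2_closure polydisc_measure bergman_polydisc
     (cfun.span {(\<lambda>z. \<Prod>i\<in>UNIV. f i (z $ i)) | f. \<forall>i. f i \<in> Qs i})"

abbreviation C_z :: "(complex ^ 'n \<Rightarrow> complex) set \<Rightarrow> 'n \<Rightarrow> (complex ^ 'n \<Rightarrow> complex)
    \<Rightarrow> complex ^ 'n \<Rightarrow> complex" where
  "C_z Q i \<equiv> compression polydisc_measure Q (coord i)"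

definition doubly_commuting :: "(complex ^ 'n::{finite,linorder} \<Rightarrow> complex) set \<Rightarrow> bool" where
  "doubly_commuting Q \<longleftrightarrow> (\<forall>i j. i < j \<longrightarrow>
    (\<forall>f\<in>Q. commutator (C_z Q i) (adjoint_on polydisc_measure Q (C_z Q j)) f = 0))"

definition essentially_normal :: "(complex ^ 'n \<Rightarrow> complex) set \<Rightarrow> bool" where
  "essentially_normal Q \<longleftrightarrow> (\<forall>i j. compact_op polydisc_measure Q
    (commutator (C_z Q i) (adjoint_on polydisc_measure Q (C_z Q j))))"

end

theory Submission
  imports Defs "HOL-Probability.Probability" "HOL-Library.Diagonal_Subsequence"
begin

text \<open>
  Let \<open>C\<close> be the compression of \<open>M\<^sub>z\<close> to a quotient module \<open>Q\<close> of the Bergman space of the disc, \<open>S\<close>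
  the orthogonal complement of \<open>Q\<close> and \<open>A = P\<^sub>S M\<^sub>z\<close> on \<open>Q\<close>. Up to a compact operator the
  self-commutator of \<open>C\<close> is \<open>A\<^sup>* A\<close>. As \<open>M\<^sub>z\<^sup>* M\<^sub>z\<close> is a compact perturbation of the identity, \<open>A\<^sup>*\<close>
  is compact on \<open>z S\<close>, while it is bounded below on \<open>S \<ominus> z S\<close> up to a compact error; so the
  self-commutator is compact iff \<open>S \<ominus> z S\<close> is finite-dimensional. If \<open>C\<close> is normal, the identity \<open>1
  - 2 M\<^sub>z M\<^sub>z\<^sup>* + M\<^sub>z\<^sup>2 M\<^sub>z\<^sup>*\<^sup>2 = 1 \<otimes> 1\<close> shows that an element of \<open>Q\<close> vanishing at 0 is 0, so \<open>dim Q
  \<le> 1\<close>.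

  On a tensor product the commutators act on elementary tensors by the self-commutator of a single
  factor. If some factor is infinite-dimensional, compactness forces the self-commutators of all
  other factors to vanish, hence these factors to be one-dimensional.
\<close>

subsection \<open>Square integrable functions\<close>

text \<open>Invariance of \<open>S\<close> under multiplication by z makes \<open>Q\<close>
  invariant under the adjoint, so the adjoint of the compression is a restriction. Splitting z q
  into its parts in \<open>Q\<close> and \<open>S\<close> turns the self-commutator into the A-term
  minus the compressed self-commutator of the Bergman shift. That the remainders are compact is read
  off from weights: if f_m is the inner product of f with z^m, then the squared norms of f, of z f
  and of the backward shift of f carry the weights m+1, (m+1)^2/(m+2) and m. Their successive
  differences are bounded by 1, while the norm itself has the unbounded weight m+1; hence each
  remainder is small up to finitely many coefficients. Compactness is proved and used through such
  explicit estimates, not through an ideal of operators. On the complement of zS in S the adjoint of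
  A is the backward shift itself, because that shift maps this space into \<open>Q\<close>; this is
  the source of the lower bound. Polar coordinates are avoided: Lebesgue measure is invariant under
  rotations, and averages over roots of unity extract mean values and Taylor coefficients.\<close>

definition L2 :: "'a measure \<Rightarrow> ('a \<Rightarrow> complex) set" where
  "L2 M = {f \<in> borel_measurable M. integrable M (\<lambda>x. (cmod (f x))\<^sup>2)}"

text \<open>Elements are functions and not classes, so definiteness of the norm is a requirement on
  \<open>Q\<close>. Completeness refers to \<open>Q\<close> alone; Bergman spaces, submodules and
  factors can thus be treated alike.\<close>

definition l2_hilbert :: "'a measure \<Rightarrow> ('a \<Rightarrow> complex) set \<Rightarrow> bool" where
  "l2_hilbert M Q \<longleftrightarrow> Q \<subseteq> L2 M \<and> cfun.subspace Q \<and> (\<forall>f\<in>Q. l2_norm M f = 0 \<longrightarrow> f = 0) \<and>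
    (\<forall>s. (\<forall>k. s k \<in> Q) \<longrightarrow> (\<forall>e>0. \<exists>N. \<forall>m\<ge>N. \<forall>n\<ge>N. l2_norm M (s m - s n) < e) \<longrightarrow>
      (\<exists>f\<in>Q. l2_tendsto M s f))"

lemma cmod_add_sq_le: "(cmod (a + b))\<^sup>2 \<le> 2 * (cmod a)\<^sup>2 + 2 * (cmod b)\<^sup>2"
proof -
  have "(cmod (a + b))\<^sup>2 \<le> (cmod a + cmod b)\<^sup>2"
    by (simp add: norm_triangle_ineq power_mono)
  also have "\<dots> \<le> 2 * (cmod a)\<^sup>2 + 2 * (cmod b)\<^sup>2"
    using sum_squares_bound[of "cmod a" "cmod b"] by (simp add: power2_sum)
  finally show ?thesis .
qed

lemma borel_measurable_cnj [measurable]: "f \<in> borel_measurable M \<Longrightarrow> (\<lambda>x. cnj (f x)) \<in> borel_measurable M"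
  by (rule borel_measurable_continuous_on[OF continuous_on_cnj[OF continuous_on_id]])

section \<open>Inner product and norm on square integrable functions\<close>

context
  fixes M :: "'a measure"
begin

abbreviation ip :: "('a \<Rightarrow> complex) \<Rightarrow> ('a \<Rightarrow> complex) \<Rightarrow> complex" where "ip \<equiv> l2_inner M"
abbreviation nm :: "('a \<Rightarrow> complex) \<Rightarrow> real" where "nm \<equiv> l2_norm M"

lemma L2_add: "f \<in> L2 M \<Longrightarrow> g \<in> L2 M \<Longrightarrow> f + g \<in> L2 M"
  unfolding L2_def
proof safe
  assume f[measurable]: "f \<in> borel_measurable M" and g[measurable]: "g \<in> borel_measurable M"
    and i: "integrable M (\<lambda>x. (cmod (f x))\<^sup>2)" "integrable M (\<lambda>x. (cmod (g x))\<^sup>2)"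
  show "f + g \<in> borel_measurable M" unfolding plus_fun_def by measurable
  show "integrable M (\<lambda>x. (cmod ((f + g) x))\<^sup>2)"
    by (rule Bochner_Integration.integrable_bound[of M "\<lambda>x. 2 * (cmod (f x))\<^sup>2 + 2 * (cmod (g x))\<^sup>2"])
      (use i in \<open>auto simp: plus_fun_def cmod_add_sq_le intro!: AE_I2\<close>)
qed

lemma L2_scale: "f \<in> L2 M \<Longrightarrow> (\<lambda>x. c * f x) \<in> L2 M"
  by (auto simp: L2_def norm_mult power_mult_distrib)

lemma L2_diff: "f \<in> L2 M \<Longrightarrow> g \<in> L2 M \<Longrightarrow> f - g \<in> L2 M"
  using L2_add[of f "\<lambda>x. -1 * g x"] L2_scale[of g "-1"]
  by (simp add: fun_diff_def plus_fun_def)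

lemma L2_zero: "0 \<in> L2 M"
  by (auto simp: L2_def zero_fun_def)

lemma subspace_L2: "cfun.subspace (L2 M)"
  by (intro cfun.subspaceI L2_zero L2_add L2_scale)

lemma L2_sum: "(\<And>i. i \<in> I \<Longrightarrow> f i \<in> L2 M) \<Longrightarrow> (\<Sum>i\<in>I. f i) \<in> L2 M"
  by (rule cfun.subspace_sum[OF subspace_L2])

lemma L2_prod_integrable:
  assumes "f \<in> L2 M" "g \<in> L2 M"
  shows "integrable M (\<lambda>x. f x * cnj (g x))"
proof (rule Bochner_Integration.integrable_bound[of M "\<lambda>x. (cmod (f x))\<^sup>2 + (cmod (g x))\<^sup>2"])
  show "integrable M (\<lambda>x. (cmod (f x))\<^sup>2 + (cmod (g x))\<^sup>2)" using assms by (auto simp: L2_def)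
  have [measurable]: "f \<in> borel_measurable M" "g \<in> borel_measurable M" using assms by (auto simp: L2_def)
  show "(\<lambda>x. f x * cnj (g x)) \<in> borel_measurable M" by measurable
  show "AE x in M. norm (f x * cnj (g x)) \<le> norm ((cmod (f x))\<^sup>2 + (cmod (g x))\<^sup>2)"
  proof (rule AE_I2)
    fix x
    have "0 \<le> cmod (f x) * cmod (g x)" by simp
    then show "norm (f x * cnj (g x)) \<le> norm ((cmod (f x))\<^sup>2 + (cmod (g x))\<^sup>2)"
      using sum_squares_bound[of "cmod (f x)" "cmod (g x)"]
          unfolding norm_mult complex_mod_cnj real_norm_def by linarith
  qed
qed

lemma l2_norm_nonneg [simp]: "0 \<le> nm f"
  by (simp add: l2_norm_def)

lemma l2_norm_sq: "(nm f)\<^sup>2 = (LINT x|M. (cmod (f x))\<^sup>2)"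
  by (simp add: l2_norm_def)

lemma l2_inner_self: "ip f f = of_real ((nm f)\<^sup>2)"
proof -
  have "ip f f = (LINT x|M. complex_of_real ((cmod (f x))\<^sup>2))"
    unfolding l2_inner_def by (rule Bochner_Integration.integral_cong) (auto simp:
        complex_norm_square simp del: of_real_power)
  then show ?thesis by (simp only: l2_norm_sq integral_complex_of_real)
qed

lemma l2_inner_add_left: "f \<in> L2 M \<Longrightarrow> g \<in> L2 M \<Longrightarrow> h \<in> L2 M \<Longrightarrow> ip (f + g) h = ip f h + ip g h"
  unfolding l2_inner_def plus_fun_def
  by (subst Bochner_Integration.integral_add[symmetric]) (auto simp: L2_prod_integrable algebra_simps)

lemma l2_inner_diff_left: "f \<in> L2 M \<Longrightarrow> g \<in> L2 M \<Longrightarrow> h \<in> L2 M \<Longrightarrow> ip (f - g) h = ip f h - ip g h"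
  unfolding l2_inner_def fun_diff_def
  by (subst Bochner_Integration.integral_diff[symmetric]) (auto simp: L2_prod_integrable algebra_simps)

lemma l2_inner_scale_left: "ip (\<lambda>x. c * f x) g = c * ip f g"
  unfolding l2_inner_def by (simp add: mult.assoc)

lemma l2_inner_cnj: "cnj (ip f g) = ip g f"
  unfolding l2_inner_def by (subst Bochner_Integration.integral_cnj[symmetric]) (simp add: mult.commute)

lemma l2_inner_add_right: "f \<in> L2 M \<Longrightarrow> g \<in> L2 M \<Longrightarrow> h \<in> L2 M \<Longrightarrow> ip h (f + g) = ip h f + ip h g"
  using l2_inner_add_left[of f g h] by (metis complex_cnj_add l2_inner_cnj)

lemma l2_inner_diff_right: "f \<in> L2 M \<Longrightarrow> g \<in> L2 M \<Longrightarrow> h \<in> L2 M \<Longrightarrow> ip h (f - g) = ip h f - ip h g"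
  using l2_inner_diff_left[of f g h] by (metis complex_cnj_diff l2_inner_cnj)

lemma l2_inner_scale_right: "ip g (\<lambda>x. c * f x) = cnj c * ip g f"
  using l2_inner_scale_left[of c f g] by (metis complex_cnj_mult l2_inner_cnj)

lemma l2_inner_zero_left [simp]: "ip 0 f = 0" and l2_inner_zero_right [simp]: "ip f 0 = 0"
  by (simp_all add: l2_inner_def)

lemma l2_inner_sum_left:
  assumes "finite I" "\<And>i. i \<in> I \<Longrightarrow> f i \<in> L2 M" "h \<in> L2 M"
  shows "ip (\<Sum>i\<in>I. f i) h = (\<Sum>i\<in>I. ip (f i) h)"
  using assms by (induction I) (auto simp: l2_inner_add_left L2_sum)

lemma l2_norm_zero [simp]: "nm 0 = 0"
  by (simp add: l2_norm_def)

lemma l2_norm_scale: "nm (\<lambda>x. c * f x) = cmod c * nm f"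
  by (simp add: l2_norm_def norm_mult power_mult_distrib real_sqrt_mult)

lemma l2_norm_minus_commute: "nm (f - g) = nm (g - f)"
  by (simp add: l2_norm_def norm_minus_commute)

lemma l2_norm_add_sq:
  assumes "f \<in> L2 M" "g \<in> L2 M"
  shows "(nm (f + g))\<^sup>2 = (nm f)\<^sup>2 + 2 * Re (ip f g) + (nm g)\<^sup>2"
proof -
  have "complex_of_real ((nm (f + g))\<^sup>2) = ip (f + g) (f + g)" by (simp only: l2_inner_self)
  also have "\<dots> = ip f f + (ip f g + cnj (ip f g)) + ip g g"
    using assms by (simp add: l2_inner_add_left l2_inner_add_right L2_add l2_inner_cnj)
  also have "\<dots> = of_real ((nm f)\<^sup>2 + 2 * Re (ip f g) + (nm g)\<^sup>2)"
    by (simp add: l2_inner_self complex_add_cnj)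
  finally show ?thesis by (simp only: of_real_eq_iff)
qed

lemma l2_norm_diff_sq:
  assumes "f \<in> L2 M" "g \<in> L2 M"
  shows "(nm (f - g))\<^sup>2 = (nm f)\<^sup>2 - 2 * Re (ip f g) + (nm g)\<^sup>2"
proof -
  have "f - g = f + (\<lambda>x. -1 * g x)" by (simp add: fun_eq_iff)
  then show ?thesis
    using l2_norm_add_sq[OF assms(1) L2_scale[OF assms(2), of "-1"]]
    by (simp only: l2_inner_scale_right l2_norm_scale) simp
qed

lemma l2_Cauchy_Schwarz:
  assumes "f \<in> L2 M" "g \<in> L2 M"
  shows "cmod (ip f g) \<le> nm f * nm g"
proof -
  have "cmod (ip f g) \<le> (LINT x|M. cmod (f x * cnj (g x)))"
    unfolding l2_inner_def by (rule integral_norm_bound)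
  also have "\<dots> = (LINT x|M. cmod (f x) * cmod (g x))" by (simp add: norm_mult)
  also have "\<dots> \<le> sqrt (LINT x|M. (cmod (f x))\<^sup>2) * sqrt (LINT x|M. (cmod (g x))\<^sup>2)"
  proof -
    have i: "integrable M (\<lambda>x. cmod (f x) * cmod (g x))"
      using integrable_norm[OF L2_prod_integrable[OF assms]] by (simp add: norm_mult)
    \<comment> \<open>The integral of (|f| - t|g|)^2 as a quadratic polynomial in t; its
      nonnegativity at the minimum t = b/c is the claim.\<close>
    have q: "0 \<le> (LINT x|M. (cmod (f x))\<^sup>2) - 2 * t * (LINT x|M. cmod (f x) * cmod (g x))
        + t\<^sup>2 * (LINT x|M. (cmod (g x))\<^sup>2)" for t
    proof -
      have "0 \<le> (LINT x|M. (cmod (f x) - t * cmod (g x))\<^sup>2)" by simp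
      also have "(\<lambda>x. (cmod (f x) - t * cmod (g x))\<^sup>2) =
         (\<lambda>x. (cmod (f x))\<^sup>2 - (2 * t) * (cmod (f x) * cmod (g x)) + t\<^sup>2 * (cmod (g x))\<^sup>2)"
        by (simp add: fun_eq_iff power2_eq_square algebra_simps)
      also have "(LINT x|M. \<dots> x) = (LINT x|M. (cmod (f x))\<^sup>2) - 2 * t * (LINT x|M. cmod (f x) * cmod (g x))
        + t\<^sup>2 * (LINT x|M. (cmod (g x))\<^sup>2)"
        using assms i by (simp add: L2_def)
      finally show ?thesis .
    qed
    define a b c where "a = (LINT x|M. (cmod (f x))\<^sup>2)" and "b = (LINT x|M. cmod (f x) * cmod (g x))"
      and "c = (LINT x|M. (cmod (g x))\<^sup>2)"
    have nn: "0 \<le> a" "0 \<le> b" "0 \<le> c" by (auto simp: a_def b_def c_def)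
    have q': "0 \<le> a - 2 * t * b + t\<^sup>2 * c" for t using q[of t] by (simp add: a_def b_def c_def)
    have "b\<^sup>2 \<le> a * c"
    proof (cases "c = 0")
      case True
      have "b = 0"
      proof (rule ccontr)
        assume "b \<noteq> 0"
        \<comment> \<open>For c = 0 the polynomial is linear in t, and this t gives it the value
          -1.\<close>
        then show False using q'[of "(a + 1) / (2 * b)"] True nn by (simp add: field_simps)
      qed
      then show ?thesis using True by simp
    next
      case False
      then have "c > 0" using nn by simp
      have "0 \<le> (a - 2 * (b/c) * b + (b/c)\<^sup>2 * c) * c" using q'[of "b / c"] nn by simp
      also have "\<dots> = a * c - b\<^sup>2" using \<open>c > 0\<close> by (simp add: field_simps power2_eq_square)
      finally show ?thesis by simp
    qed
    then have "b \<le> sqrt (a * c)" by (rule real_le_rsqrt)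
    then show ?thesis by (simp add: real_sqrt_mult a_def b_def c_def)
  qed
  finally show ?thesis by (simp add: l2_norm_def)
qed

lemma l2_norm_triangle:
  assumes "f \<in> L2 M" "g \<in> L2 M"
  shows "nm (f + g) \<le> nm f + nm g"
proof (rule power2_le_imp_le)
  have "Re (ip f g) \<le> nm f * nm g"
    using l2_Cauchy_Schwarz[OF assms] complex_Re_le_cmod[of "ip f g"] by linarith
  then show "(nm (f + g))\<^sup>2 \<le> (nm f + nm g)\<^sup>2"
    by (simp add: l2_norm_add_sq[OF assms] power2_sum)
qed simp

lemma l2_norm_triangle_diff:
  assumes "f \<in> L2 M" "g \<in> L2 M" "h \<in> L2 M"
  shows "nm (f - h) \<le> nm (f - g) + nm (g - h)"
  using l2_norm_triangle[of "f - g" "g - h"] assms by (simp add: L2_diff)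

lemma l2_tendsto_inner:
  assumes "l2_tendsto M s f" "\<And>k. s k \<in> L2 M" "f \<in> L2 M" "g \<in> L2 M"
  shows "(\<lambda>k. ip (s k) g) \<longlonglongrightarrow> ip f g"
proof -
  have "(\<lambda>k. ip (s k - f) g) \<longlonglongrightarrow> 0"
  proof (rule Lim_null_comparison)
    show "\<forall>\<^sub>F k in sequentially. norm (ip (s k - f) g) \<le> nm (s k - f) * nm g"
      using assms by (intro always_eventually allI l2_Cauchy_Schwarz L2_diff)
    show "(\<lambda>k. nm (s k - f) * nm g) \<longlonglongrightarrow> 0"
      using assms(1) unfolding l2_tendsto_def by (rule tendsto_mult_left_zero)
  qed
  then have "(\<lambda>k. ip (s k) g - ip f g) \<longlonglongrightarrow> 0" using assms by (simp add: l2_inner_diff_left)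
  then show ?thesis by (simp add: LIM_zero_iff)
qed

lemma l2_tendsto_Cauchy:
  assumes "l2_tendsto M s f" "\<And>k. s k \<in> L2 M" "f \<in> L2 M" "e > 0"
  shows "\<exists>N. \<forall>m\<ge>N. \<forall>n\<ge>N. nm (s m - s n) < e"
proof -
  from assms(1,4) obtain N where N: "\<And>k. k \<ge> N \<Longrightarrow> nm (s k - f) < e / 2"
    unfolding l2_tendsto_def LIMSEQ_iff by (metis abs_of_nonneg diff_zero half_gt_zero
        l2_norm_nonneg real_norm_def)
  have "nm (s m - s n) < e" if "m \<ge> N" "n \<ge> N" for m n
    using l2_norm_triangle_diff[of "s m" f "s n"] N[OF that(1)] N[OF that(2)] assms
    by (simp add: l2_norm_minus_commute[of f])
  then show ?thesis by blast
qed

end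

lemma l2_hilbert_L2: "l2_hilbert M Q \<Longrightarrow> f \<in> Q \<Longrightarrow> f \<in> L2 M"
  by (auto simp: l2_hilbert_def)

lemma l2_hilbert_subspace: "l2_hilbert M Q \<Longrightarrow> cfun.subspace Q"
  by (simp add: l2_hilbert_def)

lemma l2_hilbert_eq0: "l2_hilbert M Q \<Longrightarrow> f \<in> Q \<Longrightarrow> l2_norm M f = 0 \<Longrightarrow> f = 0"
  by (simp add: l2_hilbert_def)

lemma l2_hilbert_complete:
  "l2_hilbert M Q \<Longrightarrow> (\<And>k. s k \<in> Q) \<Longrightarrow>
   (\<And>e. e > 0 \<Longrightarrow> \<exists>N. \<forall>m\<ge>N. \<forall>n\<ge>N. l2_norm M (s m - s n) < e) \<Longrightarrow> \<exists>f\<in>Q. l2_tendsto M s f"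
  by (simp add: l2_hilbert_def)

lemma l2_hilbert_closed_subspace:
  assumes "l2_hilbert M H" "closed_subspace M H Q"
  shows "l2_hilbert M Q"
proof -
  have sub: "Q \<subseteq> H" "cfun.subspace Q" and cl: "l2_closure M H Q \<subseteq> Q"
    using assms(2) by (auto simp: closed_subspace_def)
  have "\<exists>f\<in>Q. l2_tendsto M s f" if "\<forall>k. s k \<in> Q" "\<forall>e>0. \<exists>N. \<forall>m\<ge>N. \<forall>n\<ge>N. l2_norm M (s m - s n) < e" for s
  proof -
    have "s k \<in> H" for k using that sub by blast
    then have "\<exists>f\<in>H. l2_tendsto M s f"
      by (rule l2_hilbert_complete[OF assms(1)]) (use that(2) in simp)
    then obtain f where "f \<in> H" "l2_tendsto M s f" by blast
    then have "f \<in> l2_closure M H Q" using that by (auto simp: l2_closure_def)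
    then show ?thesis using cl \<open>l2_tendsto M s f\<close> by blast
  qed
  then show ?thesis using assms(1) sub by (auto simp: l2_hilbert_def)
qed

subsection \<open>Orthogonal projections\<close>

text \<open>A minimizing sequence for the distance is Cauchy by the parallelogram law, its limit
  attains the distance, and a first-variation argument at the minimum gives orthogonality.\<close>

lemma l2_projection_exists:
  assumes Q: "l2_hilbert M Q" and x: "x \<in> L2 M"
  shows "\<exists>q\<in>Q. \<forall>g\<in>Q. l2_inner M (x - q) g = 0"
proof -
  define d where "d = (INF q\<in>Q. (l2_norm M (x - q))\<^sup>2)"
  have sub: "cfun.subspace Q" using Q by (rule l2_hilbert_subspace)
  have QL: "\<And>q. q \<in> Q \<Longrightarrow> q \<in> L2 M" using Q by (rule l2_hilbert_L2)
  have ne: "Q \<noteq> {}" using cfun.subspace_0[OF sub] by auto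
  have dle: "d \<le> (l2_norm M (x - q))\<^sup>2" if "q \<in> Q" for q
    unfolding d_def by (rule cINF_lower[OF _ that]) (auto intro!: bdd_belowI[of _ 0])
  have "\<exists>q\<in>Q. (l2_norm M (x - q))\<^sup>2 < d + 1 / Suc k" for k
  proof -
    have "d < d + 1 / Suc k" by simp
    then show ?thesis unfolding d_def[symmetric]
      using cInf_lessD[of "(\<lambda>q. (l2_norm M (x - q))\<^sup>2) ` Q" "d + 1 / Suc k"] ne by (auto simp: d_def)
  qed
  then obtain q where q: "\<And>k. q k \<in> Q" "\<And>k. (l2_norm M (x - q k))\<^sup>2 < d + 1 / Suc k" by metis
  have par: "(l2_norm M (q m - q n))\<^sup>2 \<le> 2 / Suc m + 2 / Suc n" for m n
  proof -
    \<comment> \<open>The midpoint belongs to \<open>Q\<close>, so its distance to x is at least the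
      infimum; this bounds one term of the parallelogram law from below.\<close>
    define h where "h = (\<lambda>t. (1/2) * (q m + q n) t)"
    have hQ: "h \<in> Q" unfolding h_def using q sub by (intro cfun.subspace_scale cfun.subspace_add)
    define u v where "u = x - q m" and "v = x - q n"
    have uv: "u \<in> L2 M" "v \<in> L2 M" unfolding u_def v_def using QL q x by (auto intro: L2_diff)
    have "(l2_norm M (u - v))\<^sup>2 + (l2_norm M (u + v))\<^sup>2 = 2 * (l2_norm M u)\<^sup>2 + 2 * (l2_norm M v)\<^sup>2"
      using uv by (simp add: l2_norm_add_sq l2_norm_diff_sq)
    moreover have "u + v = (\<lambda>t. 2 * (x - h) t)"
      by (simp add: u_def v_def h_def fun_eq_iff field_simps)
    moreover have "l2_norm M (u - v) = l2_norm M (q m - q n)"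
      using l2_norm_minus_commute[of M "q m" "q n"] by (simp add: u_def v_def)
    moreover have "(l2_norm M (\<lambda>t. 2 * (x - h) t))\<^sup>2 = 4 * (l2_norm M (x - h))\<^sup>2"
      by (subst l2_norm_scale) (simp add: power_mult_distrib)
    ultimately have "(l2_norm M (q m - q n))\<^sup>2 + 4 * (l2_norm M (x - h))\<^sup>2 = 2 * (l2_norm M u)\<^sup>2
        + 2 * (l2_norm M v)\<^sup>2"
      by simp
    then show ?thesis using dle[OF hQ] q(2)[of m] q(2)[of n] unfolding u_def v_def by simp
  qed
  have "\<exists>f\<in>Q. l2_tendsto M q f"
  proof (rule l2_hilbert_complete[OF Q q(1)])
    fix e :: real assume e: "e > 0"
    obtain N where N: "4 / e\<^sup>2 < real N" using reals_Archimedean2 by blast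
    have "l2_norm M (q m - q n) < e" if "m \<ge> N" "n \<ge> N" for m n
    proof (rule power2_less_imp_less)
      have "0 < 4 / e\<^sup>2" using e by simp
      then have Np: "0 < real N" using N by linarith
      have "2 / Suc m \<le> 2 / real (Suc N)" "2 / Suc n \<le> 2 / real (Suc N)"
        using that by (auto intro!: divide_left_mono)
      moreover have "2 / real (Suc N) < 2 / real N" using Np by (simp add: field_simps)
      ultimately have "(l2_norm M (q m - q n))\<^sup>2 < 4 / real N" using par[of m n] by linarith
      also have "\<dots> < e\<^sup>2" using N e Np by (simp add: field_simps)
      finally show "(l2_norm M (q m - q n))\<^sup>2 < e\<^sup>2" .
    qed (use e in simp)
    then show "\<exists>N. \<forall>m\<ge>N. \<forall>n\<ge>N. l2_norm M (q m - q n) < e" by blast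
  qed
  then obtain p where p: "p \<in> Q" "l2_tendsto M q p" by blast
  have min: "(l2_norm M (x - p))\<^sup>2 \<le> d"
  proof -
    have lim: "(\<lambda>k. sqrt (d + 1 / Suc k) + l2_norm M (q k - p)) \<longlonglongrightarrow> sqrt (d + 0) + 0"
      using p(2) unfolding l2_tendsto_def
      by (intro tendsto_add tendsto_real_sqrt tendsto_const)
          (use LIMSEQ_inverse_real_of_nat in \<open>simp_all add: inverse_eq_divide\<close>)
    have "l2_norm M (x - p) \<le> sqrt (d + 1 / Suc k) + l2_norm M (q k - p)" for k
    proof -
      have "l2_norm M (x - q k) \<le> sqrt (d + 1 / Suc k)"
        using q(2)[of k] by (intro real_le_rsqrt) simp
      then show ?thesis
        using l2_norm_triangle_diff[of x M "q k" p] x QL q(1) p(1) by (smt (verit))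
    qed
    then have "l2_norm M (x - p) \<le> sqrt d" using LIMSEQ_le_const[OF lim] by auto
    moreover have "0 \<le> d" unfolding d_def using ne by (intro cINF_greatest) auto
    ultimately show ?thesis by (metis l2_norm_nonneg power_mono real_sqrt_pow2)
  qed
  have "l2_inner M (x - p) g = 0" if g: "g \<in> Q" for g
  proof (rule ccontr)
    define a where "a = l2_inner M (x - p) g"
    assume "l2_inner M (x - p) g \<noteq> 0"
    then have a0: "0 < (cmod a)\<^sup>2" by (simp add: a_def)
    \<comment> \<open>Moving p by t a g changes the squared distance by -2t|a|^2 + t^2|a|^2|g|^2.
      This choice keeps t|g|^2 at most 1, so the change would be negative.\<close>
    define t where "t = 1 / (1 + (l2_norm M g)\<^sup>2)"
    have gp: "0 < 1 + (l2_norm M g)\<^sup>2" by (smt (verit) zero_le_power2)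
    then have t0: "t > 0" by (simp add: t_def)
    define c where "c = of_real t * a"
    have pc: "p + (\<lambda>z. c * g z) \<in> Q" using sub p g by (intro cfun.subspace_add cfun.subspace_scale)
    have xp: "x - p \<in> L2 M" using x p QL by (auto intro: L2_diff)
    have "x - (p + (\<lambda>z. c * g z)) = (x - p) - (\<lambda>z. c * g z)" by (simp add: fun_eq_iff)
    then have "(l2_norm M (x - (p + (\<lambda>z. c * g z))))\<^sup>2 = (l2_norm M (x - p))\<^sup>2 - 2 * Re (cnj c * a)
        + (cmod c)\<^sup>2 * (l2_norm M g)\<^sup>2"
      using l2_norm_diff_sq[OF xp L2_scale[OF QL[OF g], of c]]
      by (simp only: l2_inner_scale_right l2_norm_scale power_mult_distrib a_def)
    moreover have "cnj c * a = of_real (t * (cmod a)\<^sup>2)"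
      by (simp add: c_def complex_norm_square mult_ac del: of_real_power)
    moreover have "(cmod c)\<^sup>2 = t\<^sup>2 * (cmod a)\<^sup>2" by (simp add: c_def norm_mult power_mult_distrib)
    ultimately have "2 * (t * (cmod a)\<^sup>2) \<le> t\<^sup>2 * (cmod a)\<^sup>2 * (l2_norm M g)\<^sup>2"
      using dle[OF pc] min by simp
    then have "(t * (cmod a)\<^sup>2) * 2 \<le> (t * (cmod a)\<^sup>2) * (t * (l2_norm M g)\<^sup>2)"
      by (simp add: power2_eq_square mult_ac)
    then have "2 \<le> t * (l2_norm M g)\<^sup>2"
      using t0 a0 by (subst (asm) mult_le_cancel_left_pos) auto
    moreover have "t * (l2_norm M g)\<^sup>2 \<le> 1" unfolding t_def using gp by (simp add: field_simps)
    ultimately show False by linarith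
  qed
  then show ?thesis using p(1) by blast
qed

text \<open>Two candidates differ by an element of \<open>Q\<close> orthogonal to itself, hence 0.
  Values of projections are computed below by guessing the value and checking orthogonality.\<close>

lemma proj_unique:
  assumes Q: "l2_hilbert M Q" and "x \<in> L2 M" "q \<in> Q" "\<And>g. g \<in> Q \<Longrightarrow> l2_inner M (x - q) g = 0"
  shows "proj M Q x = q"
  unfolding Defs.proj_def
proof (rule the_equality)
  show "q \<in> Q \<and> (\<forall>g\<in>Q. l2_inner M (x - q) g = 0)" using assms by blast
  fix p assume p: "p \<in> Q \<and> (\<forall>g\<in>Q. l2_inner M (x - p) g = 0)"
  note L = l2_hilbert_L2[OF Q]
  have pq: "p - q \<in> Q" using p assms l2_hilbert_subspace[OF Q] cfun.subspace_diff by blast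
  have "l2_inner M (p - q) (p - q) = l2_inner M (x - q) (p - q) - l2_inner M (x - p) (p - q)"
    using L pq p assms by (simp add: l2_inner_diff_left)
  also have "\<dots> = 0" using p pq assms by simp
  finally have "l2_norm M (p - q) = 0" by (simp add: l2_inner_self)
  then show "p = q" using l2_hilbert_eq0[OF Q pq] by simp
qed

lemma
  assumes Q: "l2_hilbert M Q" and x: "x \<in> L2 M"
  shows proj_in: "proj M Q x \<in> Q"
    and proj_orth: "g \<in> Q \<Longrightarrow> l2_inner M (x - proj M Q x) g = 0"
proof -
  obtain q where "q \<in> Q" "\<forall>g\<in>Q. l2_inner M (x - q) g = 0" using l2_projection_exists[OF assms] by blast
  moreover from this have "proj M Q x = q" using proj_unique[OF assms] by blast
  ultimately show "proj M Q x \<in> Q" "g \<in> Q \<Longrightarrow> l2_inner M (x - proj M Q x) g = 0" by auto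
qed

lemma proj_inner:
  assumes Q: "l2_hilbert M Q" and x: "x \<in> L2 M" and g: "g \<in> Q"
  shows "l2_inner M (proj M Q x) g = l2_inner M x g"
    and "l2_inner M g (proj M Q x) = l2_inner M g x"
proof -
  show *: "l2_inner M (proj M Q x) g = l2_inner M x g"
    using proj_orth[OF assms] proj_in[OF Q x] l2_hilbert_L2[OF Q] g x by (simp add: l2_inner_diff_left)
  show "l2_inner M g (proj M Q x) = l2_inner M g x"
    using * by (metis l2_inner_cnj)
qed

lemma proj_diff:
  assumes Q: "l2_hilbert M Q" and "x \<in> L2 M" "y \<in> L2 M"
  shows "proj M Q (x - y) = proj M Q x - proj M Q y"
proof (rule proj_unique[OF Q])
  note L = l2_hilbert_L2[OF Q]
  show "proj M Q x - proj M Q y \<in> Q"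
    using assms proj_in[OF Q] l2_hilbert_subspace[OF Q] cfun.subspace_diff by blast
  fix g assume g: "g \<in> Q"
  show "l2_inner M (x - y - (proj M Q x - proj M Q y)) g = 0"
    using assms g proj_in[OF Q] L by (simp add: l2_inner_diff_left L2_diff proj_inner[OF Q])
qed (use assms in \<open>auto intro: L2_diff\<close>)

lemma proj_scale:
  assumes Q: "l2_hilbert M Q" and "x \<in> L2 M"
  shows "proj M Q (\<lambda>z. c * x z) = (\<lambda>z. c * proj M Q x z)"
proof (rule proj_unique[OF Q])
  note L = l2_hilbert_L2[OF Q]
  show "(\<lambda>z. c * proj M Q x z) \<in> Q"
    using assms proj_in[OF Q] l2_hilbert_subspace[OF Q] cfun.subspace_scale by blast
  fix g assume g: "g \<in> Q"
  show "l2_inner M ((\<lambda>z. c * x z) - (\<lambda>z. c * proj M Q x z)) g = 0"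
    using assms g proj_in[OF Q] L
    by (simp add: l2_inner_diff_left L2_scale l2_inner_scale_left proj_inner[OF Q])
qed (use assms in \<open>auto intro: L2_scale\<close>)

lemma proj_norm_le:
  assumes Q: "l2_hilbert M Q" and x: "x \<in> L2 M"
  shows "l2_norm M (proj M Q x) \<le> l2_norm M x"
proof -
  let ?p = "proj M Q x"
  have p: "?p \<in> Q" using proj_in[OF assms] .
  have "(l2_norm M ?p)\<^sup>2 = cmod (l2_inner M ?p ?p)" by (simp only: l2_inner_self norm_of_real) simp
  also have "l2_inner M ?p ?p = l2_inner M x ?p" using proj_inner[OF assms p] by simp
  also have "cmod \<dots> \<le> l2_norm M x * l2_norm M ?p"
    using l2_Cauchy_Schwarz[OF x l2_hilbert_L2[OF Q p]] .
  finally have "l2_norm M ?p * l2_norm M ?p \<le> l2_norm M x * l2_norm M ?p" by (simp add: power2_eq_square)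
  then show ?thesis
    by (metis l2_norm_nonneg mult_right_le_imp_le order_le_less)
qed

text \<open>Orthogonality to a fixed vector survives limits. No structure is imposed on
  \<open>B\<close>, so that it may be a quotient module as well as an image under multiplication by
  z.\<close>

lemma l2_hilbert_ominus:
  assumes H: "l2_hilbert M H" and B: "B \<subseteq> L2 M"
  shows "l2_hilbert M (ominus M H B)"
proof -
  note L = l2_hilbert_L2[OF H] and sub = l2_hilbert_subspace[OF H]
  have "cfun.subspace (ominus M H B)"
  proof (rule cfun.subspaceI)
    show "0 \<in> ominus M H B" using cfun.subspace_0[OF sub] by (simp add: ominus_def)
    fix f g c assume f: "f \<in> ominus M H B" and g: "g \<in> ominus M H B"
    show "f + g \<in> ominus M H B"
      using f g B L cfun.subspace_add[OF sub] by (auto simp: ominus_def l2_inner_add_left subset_iff)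
    show "(\<lambda>x. c * f x) \<in> ominus M H B"
      using f cfun.subspace_scale[OF sub] by (auto simp: ominus_def l2_inner_scale_left)
  qed
  moreover have "\<exists>f\<in>ominus M H B. l2_tendsto M s f"
    if s: "\<And>k. s k \<in> ominus M H B" and C: "\<And>e. e > 0 \<Longrightarrow> \<exists>N. \<forall>m\<ge>N. \<forall>n\<ge>N. l2_norm M (s m - s n) < e" for s
  proof -
    have sH: "s k \<in> H" for k using s by (simp add: ominus_def)
    obtain f where f: "f \<in> H" "l2_tendsto M s f" using l2_hilbert_complete[OF H sH C] by blast
    have "l2_inner M f g = 0" if "g \<in> B" for g
    proof -
      have "(\<lambda>k. l2_inner M (s k) g) \<longlonglongrightarrow> l2_inner M f g"
        using that B by (intro l2_tendsto_inner[OF f(2) L[OF sH] L[OF f(1)]]) auto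
      moreover have "l2_inner M (s k) g = 0" for k using s that by (simp add: ominus_def)
      ultimately show ?thesis by (simp add: LIMSEQ_const_iff)
    qed
    then show ?thesis using f by (auto simp: ominus_def)
  qed
  ultimately show ?thesis
    using H unfolding l2_hilbert_def by (auto simp: ominus_def)
qed

text \<open>The difference of h and its projection lies in the complement, so it is orthogonal to h
  and to the projection, and therefore to itself. Membership in a quotient module is later shown by
  testing against its complement.\<close>

lemma ominus_ominus:
  assumes H: "l2_hilbert M H" and Q: "l2_hilbert M Q" "Q \<subseteq> H"
    and h: "h \<in> H" "\<And>s. s \<in> ominus M H Q \<Longrightarrow> l2_inner M h s = 0"
  shows "h \<in> Q"
proof -
  note L = l2_hilbert_L2[OF H]
  define p where "p = proj M Q h"
  have p: "p \<in> Q" unfolding p_def by (rule proj_in[OF Q(1) L[OF h(1)]])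
  have pH: "p \<in> H" using p Q by auto
  have dH: "h - p \<in> H" using cfun.subspace_diff[OF l2_hilbert_subspace[OF H] h(1) pH] .
  have o: "l2_inner M (h - p) g = 0" if "g \<in> Q" for g unfolding p_def
      by (rule proj_orth[OF Q(1) L[OF h(1)] that])
  have "h - p \<in> ominus M H Q" using dH o by (simp add: ominus_def)
  then have "l2_inner M h (h - p) = 0" by (rule h(2))
  moreover have "l2_inner M p (h - p) = 0" using o[OF p] by (metis complex_cnj_zero l2_inner_cnj)
  ultimately have "l2_inner M (h - p) (h - p) = 0"
    using L h(1) pH dH by (simp add: l2_inner_diff_left)
  then have "l2_norm M (h - p) = 0" by (simp add: l2_inner_self)
  then have "h - p = 0" using l2_hilbert_eq0[OF H dH] by simp
  then show ?thesis using p by simp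
qed

lemma l2_inner_commute_zero: "l2_inner M f g = 0 \<Longrightarrow> l2_inner M g f = 0"
  by (metis complex_cnj_zero l2_inner_cnj)

subsection \<open>Compressions of multiplication operators\<close>

lemma mult_op_L2:
  assumes f: "f \<in> L2 M" and \<phi>: "\<phi> \<in> borel_measurable M" "AE x in M. cmod (\<phi> x) \<le> 1"
  shows "mult_op \<phi> f \<in> L2 M" "l2_norm M (mult_op \<phi> f) \<le> l2_norm M f"
proof -
  have [measurable]: "f \<in> borel_measurable M" "\<phi> \<in> borel_measurable M" and i:
      "integrable M (\<lambda>x. (cmod (f x))\<^sup>2)"
    using assms by (auto simp: L2_def)
  have b: "AE x in M. (cmod (\<phi> x * f x))\<^sup>2 \<le> (cmod (f x))\<^sup>2"
    using \<phi>(2) by eventually_elim (auto simp: norm_mult intro!: power_mono mult_left_le_one_le)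
  have i2: "integrable M (\<lambda>x. (cmod (\<phi> x * f x))\<^sup>2)"
    by (rule Bochner_Integration.integrable_bound[OF i]) (use b in auto)
  then show "mult_op \<phi> f \<in> L2 M" by (auto simp: L2_def mult_op_def)
  show "l2_norm M (mult_op \<phi> f) \<le> l2_norm M f"
    unfolding l2_norm_def mult_op_def using integral_mono_AE[OF i2 i b] by simp
qed

lemma mult_op_inner: "l2_inner M (mult_op \<phi> f) g = l2_inner M f (mult_op (\<lambda>x. cnj (\<phi> x)) g)"
  unfolding l2_inner_def mult_op_def by (simp add: mult_ac)

lemma mult_op_diff: "mult_op \<phi> (f - g) = mult_op \<phi> f - mult_op \<phi> g"
  by (simp add: mult_op_def fun_eq_iff algebra_simps)

lemma mult_op_scale: "mult_op \<phi> (\<lambda>x. c * f x) = (\<lambda>x. c * mult_op \<phi> f x)"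
  by (simp add: mult_op_def fun_eq_iff algebra_simps)

context
  fixes M :: "'a measure" and Q and \<phi> :: "'a \<Rightarrow> complex"
  assumes Q: "l2_hilbert M Q" and \<phi>: "\<phi> \<in> borel_measurable M" "AE x in M. cmod (\<phi> x) \<le> 1"
begin

lemma compression_in: "f \<in> Q \<Longrightarrow> compression M Q \<phi> f \<in> Q"
  unfolding compression_def by (intro proj_in Q mult_op_L2 \<phi> l2_hilbert_L2[OF Q])

lemma compression_norm_le: "f \<in> Q \<Longrightarrow> l2_norm M (compression M Q \<phi> f) \<le> l2_norm M f"
  unfolding compression_def
  using proj_norm_le[OF Q mult_op_L2(1)[OF l2_hilbert_L2[OF Q] \<phi>]] mult_op_L2(2)[OF l2_hilbert_L2[OF Q] \<phi>]
  by force

lemma compression_diff: "f \<in> Q \<Longrightarrow> g \<in> Q \<Longrightarrow>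
    compression M Q \<phi> (f - g) = compression M Q \<phi> f - compression M Q \<phi> g"
  unfolding compression_def by (simp add: mult_op_diff proj_diff[OF Q] mult_op_L2(1)[OF _ \<phi>]
      l2_hilbert_L2[OF Q])

lemma compression_scale: "f \<in> Q \<Longrightarrow>
    compression M Q \<phi> (\<lambda>x. c * f x) = (\<lambda>x. c * compression M Q \<phi> f x)"
  unfolding compression_def by (simp add: mult_op_scale proj_scale[OF Q] mult_op_L2(1)[OF _ \<phi>]
      l2_hilbert_L2[OF Q])

lemma compression_inner: "f \<in> Q \<Longrightarrow> g \<in> Q \<Longrightarrow>
    l2_inner M (compression M Q \<phi> f) g = l2_inner M (mult_op \<phi> f) g"
  "f \<in> Q \<Longrightarrow> g \<in> Q \<Longrightarrow>
    l2_inner M g (compression M Q \<phi> f) = l2_inner M g (mult_op \<phi> f)"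
  unfolding compression_def by (simp_all add: proj_inner[OF Q] mult_op_L2(1)[OF _ \<phi>] l2_hilbert_L2[OF Q])

end

lemma compression_adjoint:
  assumes Q: "l2_hilbert M Q" and \<phi>: "\<phi> \<in> borel_measurable M" "AE x in M. cmod (\<phi> x) \<le> 1"
    and "f \<in> Q" "g \<in> Q"
  shows "l2_inner M (compression M Q \<phi> f) g = l2_inner M f (compression M Q (\<lambda>x. cnj (\<phi> x)) g)"
proof -
  have c: "(\<lambda>x. cnj (\<phi> x)) \<in> borel_measurable M" "AE x in M. cmod (cnj (\<phi> x)) \<le> 1" using \<phi> by auto
  show ?thesis
    using compression_inner(1)[OF Q \<phi>] compression_inner(2)[OF Q c] assms mult_op_inner by metis
qed

text \<open>The adjoint is again a compression, with conjugate symbol. That symbol is not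
  holomorphic, which is why compressions are developed for arbitrary measurable symbols bounded by
  1.\<close>

lemma adjoint_on_compression:
  assumes Q: "l2_hilbert M Q" and \<phi>: "\<phi> \<in> borel_measurable M" "AE x in M. cmod (\<phi> x) \<le> 1"
    and g: "g \<in> Q"
  shows "adjoint_on M Q (compression M Q \<phi>) g = compression M Q (\<lambda>x. cnj (\<phi> x)) g"
  unfolding adjoint_on_def
proof (rule the_equality)
  have c: "(\<lambda>x. cnj (\<phi> x)) \<in> borel_measurable M" "AE x in M. cmod (cnj (\<phi> x)) \<le> 1" using \<phi> by auto
  let ?h = "compression M Q (\<lambda>x. cnj (\<phi> x)) g"
  have h: "?h \<in> Q" using compression_in[OF Q c g] .
  show "?h \<in> Q \<and> (\<forall>f\<in>Q. l2_inner M (compression M Q \<phi> f) g = l2_inner M f ?h)"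
    using h compression_adjoint[OF Q \<phi> _ g] by blast
  fix h assume a: "h \<in> Q \<and> (\<forall>f\<in>Q. l2_inner M (compression M Q \<phi> f) g = l2_inner M f h)"
  have d: "h - ?h \<in> Q" using a h l2_hilbert_subspace[OF Q] cfun.subspace_diff by blast
  then have "l2_inner M (h - ?h) h = l2_inner M (h - ?h) ?h"
    using a compression_adjoint[OF Q \<phi> _ g] by metis
  then have "l2_inner M (h - ?h) (h - ?h) = 0"
    using a d h l2_hilbert_L2[OF Q] by (simp add: l2_inner_diff_right)
  then have "l2_norm M (h - ?h) = 0" by (simp add: l2_inner_self)
  then show "h = ?h" using l2_hilbert_eq0[OF Q d] by simp
qed

subsection \<open>Orthonormal families\<close>

lemma sum_fun_apply: "(\<Sum>i\<in>I. f i) x = (\<Sum>i\<in>I. f i x)" for f :: "'i \<Rightarrow> 'a \<Rightarrow> 'b::comm_monoid_add"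
  by (induction I rule: infinite_finite_induct) auto

text \<open>Gram-Schmidt applied to a finite basis. Only the expansion formula and the normalization
  are exported; the orthogonality relations live inside the induction.\<close>

lemma orthonormal_basis_exists:
  assumes H: "l2_hilbert M H" and "V \<subseteq> H" "cfun.subspace V" and "finite_dim V"
  shows "\<exists>F. finite F \<and> F \<subseteq> V \<and> (\<forall>u\<in>F. l2_norm M u = 1) \<and>
    (\<forall>f\<in>V. f = (\<Sum>u\<in>F. (\<lambda>x. l2_inner M f u * u x)))"
proof -
  have V: "V \<subseteq> L2 M" "cfun.subspace V" and V0: "\<And>f. f \<in> V \<Longrightarrow> l2_norm M f = 0 \<Longrightarrow> f = 0"
    using assms l2_hilbert_L2 l2_hilbert_eq0[OF H] by blast+
  obtain B0 where B0: "finite B0" "V \<subseteq> cfun.span B0" using \<open>finite_dim V\<close> by (auto simp: finite_dim_def)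
  obtain B where B: "B \<subseteq> V" "cfun.independent B" "V \<subseteq> cfun.span B"
    using cfun.maximal_independent_subset[of V] by blast
  have "finite B" using cfun.independent_span_bound[OF B0(1) B(2)] B B0 by blast
  \<comment> \<open>The vectors reproduced by their expansion along F form a subspace, so it is
    enough to capture a spanning set.\<close>
  define W where "W F = {f \<in> V. f = (\<Sum>u\<in>F. (\<lambda>x. l2_inner M f u * u x))}" for F
  have Wsub: "cfun.subspace (W F)" if "finite F" "F \<subseteq> V" for F
  proof (rule cfun.subspaceI)
    show "0 \<in> W F" using cfun.subspace_0[OF V(2)] by (simp add: W_def zero_fun_def[symmetric])
    fix f g c assume f: "f \<in> W F" and g: "g \<in> W F"
    have fg: "f \<in> L2 M" "g \<in> L2 M" "f \<in> V" "g \<in> V" using f g V by (auto simp: W_def)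
    have FL: "u \<in> L2 M" if "u \<in> F" for u using that \<open>F \<subseteq> V\<close> V by auto
    have fe: "f x = (\<Sum>u\<in>F. l2_inner M f u * u x)" for x
    proof -
      have "f = (\<Sum>u\<in>F. (\<lambda>x. l2_inner M f u * u x))" using f by (simp add: W_def)
      then have "f x = (\<Sum>u\<in>F. (\<lambda>x. l2_inner M f u * u x)) x" by (rule fun_cong)
      then show ?thesis by (simp add: sum_fun_apply)
    qed
    have ge: "g x = (\<Sum>u\<in>F. l2_inner M g u * u x)" for x
    proof -
      have "g = (\<Sum>u\<in>F. (\<lambda>x. l2_inner M g u * u x))" using g by (simp add: W_def)
      then have "g x = (\<Sum>u\<in>F. (\<lambda>x. l2_inner M g u * u x)) x" by (rule fun_cong)
      then show ?thesis by (simp add: sum_fun_apply)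
    qed
    have "(\<Sum>u\<in>F. l2_inner M (f + g) u * u x) = f x + g x" for x
      unfolding fe[of x] ge[of x] sum.distrib[symmetric]
      by (rule sum.cong) (use FL fg in \<open>auto simp: l2_inner_add_left algebra_simps\<close>)
    then show "f + g \<in> W F"
      using fg cfun.subspace_add[OF V(2)] by (auto simp: W_def fun_eq_iff sum_fun_apply)
    have "(\<Sum>u\<in>F. l2_inner M (\<lambda>x. c * f x) u * u x) = c * f x" for x
      unfolding fe[of x] by (simp add: l2_inner_scale_left sum_distrib_left mult.assoc)
    then show "(\<lambda>x. c * f x) \<in> W F"
      using fg cfun.subspace_scale[OF V(2)] by (auto simp: W_def fun_eq_iff sum_fun_apply)
  qed
  have "\<exists>F. finite F \<and> F \<subseteq> V \<and> (\<forall>u\<in>F. l2_norm M u = 1) \<and> (\<forall>u\<in>F. \<forall>v\<in>F. u \<noteq> v \<longrightarrow> l2_inner M u v = 0) \<and> B \<subseteq> W F"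
    using \<open>finite B\<close> B(1)
  proof (induction B)
    case empty
    show ?case by (rule exI[of _ "{}"]) auto
  next
    case (insert b B)
    then obtain F where F: "finite F" "F \<subseteq> V" "\<forall>u\<in>F. l2_norm M u = 1"
        "\<forall>u\<in>F. \<forall>v\<in>F. u \<noteq> v \<longrightarrow> l2_inner M u v = 0" "B \<subseteq> W F" by auto
    have bV: "b \<in> V" using insert by auto
    have FL: "u \<in> L2 M" if "u \<in> F" for u using that F V by auto
    \<comment> \<open>p is the component of b along F and r the residue: either r = 0 and F already
      reproduces b, or the normalized residue joins F.\<close>
    define p where "p = (\<Sum>u\<in>F. (\<lambda>x. l2_inner M b u * u x))"
    have pV: "p \<in> V" unfolding p_def
      using F by (intro cfun.subspace_sum[OF V(2)] cfun.subspace_scale[OF V(2)]) auto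
    define r where "r = b - p"
    have rV: "r \<in> V" unfolding r_def using bV pV cfun.subspace_diff[OF V(2)] by blast
    have L: "b \<in> L2 M" "p \<in> L2 M" "r \<in> L2 M" using V bV pV rV by auto
    have pu: "l2_inner M p u = l2_inner M b u" if u: "u \<in> F" for u
    proof -
      have "l2_inner M p u = (\<Sum>v\<in>F. l2_inner M b v * l2_inner M v u)"
        unfolding p_def using F FL u by (subst l2_inner_sum_left) (auto simp: l2_inner_scale_left L2_scale)
      also have "\<dots> = (\<Sum>v\<in>F. if v = u then l2_inner M b u else 0)"
        by (rule sum.cong) (use F u in \<open>auto simp: l2_inner_self\<close>)
      finally show ?thesis using F u by simp
    qed
    have ru: "l2_inner M r u = 0" if u: "u \<in> F" for u
      using pu[OF u] L FL[OF u] by (simp add: r_def l2_inner_diff_left)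
    show ?case
    proof (cases "r = 0")
      case True
      then have "b = p" by (simp add: r_def)
      then have "b \<in> W F" using bV by (simp add: W_def p_def)
      then show ?thesis using F by (intro exI[of _ F]) auto
    next
      case False
      then have n0: "l2_norm M r \<noteq> 0" using V0[OF rV] by blast
      define u0 where "u0 = (\<lambda>x. of_real (1 / l2_norm M r) * r x)"
      have u0V: "u0 \<in> V" unfolding u0_def using rV cfun.subspace_scale[OF V(2)] by blast
      have u0n: "l2_norm M u0 = 1" unfolding u0_def using n0 by (simp only: l2_norm_scale norm_of_real) simp
      have u0o: "l2_inner M u0 u = 0" "l2_inner M u u0 = 0" if "u \<in> F" for u
      proof -
        show "l2_inner M u0 u = 0" unfolding u0_def using ru[OF that] by (simp only: l2_inner_scale_left) simp
        then show "l2_inner M u u0 = 0" by (metis complex_cnj_zero l2_inner_cnj)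
      qed
      have u0F: "u0 \<notin> F"
        using u0o u0n by (force simp: l2_inner_self)
      have sums: "(\<Sum>u\<in>insert u0 F. (\<lambda>x. l2_inner M f u * u x)) = (\<lambda>x. l2_inner M f u0 * u0 x)
          + (\<Sum>u\<in>F. (\<lambda>x. l2_inner M f u * u x))" for f
        using F(1) u0F by simp
      have WF: "f \<in> W (insert u0 F)" if f: "f \<in> W F" for f
      proof -
        have fV: "f \<in> V" and fe: "f = (\<Sum>u\<in>F. (\<lambda>x. l2_inner M f u * u x))" using f by (auto simp: W_def)
        have "l2_inner M f u0 = (\<Sum>v\<in>F. l2_inner M f v * l2_inner M v u0)"
          by (subst fe, subst l2_inner_sum_left)
            (use F FL u0V V in \<open>auto simp: l2_inner_scale_left intro!: L2_scale\<close>)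
        also have "\<dots> = 0" using u0o by simp
        finally have "l2_inner M f u0 = 0" .
        then show ?thesis unfolding W_def sums using fV fe by (simp add: zero_fun_def[symmetric])
      qed
      have "b \<in> W (insert u0 F)"
      proof -
        have "l2_inner M b u0 = l2_inner M r u0 + l2_inner M p u0"
          using L u0V V by (simp add: r_def l2_inner_diff_left subset_iff)
        also have "l2_inner M p u0 = 0"
          unfolding p_def by (subst l2_inner_sum_left)
            (use F FL u0V V u0o in \<open>auto simp: l2_inner_scale_left intro!: L2_scale\<close>)
        also have "l2_inner M r u0 = of_real (l2_norm M r)"
          unfolding u0_def using n0 by (simp only: l2_inner_scale_right l2_inner_self) (simp add:
              power2_eq_square)
        finally have bi: "l2_inner M b u0 = of_real (l2_norm M r)" by simp
        have "b = r + p" by (simp add: r_def)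
        moreover have "(\<lambda>x. l2_inner M b u0 * u0 x) = r"
          unfolding bi using n0 by (simp add: fun_eq_iff u0_def)
        ultimately show ?thesis unfolding W_def sums using bV p_def by simp
      qed
      then show ?thesis
        using F u0V u0n u0o WF by (intro exI[of _ "insert u0 F"]) auto
    qed
  qed
  then obtain F where F: "finite F" "F \<subseteq> V" "\<forall>u\<in>F. l2_norm M u = 1" "B \<subseteq> W F" by blast
  have "V \<subseteq> W F" using cfun.span_minimal[OF F(4) Wsub[OF F(1,2)]] B(3) by blast
  then have "\<forall>f\<in>V. f = (\<Sum>u\<in>F. (\<lambda>x. l2_inner M f u * u x))" unfolding W_def by blast
  then show ?thesis using F by blast
qed

text \<open>The finitely many expansion coefficients pass to the limit, so the limit q and its
  expansion p have the same inner products with every test function.\<close>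

lemma finite_dim_closed:
  assumes H: "l2_hilbert M H" and V: "V \<subseteq> H" "cfun.subspace V" "finite_dim V"
  shows "l2_closure M H V \<subseteq> V"
proof
  fix q assume "q \<in> l2_closure M H V"
  then obtain s where q: "q \<in> H" and s: "\<And>k. s k \<in> V" "l2_tendsto M s q" by (auto simp: l2_closure_def)
  note L = l2_hilbert_L2[OF H]
  have sL: "s k \<in> L2 M" for k using s V L by blast
  obtain F where F: "finite F" "F \<subseteq> V" "\<forall>f\<in>V. f = (\<Sum>u\<in>F. (\<lambda>x. l2_inner M f u * u x))"
    using orthonormal_basis_exists[OF H V] by (elim exE conjE)
  have FL: "u \<in> L2 M" if "u \<in> F" for u using that F V L by blast
  define p where "p = (\<Sum>u\<in>F. (\<lambda>x. l2_inner M q u * u x))"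
  have pV: "p \<in> V" unfolding p_def using F by (intro cfun.subspace_sum[OF V(2)]
      cfun.subspace_scale[OF V(2)]) auto
  have "l2_inner M q h = l2_inner M p h" if h: "h \<in> L2 M" for h
  proof -
    have "l2_inner M (s k) h = (\<Sum>u\<in>F. l2_inner M (s k) u * l2_inner M u h)" for k
    proof -
      have e: "s k = (\<Sum>u\<in>F. (\<lambda>x. l2_inner M (s k) u * u x))" using F(3) s(1) by blast
      show ?thesis by (subst e, subst l2_inner_sum_left)
          (use F FL h in \<open>auto simp: l2_inner_scale_left intro!: L2_scale\<close>)
    qed
    moreover have "(\<lambda>k. \<Sum>u\<in>F. l2_inner M (s k) u * l2_inner M u h) \<longlonglongrightarrow> (\<Sum>u\<in>F. l2_inner M q u * l2_inner M u h)"
      by (intro tendsto_sum tendsto_mult_right l2_tendsto_inner[OF s(2) sL L[OF q]] FL)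
    moreover have "(\<Sum>u\<in>F. l2_inner M q u * l2_inner M u h) = l2_inner M p h"
      unfolding p_def by (subst l2_inner_sum_left) (use F FL h in \<open>auto simp: l2_inner_scale_left
          intro!: L2_scale\<close>)
    ultimately have "(\<lambda>k. l2_inner M (s k) h) \<longlonglongrightarrow> l2_inner M p h" by simp
    then show ?thesis using l2_tendsto_inner[OF s(2) sL L[OF q] h] LIMSEQ_unique by blast
  qed
  note e = this
  have pH: "p \<in> H" using pV V by blast
  have d: "q - p \<in> H" using cfun.subspace_diff[OF l2_hilbert_subspace[OF H] q pH] .
  have "l2_inner M (q - p) (q - p) = 0"
    using e[OF L[OF d]] L q pH d by (simp add: l2_inner_diff_left)
  then have "l2_norm M (q - p) = 0" by (simp add: l2_inner_self)
  then have "q - p = 0" using l2_hilbert_eq0[OF H d] by blast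
  then show "q \<in> V" using pV by simp
qed

text \<open>One linear condition lowers the dimension by at most one. The induction therefore
  carries the stronger claim that the joint kernel is still infinite-dimensional.\<close>

lemma orthogonal_vector_exists:
  assumes V: "V \<subseteq> L2 M" "cfun.subspace V" and nf: "\<not> finite_dim V" and F: "finite F" "F \<subseteq> L2 M"
  shows "\<exists>v\<in>V. v \<noteq> 0 \<and> (\<forall>x\<in>F. l2_inner M v x = 0)"
proof -
  define W where "W F = {v \<in> V. \<forall>x\<in>F. l2_inner M v x = 0}" for F
  have "\<not> finite_dim (W F)" using F
  proof (induction F)
    case empty
    then show ?case using nf by (simp add: W_def)
  next
    case (insert x F)
    have nW: "\<not> finite_dim (W F)" using insert by auto
    show ?case
    proof
      assume "finite_dim (W (insert x F))"
      then obtain B where B: "finite B" "W (insert x F) \<subseteq> cfun.span B" by (auto simp: finite_dim_def)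
      have xL: "x \<in> L2 M" and FL: "F \<subseteq> L2 M" using insert by auto
      show False
      proof (cases "\<forall>v\<in>W F. l2_inner M v x = 0")
        case True
        then have "W F \<subseteq> W (insert x F)" by (auto simp: W_def)
        then show False using nW B by (auto simp: finite_dim_def)
      next
        case False
        then obtain v0 where v0: "v0 \<in> W F" "l2_inner M v0 x \<noteq> 0" by blast
        have "v \<in> cfun.span (insert v0 B)" if v: "v \<in> W F" for v
        proof -
          \<comment> \<open>Chosen so that subtracting c v0 from v removes its inner product with x
            while preserving orthogonality to F.\<close>
          define c where "c = l2_inner M v x / l2_inner M v0 x"
          have VL: "v \<in> V" "v0 \<in> V" "v \<in> L2 M" "v0 \<in> L2 M" using v v0 V by (auto simp: W_def)
          define w where "w = v - (\<lambda>z. c * v0 z)"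
          have "l2_inner M w y = 0" if "y \<in> insert x F" for y
          proof -
            have "y \<in> L2 M" using that xL FL by auto
            then have "l2_inner M w y = l2_inner M v y - c * l2_inner M v0 y"
              unfolding w_def using VL by (simp add: l2_inner_diff_left L2_scale l2_inner_scale_left)
            then show ?thesis using that v v0 by (auto simp: W_def c_def)
          qed
          moreover have "w \<in> V" unfolding w_def
            using VL V(2) by (intro cfun.subspace_diff cfun.subspace_scale)
          ultimately have "w \<in> cfun.span B" using B by (auto simp: W_def)
          then have w: "w \<in> cfun.span (insert v0 B)" using cfun.span_mono[of B "insert v0 B"] by auto
          have "(\<lambda>z. c * v0 z) \<in> cfun.span (insert v0 B)"
            by (intro cfun.span_scale cfun.span_base) simp
          then have "w + (\<lambda>z. c * v0 z) \<in> cfun.span (insert v0 B)" using w cfun.span_add by blast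
          then show ?thesis by (simp add: w_def)
        qed
        then have "W F \<subseteq> cfun.span (insert v0 B)" by blast
        then show False using nW B(1) unfolding finite_dim_def by blast
      qed
    qed
  qed
  moreover have "finite_dim (W F)" if "W F \<subseteq> {0}"
    using that unfolding finite_dim_def
    by (intro exI[of _ "{}"]) auto
  ultimately show ?thesis by (auto simp: W_def)
qed

text \<open>Recursive choice of a unit vector orthogonal to all previous ones. Such sequences are
  the test objects that detect failure of compactness.\<close>

lemma orthonormal_sequence_exists:
  assumes H: "l2_hilbert M V" and nf: "\<not> finite_dim V"
  shows "\<exists>u::nat \<Rightarrow> _. (\<forall>k. u k \<in> V \<and> l2_norm M (u k) = 1) \<and> (\<forall>j k. j \<noteq> k \<longrightarrow> l2_inner M (u j) (u k) = 0)"
proof -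
  have V: "V \<subseteq> L2 M" "cfun.subspace V" and V0: "\<And>f. f \<in> V \<Longrightarrow> l2_norm M f = 0 \<Longrightarrow> f = 0"
    using H l2_hilbert_L2 l2_hilbert_subspace l2_hilbert_eq0[OF H] by blast+
  have ex: "\<exists>v\<in>V. l2_norm M v = 1 \<and> (\<forall>x\<in>F. l2_inner M v x = 0)" if F: "finite F" "F \<subseteq> V" for F
  proof -
    obtain v where v: "v \<in> V" "v \<noteq> 0" "\<forall>x\<in>F. l2_inner M v x = 0"
      using orthogonal_vector_exists[OF V(1,2) nf F(1)] F V by blast
    have "l2_norm M v \<noteq> 0" using V0 v by blast
    then show ?thesis
      using v cfun.subspace_scale[OF V(2) v(1), of "of_real (1 / l2_norm M v)"]
      by (intro bexI[of _ "\<lambda>x. of_real (1 / l2_norm M v) * v x"])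
        (simp_all only: l2_norm_scale l2_inner_scale_left norm_of_real, simp)
  qed
  have "\<exists>u::nat \<Rightarrow> _. \<forall>k. (u k \<in> V \<and> l2_norm M (u k) = 1 \<and> (\<forall>j<k. l2_inner M (u k) (u j) = 0))"
  proof (rule dependent_wellorder_choice)
    fix k :: nat and f assume IH: "\<And>j. j < k \<Longrightarrow> f j \<in> V \<and> l2_norm M (f j) = 1
        \<and> (\<forall>i<j. l2_inner M (f j) (f i) = 0)"
    show "\<exists>x. x \<in> V \<and> l2_norm M x = 1 \<and> (\<forall>j<k. l2_inner M x (f j) = 0)"
    proof -
      have "f ` {..<k} \<subseteq> V" using IH by blast
      from ex[OF finite_imageI[OF finite_lessThan] this] show ?thesis
      proof (elim bexE conjE)
        fix v assume "v \<in> V" "l2_norm M v = 1" and o: "\<forall>x\<in>f ` {..<k}. l2_inner M v x = 0"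
        moreover have "\<forall>j<k. l2_inner M v (f j) = 0" using o by simp
        ultimately show ?thesis by (intro exI[of _ v] conjI)
      qed
    qed
  qed simp
  then obtain u where U: "\<forall>k::nat. (u k \<in> V \<and> l2_norm M (u k) = 1 \<and> (\<forall>j<k. l2_inner M (u k) (u j) = 0))" ..
  have u: "u k \<in> V" "l2_norm M (u k) = 1" "j < k \<Longrightarrow> l2_inner M (u k) (u j) = 0" for j k
    using spec[OF U, of k] by simp_all
  have "l2_inner M (u j) (u k) = 0" if "j \<noteq> k" for j k
    using u(3)[of j k] u(3)[of k j] that l2_inner_cnj[of M "u k" "u j"] by (cases "j < k") auto
  then show ?thesis using u(1,2) by (intro exI[of _ u] conjI allI impI)
qed

text \<open>Kept as an equation: it yields Bessel's inequality, and applied to partial sums it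
  computes the increments needed for Parseval's formula.\<close>

lemma Bessel_finite:
  assumes u: "\<And>k. u k \<in> L2 M" "\<And>k. l2_norm M (u k) = 1" "\<And>j k. j \<noteq> k \<Longrightarrow> l2_inner M (u j) (u k) = 0"
    and f: "f \<in> L2 M" and I: "finite I"
  shows "(l2_norm M (f - (\<Sum>k\<in>I. (\<lambda>x. l2_inner M f (u k) * u k x))))\<^sup>2
      = (l2_norm M f)\<^sup>2 - (\<Sum>k\<in>I. (cmod (l2_inner M f (u k)))\<^sup>2)"
proof -
  define p where "p = (\<Sum>k\<in>I. (\<lambda>x. l2_inner M f (u k) * u k x))"
  have pL: "p \<in> L2 M" unfolding p_def by (intro L2_sum L2_scale u)
  have pu: "l2_inner M p (u j) = l2_inner M f (u j)" if "j \<in> I" for j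
  proof -
    have "l2_inner M p (u j) = (\<Sum>k\<in>I. l2_inner M f (u k) * l2_inner M (u k) (u j))"
      unfolding p_def using u I by (subst l2_inner_sum_left) (auto simp: l2_inner_scale_left L2_scale)
    also have "\<dots> = (\<Sum>k\<in>I. if k = j then l2_inner M f (u j) else 0)"
      by (rule sum.cong) (use u in \<open>auto simp: l2_inner_self\<close>)
    finally show ?thesis using that I by simp
  qed
  have e: "l2_inner M p g = (\<Sum>k\<in>I. l2_inner M f (u k) * l2_inner M (u k) g)" if "g \<in> L2 M" for g
    unfolding p_def using u I that by (subst l2_inner_sum_left) (auto simp: l2_inner_scale_left L2_scale)
  have c: "l2_inner M f (u k) * l2_inner M (u k) f = of_real ((cmod (l2_inner M f (u k)))\<^sup>2)" for k
    by (metis complex_norm_square l2_inner_cnj)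
  have pf: "l2_inner M p f = of_real (\<Sum>k\<in>I. (cmod (l2_inner M f (u k)))\<^sup>2)"
    by (simp only: e[OF f] c of_real_sum)
  have pp: "l2_inner M p p = l2_inner M p f"
  proof -
    have "l2_inner M (u k) p = l2_inner M (u k) f" if "k \<in> I" for k
      using pu[OF that] by (metis l2_inner_cnj)
    then show ?thesis using e[OF pL] e[OF f] by simp
  qed
  then have 1: "(l2_norm M p)\<^sup>2 = (\<Sum>k\<in>I. (cmod (l2_inner M f (u k)))\<^sup>2)"
    unfolding pf l2_inner_self by (simp only: of_real_eq_iff)
  have "l2_inner M f p = cnj (l2_inner M p f)" by (simp add: l2_inner_cnj)
  then have 2: "Re (l2_inner M f p) = (\<Sum>k\<in>I. (cmod (l2_inner M f (u k)))\<^sup>2)" unfolding pf by simp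
  show ?thesis
    unfolding p_def[symmetric] using l2_norm_diff_sq[OF f pL] 1 2 by simp
qed

text \<open>The coefficients are square summable. In other words, an orthonormal sequence is weakly
  null.\<close>

lemma Bessel_tendsto:
  assumes u: "\<And>k. u k \<in> L2 M" "\<And>k. l2_norm M (u k) = 1" "\<And>j k. j \<noteq> k \<Longrightarrow> l2_inner M (u j) (u k) = 0"
    and f: "f \<in> L2 M"
  shows "(\<lambda>k. l2_inner M f (u k)) \<longlonglongrightarrow> 0"
proof -
  have "(\<Sum>k<n. (cmod (l2_inner M f (u k)))\<^sup>2) \<le> (l2_norm M f)\<^sup>2" for n
    using Bessel_finite[of u M f "{..<n}"] u f
    by (smt (verit) finite_lessThan zero_le_power2)
  then have "summable (\<lambda>k. (cmod (l2_inner M f (u k)))\<^sup>2)"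
    by (intro summableI_nonneg_bounded) auto
  then have "(\<lambda>k. (cmod (l2_inner M f (u k)))\<^sup>2) \<longlonglongrightarrow> 0" by (rule summable_LIMSEQ_zero)
  then have "(\<lambda>k. cmod (l2_inner M f (u k))) \<longlonglongrightarrow> 0"
    using tendsto_real_sqrt[of "\<lambda>k. (cmod (l2_inner M f (u k)))\<^sup>2" 0] by simp
  then show ?thesis by (rule tendsto_norm_zero_cancel)
qed

text \<open>Squared distances of partial sums are blocks of a convergent series, so the partial sums
  have a limit in \<open>H\<close>. It has the coefficients of f, and totality identifies it with
  f.\<close>

lemma Parseval:
  assumes H: "l2_hilbert M H" and u: "\<And>k. u k \<in> H" "\<And>k. l2_norm M (u k) = 1"
      "\<And>j k. j \<noteq> k \<Longrightarrow> l2_inner M (u j) (u k) = 0"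
    and total: "\<And>f. f \<in> H \<Longrightarrow> (\<And>k. l2_inner M f (u k) = 0) \<Longrightarrow> f = 0"
    and f: "f \<in> H" and g: "g \<in> H"
  shows "(\<lambda>k::nat. l2_inner M f (u k) * cnj (l2_inner M g (u k))) sums l2_inner M f g"
proof -
  note L = l2_hilbert_L2[OF H] and sub = l2_hilbert_subspace[OF H]
  define c where "c k = l2_inner M f (u k)" for k
  define p where "p n = (\<Sum>k<n. (\<lambda>x. c k * u k x))" for n
  have uL: "u k \<in> L2 M" for k using u L by blast
  have pH: "p n \<in> H" for n unfolding p_def by (intro cfun.subspace_sum[OF sub] cfun.subspace_scale[OF sub] u)
  have pi: "l2_inner M (p n) h = (\<Sum>k<n. c k * l2_inner M (u k) h)" if "h \<in> L2 M" for n h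
    unfolding p_def using uL that by (subst l2_inner_sum_left) (auto simp: l2_inner_scale_left L2_scale)
  have pu: "l2_inner M (p n) (u j) = (if j < n then c j else 0)" for n j
  proof -
    have "l2_inner M (p n) (u j) = (\<Sum>k<n. if k = j then c j else 0)"
      unfolding pi[OF uL] by (rule sum.cong) (use u in \<open>auto simp: l2_inner_self\<close>)
    then show ?thesis by simp
  qed
  have pdiff: "(l2_norm M (p m - p n))\<^sup>2 = (\<Sum>k<m. (cmod (c k))\<^sup>2) - (\<Sum>k<n. (cmod (c k))\<^sup>2)" if "n \<le> m" for m n
  proof -
    have a: "(\<Sum>k<n. (\<lambda>x. l2_inner M (p m) (u k) * u k x)) = p n"
      unfolding pu unfolding p_def using that by (intro sum.cong) auto
    have b: "(\<Sum>k<n. (cmod (l2_inner M (p m) (u k)))\<^sup>2) = (\<Sum>k<n. (cmod (c k))\<^sup>2)"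
      unfolding pu using that by (intro sum.cong) auto
    have a': "(\<Sum>k<m. (\<lambda>x. l2_inner M (p m) (u k) * u k x)) = p m"
      unfolding pu unfolding p_def by (intro sum.cong) auto
    have b': "(\<Sum>k<m. (cmod (l2_inner M (p m) (u k)))\<^sup>2) = (\<Sum>k<m. (cmod (c k))\<^sup>2)"
      unfolding pu by (intro sum.cong) auto
    have "(l2_norm M (p m))\<^sup>2 = (\<Sum>k<m. (cmod (c k))\<^sup>2)"
      using Bessel_finite[of u M "p m" "{..<m}"] uL u L[OF pH] by (simp add: a' b')
    then show ?thesis using Bessel_finite[of u M "p m" "{..<n}"] uL u L[OF pH] by (simp add: a b)
  qed
  have "(\<Sum>k<n. (cmod (c k))\<^sup>2) \<le> (l2_norm M f)\<^sup>2" for n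
    using Bessel_finite[of u M f "{..<n}"] uL u L[OF f] unfolding c_def
    by (smt (verit) finite_lessThan zero_le_power2)
  then have "summable (\<lambda>k. (cmod (c k))\<^sup>2)" by (intro summableI_nonneg_bounded) auto
  then have Cau: "Cauchy (\<lambda>n. \<Sum>k<n. (cmod (c k))\<^sup>2)"
    by (simp add: summable_iff_convergent Cauchy_convergent_iff)
  have "\<exists>q\<in>H. l2_tendsto M p q"
  proof (rule l2_hilbert_complete[OF H pH])
    fix e :: real assume e: "e > 0"
    then have "0 < e\<^sup>2" by simp
    from CauchyD[OF Cau this] obtain N where N: "\<forall>m\<ge>N. \<forall>n\<ge>N. norm ((\<Sum>k<m. (cmod (c k))\<^sup>2) - (\<Sum>k<n.
        (cmod (c k))\<^sup>2)) < e\<^sup>2" ..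
    have *: "l2_norm M (p m - p n) < e" if "m \<ge> N" "n \<ge> N" "n \<le> m" for m n
    proof (rule power2_less_imp_less)
      show "(l2_norm M (p m - p n))\<^sup>2 < e\<^sup>2" using N that pdiff[OF that(3)] by fastforce
    qed (use e in simp)
    have "l2_norm M (p m - p n) < e" if "m \<ge> N" "n \<ge> N" for m n
      using *[of m n] *[of n m] that l2_norm_minus_commute[of M "p m" "p n"] by (cases "n \<le> m") auto
    then show "\<exists>N. \<forall>m\<ge>N. \<forall>n\<ge>N. l2_norm M (p m - p n) < e" by blast
  qed
  then obtain q where q: "q \<in> H" "l2_tendsto M p q" by blast
  have lim: "(\<lambda>n. l2_inner M (p n) h) \<longlonglongrightarrow> l2_inner M q h" if "h \<in> L2 M" for h
    using l2_tendsto_inner[OF q(2) L[OF pH] L[OF q(1)] that] .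
  have "f - q = 0"
  proof (rule total)
    show "f - q \<in> H" using cfun.subspace_diff[OF sub f q(1)] .
    fix k
    have "(\<lambda>n. l2_inner M (p n) (u k)) \<longlonglongrightarrow> c k"
      unfolding pu by (rule tendsto_eventually) (auto simp: eventually_sequentially intro!: exI[of _ "Suc k"])
    then have "l2_inner M q (u k) = c k" using lim[OF uL] LIMSEQ_unique by blast
    then show "l2_inner M (f - q) (u k) = 0" using L f q uL by (simp add: l2_inner_diff_left c_def)
  qed
  then have "f = q" by simp
  then have "(\<lambda>n. \<Sum>k<n. c k * l2_inner M (u k) g) \<longlonglongrightarrow> l2_inner M f g"
    using lim[OF L[OF g]] by (simp add: pi[OF L[OF g]])
  then show ?thesis unfolding sums_def c_def l2_inner_cnj .
qed

subsection \<open>Compactness\<close>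

lemma weakly_convergent_subsequence:
  assumes s: "\<And>k. s k \<in> L2 M" "\<And>k. l2_norm M (s k) \<le> B" and F: "\<And>n::nat. finite (F n)" "\<And>n. F n \<subseteq> L2 M"
  shows "\<exists>r. strict_mono (r::nat \<Rightarrow> nat) \<and> (\<forall>n. \<forall>x\<in>F n. convergent (\<lambda>k. l2_inner M (s (r k)) x))"
proof -
  define P where "P n r \<longleftrightarrow> (\<forall>x\<in>F n. convergent (\<lambda>k. l2_inner M (s (r k)) x))" for n and r :: "nat \<Rightarrow> nat"
  interpret subseqs P
  proof
    fix n and t :: "nat \<Rightarrow> nat" assume t: "strict_mono t"
    \<comment> \<open>Refinement for a single finite family: one application of Bolzano-Weierstrass
      per vector, the inner products being bounded by Cauchy-Schwarz.\<close>
    have "\<exists>r'. strict_mono (r'::nat\<Rightarrow>nat) \<and> (\<forall>x\<in>G. convergent (\<lambda>k. l2_inner M (s (t (r' k))) x))"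
      if "finite G" "G \<subseteq> L2 M" for G
      using that
    proof (induction G)
      case empty
      show ?case by (rule exI[of _ id]) (auto simp: strict_mono_def)
    next
      case (insert x G)
      then obtain r' where r': "strict_mono (r'::nat\<Rightarrow>nat)"
          "\<forall>x\<in>G. convergent (\<lambda>k. l2_inner M (s (t (r' k))) x)" by auto
      have "bounded (range (\<lambda>k. l2_inner M (s (t (r' k))) x))"
      proof (rule boundedI)
        fix y assume "y \<in> range (\<lambda>k. l2_inner M (s (t (r' k))) x)"
        then obtain k where "y = l2_inner M (s (t (r' k))) x" by auto
        then have "norm y \<le> l2_norm M (s (t (r' k))) * l2_norm M x"
          using l2_Cauchy_Schwarz s insert by auto
        also have "\<dots> \<le> B * l2_norm M x" using s by (intro mult_right_mono) auto
        finally show "norm y \<le> B * l2_norm M x" .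
      qed
      then obtain l r2 where r2: "strict_mono (r2::nat\<Rightarrow>nat)" "((\<lambda>k. l2_inner M (s (t (r' k))) x) \<circ> r2) \<longlonglongrightarrow> l"
        using bounded_imp_convergent_subsequence by blast
      have "convergent (\<lambda>k. l2_inner M (s (t (r' (r2 k)))) y)" if "y \<in> insert x G" for y
      proof (cases "y = x")
        case True
        then show ?thesis using r2(2) by (auto simp: convergent_def o_def)
      next
        case False
        then have "y \<in> G" using that by simp
        then show ?thesis using r'(2) convergent_subseq_convergent[OF _ r2(1), of
            "\<lambda>k. l2_inner M (s (t (r' k))) y"]
          by (auto simp: o_def)
      qed
      moreover have "strict_mono (r' \<circ> r2)" using r'(1) r2(1) by (rule strict_mono_o)
      ultimately show ?case by (intro exI[of _ "r' \<circ> r2"]) (auto simp: o_def)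
    qed
    from this[OF F(1) F(2), of n] show "\<exists>r'. strict_mono r' \<and> P n (t \<circ> r')" by (auto simp: P_def o_def)
  qed
  \<comment> \<open>After dropping finitely many terms the diagonal sequence is a subsequence of the
    n-th refinement, and convergence ignores initial terms.\<close>
  have "P n (diagseq \<circ> ((+) (Suc n)))" for n
  proof (rule diagseq_holds)
    fix r t :: "nat \<Rightarrow> nat" and n assume r: "strict_mono r" and "P n t"
    then show "P n (t \<circ> r)"
      unfolding P_def using convergent_subseq_convergent[OF _ r, of "\<lambda>k. l2_inner M (s (t k)) _"]
          by (auto simp: o_def)
  qed
  then have "convergent (\<lambda>k. l2_inner M (s (diagseq k)) x)" if "x \<in> F n" for n x
    using that convergent_ignore_initial_segment[of "\<lambda>k. l2_inner M (s (diagseq k)) x" "Suc n"]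
    unfolding P_def o_def add.commute[of _ "Suc n"] by blast
  then show ?thesis using subseq_diagseq by blast
qed

text \<open>Along a subsequence on which all the test functionals converge, the images under T are
  Cauchy. The functionals come as a list and not as a set, so that one vector may be counted several
  times and integer factors in estimates can be absorbed.\<close>

lemma compact_opI:
  assumes Q: "l2_hilbert M Q" and T: "\<And>f. f \<in> Q \<Longrightarrow> T f \<in> Q"
    and Td: "\<And>f g. f \<in> Q \<Longrightarrow> g \<in> Q \<Longrightarrow> T (f - g) = T f - T g"
    and small: "\<And>e. e > 0 \<Longrightarrow> \<exists>xs. set xs \<subseteq> L2 M \<and>
       (\<forall>f\<in>Q. l2_norm M (T f) \<le> e * l2_norm M f + (\<Sum>x\<leftarrow>xs. cmod (l2_inner M f x)))"
  shows "compact_op M Q T"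
  unfolding compact_op_def
proof (intro allI impI, elim conjE exE)
  fix s B assume s: "\<forall>k::nat. s k \<in> Q" and B: "\<forall>k. l2_norm M (s k) \<le> B"
  have sL: "s k \<in> L2 M" for k using s Q l2_hilbert_L2 by blast
  have "\<forall>n. \<exists>xs. set xs \<subseteq> L2 M \<and>
       (\<forall>f\<in>Q. l2_norm M (T f) \<le> inverse (Suc n) * l2_norm M f + (\<Sum>x\<leftarrow>xs. cmod (l2_inner M f x)))"
    by (intro allI small) simp
  then obtain xs where xs: "\<And>n::nat. set (xs n) \<subseteq> L2 M"
    "\<And>n f. f \<in> Q \<Longrightarrow> l2_norm M (T f) \<le> inverse (Suc n) * l2_norm M f + (\<Sum>x\<leftarrow>xs n. cmod (l2_inner M f x))"
    by metis
  define F where "F n = set (xs n)" for n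
  have F: "\<And>n. finite (F n)" "\<And>n. F n \<subseteq> L2 M" using xs by (auto simp: F_def)
  obtain r where r: "strict_mono (r::nat \<Rightarrow> nat)" "\<And>n x. x\<in>F n \<Longrightarrow> convergent (\<lambda>k. l2_inner M (s (r k)) x)"
    using weakly_convergent_subsequence[of s M B F] sL B F by blast
  have B0: "0 \<le> B" using B l2_norm_nonneg order_trans by blast
  have "\<exists>f\<in>Q. l2_tendsto M (\<lambda>k. T (s (r k))) f"
  proof (rule l2_hilbert_complete[OF Q])
    show "T (s (r k)) \<in> Q" for k using s T by blast
    fix e :: real assume e: "e > 0"
    \<comment> \<open>Differences of terms have norm at most 2B, so this accuracy costs less than
      e/2; the summand 4 covers B = 0.\<close>
    obtain n where n: "inverse (Suc n) < e / (4 * B + 4)" 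
      using reals_Archimedean[of "e / (4 * B + 4)"] e B0 by auto
    \<comment> \<open>The remaining e/2 is shared among the functionals; the added 1 covers the
      empty list.\<close>
    define e' where "e' = e / (2 * (length (xs n) + 1))"
    have e': "e' > 0" using e by (simp add: e'_def)
    have "\<forall>x\<in>F n. \<exists>N. \<forall>j\<ge>N. \<forall>k\<ge>N. cmod (l2_inner M (s (r j)) x - l2_inner M (s (r k)) x) < e'"
    proof
      fix x assume "x \<in> F n"
      then have "Cauchy (\<lambda>k. l2_inner M (s (r k)) x)" using r(2) by (simp add: Cauchy_convergent_iff)
      then show "\<exists>N. \<forall>j\<ge>N. \<forall>k\<ge>N. cmod (l2_inner M (s (r j)) x - l2_inner M (s (r k)) x) < e'"
        using e' by (auto simp: Cauchy_iff)
    qed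
    then obtain N where N: "\<And>x j k. x \<in> F n \<Longrightarrow> j \<ge> N x \<Longrightarrow> k \<ge> N x
        \<Longrightarrow> cmod (l2_inner M (s (r j)) x - l2_inner M (s (r k)) x) < e'"
      by metis
    define N' where "N' = Max (insert 0 (N ` F n))"
    have N': "N x \<le> N'" if "x \<in> F n" for x unfolding N'_def using that F(1) by auto
    have "l2_norm M (T (s (r j)) - T (s (r k))) < e" if jk: "j \<ge> N'" "k \<ge> N'" for j k
    proof -
      define d where "d = s (r j) - s (r k)"
      have dQ: "d \<in> Q" unfolding d_def using s l2_hilbert_subspace[OF Q] cfun.subspace_diff by blast
      have "l2_norm M d \<le> 2 * B"
        using l2_norm_triangle_diff[of "s (r j)" M 0 "s (r k)"] sL L2_zero[of M] B[rule_format, of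
            "r j"] B[rule_format, of "r k"] l2_norm_minus_commute[of M "s (r k)" 0]
        unfolding d_def by simp
      then have 1: "inverse (Suc n) * l2_norm M d \<le> inverse (Suc n) * (2 * B)" by (intro mult_left_mono) auto
      have 2: "inverse (real (Suc n)) * (2 * B) \<le> e / (4 * B + 4) * (2 * B)" using n B0
          by (intro mult_right_mono) auto
      have 3: "e / (4 * B + 4) * (2 * B) < e / 2" using e B0 by (simp add: field_simps)
      have "(\<Sum>x\<leftarrow>xs n. cmod (l2_inner M d x)) \<le> (\<Sum>x\<leftarrow>xs n. e')"
      proof (rule sum_list_mono)
        fix x assume "x \<in> set (xs n)"
        then have x: "x \<in> F n" by (simp add: F_def)
        have "l2_inner M d x = l2_inner M (s (r j)) x - l2_inner M (s (r k)) x"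
          unfolding d_def using sL F(2) x by (intro l2_inner_diff_left) auto
        then show "cmod (l2_inner M d x) \<le> e'" using N[OF x, of j k] N'[OF x] jk by simp
      qed
      also have "\<dots> < e / 2" using e by (simp add: e'_def sum_list_triv field_simps)
      finally have "l2_norm M (T d) < e" using xs(2)[OF dQ, of n] 1 2 3 by linarith
      then show ?thesis unfolding d_def using s by (simp add: Td)
    qed
    then show "\<exists>N. \<forall>m\<ge>N. \<forall>n\<ge>N. l2_norm M (T (s (r m)) - T (s (r n))) < e" by blast
  qed
  then show "\<exists>r g. strict_mono r \<and> g \<in> Q \<and> l2_tendsto M (\<lambda>k. T (s (r k))) g" using r(1) by blast
qed

text \<open>The norm is bounded by the sum of finitely many coordinates. The factor 2 suits a
  commutator of two contractions and is matched by listing the basis twice.\<close>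

lemma finite_dim_compact_op:
  assumes Q: "l2_hilbert M Q" and fd: "finite_dim Q" and T: "\<And>f. f \<in> Q \<Longrightarrow> T f \<in> Q"
    and Td: "\<And>f g. f \<in> Q \<Longrightarrow> g \<in> Q \<Longrightarrow> T (f - g) = T f - T g"
    and Tb: "\<And>f. f \<in> Q \<Longrightarrow> l2_norm M (T f) \<le> 2 * l2_norm M f"
  shows "compact_op M Q T"
proof (rule compact_opI[OF Q T Td])
  fix e :: real assume e: "e > 0"
  obtain F where F: "finite F" "F \<subseteq> Q" "\<forall>u\<in>F. l2_norm M u = 1" "\<forall>f\<in>Q. f = (\<Sum>u\<in>F. (\<lambda>x. l2_inner M f u * u x))"
    using orthonormal_basis_exists[OF Q order_refl l2_hilbert_subspace[OF Q] fd] by (elim exE conjE)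
  have FL: "u \<in> L2 M" if "u \<in> F" for u using that F(2) l2_hilbert_L2[OF Q] by blast
  obtain us where us: "set us = F" "distinct us" using finite_distinct_list[OF F(1)] by blast
  have "l2_norm M (T f) \<le> e * l2_norm M f + (\<Sum>x\<leftarrow>us @ us. cmod (l2_inner M f x))" if f: "f \<in> Q" for f
  proof -
    have "(l2_norm M f)\<^sup>2 = cmod (l2_inner M f f)" by (simp only: l2_inner_self norm_of_real) simp
    also have "l2_inner M f f = (\<Sum>u\<in>F. l2_inner M f u * l2_inner M u f)"
    proof -
      have e: "f = (\<Sum>u\<in>F. (\<lambda>x. l2_inner M f u * u x))" using F(4) f by blast
      have "l2_inner M (\<Sum>u\<in>F. (\<lambda>x. l2_inner M f u * u x)) f = (\<Sum>u\<in>F. l2_inner M f u * l2_inner M u f)"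
        by (subst l2_inner_sum_left) (use F FL l2_hilbert_L2[OF Q f] in \<open>auto simp:
            l2_inner_scale_left intro!: L2_scale\<close>)
      then show ?thesis using e by simp
    qed
    also have "cmod \<dots> \<le> (\<Sum>u\<in>F. cmod (l2_inner M f u) * l2_norm M f)"
    proof (rule sum_norm_le)
      fix u assume u: "u \<in> F"
      have "cmod (l2_inner M u f) \<le> l2_norm M f"
        using l2_Cauchy_Schwarz[OF FL[OF u] l2_hilbert_L2[OF Q f]] F(3) u by simp
      then show "cmod (l2_inner M f u * l2_inner M u f) \<le> cmod (l2_inner M f u) * l2_norm M f"
        by (simp add: norm_mult mult_left_mono)
    qed
    finally have *: "l2_norm M f * l2_norm M f \<le> (\<Sum>u\<in>F. cmod (l2_inner M f u)) * l2_norm M f"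
      by (simp add: power2_eq_square sum_distrib_right)
    have "l2_norm M f \<le> (\<Sum>u\<in>F. cmod (l2_inner M f u))"
    proof (cases "l2_norm M f = 0")
      case False
      then have "0 < l2_norm M f" by (simp add: less_le)
      then show ?thesis using * by simp
    qed (simp add: sum_nonneg)
    moreover have "(\<Sum>x\<leftarrow>us. cmod (l2_inner M f x)) = (\<Sum>u\<in>F. cmod (l2_inner M f u))"
      using us by (simp add: sum_list_distinct_conv_sum_set)
    moreover have "0 \<le> e * l2_norm M f" using e by simp
    ultimately show ?thesis using Tb[OF f] by simp
  qed
  then show "\<exists>xs. set xs \<subseteq> L2 M \<and> (\<forall>f\<in>Q. l2_norm M (T f) \<le> e * l2_norm M f + (\<Sum>x\<leftarrow>xs. cmod (l2_inner M f x)))"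
    using us FL by (intro exI[of _ "us @ us"]) auto
qed

subsection \<open>Rotations preserve Lebesgue measure\<close>

text \<open>For fixed second coordinate the shear is a translation of the first, so Tonelli's
  theorem reduces the claim to translation invariance on the line.\<close>

lemma lborel_shear_fst:
  "distr (lborel :: (real \<times> real) measure) borel (\<lambda>(x, y). (x + a * y, y)) = lborel"
proof (rule measure_eqI)
  fix A :: "(real \<times> real) set" assume "A \<in> sets (distr (lborel :: (real \<times> real) measure) borel (\<lambda>(x,
      y). (x + a * y, y)))"
  then have A[measurable]: "A \<in> sets borel" by simp
  have [measurable]: "(\<lambda>(x, y). (x + a * y, y)) \<in> borel_measurable (borel :: (real \<times> real) measure)"
    by (subst borel_prod[symmetric]) measurable
  have m[measurable]: "indicator A \<in> borel_measurable (lborel \<Otimes>\<^sub>M lborel)" by (subst lborel_prod) measurable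
  have "emeasure (distr lborel borel (\<lambda>(x, y). (x + a * y, y))) A
      = (\<integral>\<^sup>+p. indicator A p \<partial>distr (lborel :: (real \<times> real) measure) borel (\<lambda>(x, y). (x
          + a * y, y)))" by simp
  also have "\<dots> = (\<integral>\<^sup>+p. indicator A (case p of (x, y) \<Rightarrow> (x + a * y, y)) \<partial>(lborel \<Otimes>\<^sub>M lborel))"
    by (subst nn_integral_distr) (auto simp: lborel_prod)
  also have "\<dots> = (\<integral>\<^sup>+y. (\<integral>\<^sup>+x. indicator A (case (x, y) of (x, y) \<Rightarrow> (x + a * y, y)) \<partial>lborel) \<partial>lborel)"
    by (subst lborel_pair.nn_integral_snd[symmetric]) (auto simp: lborel_prod intro!:
        measurable_compose[where f = "\<lambda>(x,y). (x + a * y, y)"])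
  also have "\<dots> = (\<integral>\<^sup>+y. (\<integral>\<^sup>+x. indicator A (x, y) \<partial>lborel) \<partial>lborel)"
  proof (rule nn_integral_cong)
    fix y :: real
    have "(\<lambda>x. indicator A (x, y)) \<in> borel_measurable borel"
    proof -
      have "(\<lambda>x::real. (x, y)) \<in> borel_measurable borel"
          by (intro borel_measurable_continuous_onI continuous_intros)
      then show ?thesis by measurable
    qed
    then have "(\<integral>\<^sup>+x. indicator A (x, y) \<partial>lborel) = ennreal \<bar>1\<bar> * (\<integral>\<^sup>+x. indicator A (a * y
        + 1 * x, y) \<partial>lborel)"
      by (rule nn_integral_real_affine) simp
    then show "(\<integral>\<^sup>+x. indicator A (case (x, y) of (x, y) \<Rightarrow> (x + a * y, y)) \<partial>lborel)
        = (\<integral>\<^sup>+x. indicator A (x, y) \<partial>lborel)"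
      by (simp add: add.commute)
  qed
  also have "\<dots> = (\<integral>\<^sup>+p. indicator A p \<partial>(lborel \<Otimes>\<^sub>M lborel))"
    by (subst lborel_pair.nn_integral_snd[symmetric]) auto
  also have "\<dots> = emeasure lborel A" by (simp add: lborel_prod)
  finally show "emeasure (distr lborel borel (\<lambda>(x, y). (x + a * y, y))) A = emeasure lborel A" .
qed simp

lemma lborel_swap: "distr (lborel :: (real \<times> real) measure) borel prod.swap = lborel"
proof -
  have "distr (lborel \<Otimes>\<^sub>M lborel) (lborel \<Otimes>\<^sub>M lborel) (\<lambda>(x::real, y::real). (y, x)) = lborel \<Otimes>\<^sub>M lborel"
    by (rule lborel_pair.distr_pair_swap[symmetric])
  moreover have "prod.swap = (\<lambda>(x::real, y::real). (y, x))" by auto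
  moreover have "distr (lborel :: (real \<times> real) measure) borel prod.swap = distr lborel lborel prod.swap"
    by (rule distr_cong) auto
  ultimately show ?thesis by (simp add: lborel_prod)
qed

lemma lborel_shear_snd:
  "distr (lborel :: (real \<times> real) measure) borel (\<lambda>(x, y). (x, y + b * x)) = lborel"
proof -
  have [measurable]: "(\<lambda>(x, y). (x + b * y, y)) \<in> borel_measurable (borel :: (real \<times> real) measure)"
    "prod.swap \<in> borel_measurable (borel :: (real \<times> real) measure)"
    by (subst borel_prod[symmetric], measurable)
      (auto simp: prod.swap_def intro!: borel_measurable_continuous_onI continuous_intros)
  have "(\<lambda>(x, y). (x, y + b * x)) = prod.swap \<circ> ((\<lambda>(x::real, y). (x + b * y, y)) \<circ> prod.swap)" by auto
  then show ?thesis
    using distr_distr[of "prod.swap" borel "borel :: (real \<times> real) measure"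
        "(\<lambda>(x, y). (x + b * y, y)) \<circ> prod.swap" lborel]
      distr_distr[of "\<lambda>(x::real, y). (x + b * y, y)" borel "borel :: (real \<times> real) measure"
          "prod.swap" lborel]
    by (simp add: lborel_swap lborel_shear_fst)
qed

text \<open>Comparison on boxes. It carries the shears of the real plane over to the complex
  numbers.\<close>

lemma lborel_complex_eq: "distr (lborel :: (real \<times> real) measure) borel (\<lambda>(x, y). Complex x y) = lborel"
proof (rule lborel_eqI[symmetric])
  have [measurable]: "(\<lambda>(x, y). Complex x y) \<in> borel_measurable (borel :: (real \<times> real) measure)"
    by (auto simp: split_def complex_eq_iff intro!: borel_measurable_continuous_onI continuous_intros)
  fix l u :: complex assume lu: "\<And>b. b \<in> Basis \<Longrightarrow> l \<bullet> b \<le> u \<bullet> b"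
  have le: "Re l \<le> Re u" "Im l \<le> Im u" using lu[of 1] lu[of "\<i>"] by (auto simp: Basis_complex_def)
  have "(\<lambda>(x, y). Complex x y) -` box l u \<inter> space (lborel :: (real \<times> real) measure)
      = box (Re l, Im l) (Re u, Im u)"
    by (auto simp: box_def Basis_complex_def Basis_prod_def)
  then have "emeasure (distr lborel borel (\<lambda>(x, y). Complex x y)) (box l u)
      = emeasure lborel (box (Re l, Im l) (Re u, Im u))"
    by (subst emeasure_distr) auto
  also have "\<dots> = (\<Prod>b\<in>Basis. ((Re u, Im u) - (Re l, Im l)) \<bullet> b)"
    by (subst emeasure_lborel_box) (use le in \<open>auto simp: Basis_prod_def\<close>)
  also have "\<dots> = (\<Prod>b\<in>Basis. (u - l) \<bullet> b)"
    by (simp add: Basis_prod_def Basis_complex_def prod.union_disjoint complex_eq_iff mult.commute)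
  finally show "emeasure (distr lborel borel (\<lambda>(x, y). Complex x y)) (box l u) = (\<Prod>b\<in>Basis. (u - l) \<bullet> b)" .
qed simp

text \<open>A rotation with nonzero sine is a product of three shears; a rotation by 1 or -1 is a
  product of two rotations of that kind.\<close>

lemma lborel_rotation_complex:
  fixes \<omega> :: complex
  assumes "cmod \<omega> = 1"
  shows "distr lborel borel ((*) \<omega>) = lborel"
proof -
  have [measurable]: "(\<lambda>(x, y). Complex x y) \<in> borel_measurable (borel :: (real \<times> real) measure)"
    by (auto simp: split_def complex_eq_iff intro!: borel_measurable_continuous_onI continuous_intros)
  have *: "distr lborel borel ((*) \<omega>) = lborel" if \<omega>: "cmod \<omega> = 1" "Im \<omega> \<noteq> 0" for \<omega> :: complex
  proof -
    define c s where "c = Re \<omega>" and "s = Im \<omega>"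
    \<comment> \<open>The parameter of the outer shears: the diagonal entries 1 + a s become c, and
      c^2 + s^2 = 1 then forces the off-diagonal entry a(1 + c) to be -s.\<close>
    define a where "a = (c - 1) / s"
    have cs: "c\<^sup>2 + s\<^sup>2 = 1" using \<omega>(1) by (simp add: c_def s_def cmod_def)
    have s0: "s \<noteq> 0" using \<omega>(2) by (simp add: s_def)
    have 1: "1 + a * s = c" using s0 by (simp add: a_def)
    have 2: "a * (1 + c) = - s" using s0 cs by (simp add: a_def field_simps power2_eq_square)
    define S T where "S = (\<lambda>(x::real, y::real). (x + a * y, y))" and
        "T = (\<lambda>(x::real, y::real). (x, y + s * x))"
    have m[measurable]: "S \<in> borel_measurable borel" "T \<in> borel_measurable borel"
      unfolding S_def T_def by (subst borel_prod[symmetric], measurable)+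
    have SL: "distr lborel borel S = lborel" "distr lborel borel T = lborel"
      unfolding S_def T_def by (rule lborel_shear_fst lborel_shear_snd)+
    have e: "(*) \<omega> \<circ> (\<lambda>(x, y). Complex x y) = (\<lambda>(x, y). Complex x y) \<circ> (S \<circ> (T \<circ> S))"
    proof (rule ext)
      fix p :: "real \<times> real"
      obtain x y where p: "p = (x, y)" by (cases p)
      have "x + a * y + a * (y + s * (x + a * y)) = (1 + a * s) * x + a * (1 + (1 + a * s)) * y"
          by (simp add: algebra_simps)
      also have "\<dots> = c * x - s * y" unfolding 1 2 by simp
      finally have e1: "x + a * y + a * (y + s * (x + a * y)) = c * x - s * y" .
      have "y + s * (x + a * y) = s * x + (1 + a * s) * y" by (simp add: algebra_simps)
      then have e2: "y + s * (x + a * y) = s * x + c * y" unfolding 1 .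
      show "((*) \<omega> \<circ> (\<lambda>(x, y). Complex x y)) p = ((\<lambda>(x, y). Complex x y) \<circ> (S \<circ> (T \<circ> S))) p"
        using e1 e2 by (simp add: p S_def T_def complex_eq_iff c_def[symmetric] s_def[symmetric])
    qed
    have "distr lborel borel ((*) \<omega>) = distr (distr lborel borel (\<lambda>(x, y). Complex x y)) borel ((*) \<omega>)"
      by (simp add: lborel_complex_eq)
    also have "\<dots> = distr lborel borel ((*) \<omega> \<circ> (\<lambda>(x, y). Complex x y))"
      by (rule distr_distr) auto
    also have "\<dots> = distr (distr (distr (distr lborel borel S) borel T) borel S) borel (\<lambda>(x, y). Complex x y)"
      unfolding e by (subst distr_distr; measurable; auto simp: o_assoc)+
    also have "\<dots> = lborel" by (simp add: SL lborel_complex_eq)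
    finally show ?thesis .
  qed
  show ?thesis
  proof (cases "Im \<omega> = 0")
    case False
    then show ?thesis using * assms by blast
  next
    case True
    \<comment> \<open>A real \<omega> is nonzero here, so both \<eta> and the imaginary unit have
      nonzero imaginary part, and their product is \<omega>.\<close>
    define \<eta> where "\<eta> = \<omega> * (- \<i>)"
    have "Re \<omega> \<noteq> 0" using True assms by (auto simp: cmod_def)
    then have \<eta>: "distr lborel borel ((*) \<eta>) = lborel" "distr lborel borel ((*) \<i>)
        = (lborel :: complex measure)"
      using assms by (intro *; simp add: \<eta>_def norm_mult)+
    have "(*) \<omega> = (*) \<eta> \<circ> (*) \<i>" by (auto simp: \<eta>_def fun_eq_iff complex_eq_iff)
    then show ?thesis
      using distr_distr[of "(*) \<eta>" borel borel "(*) \<i>" "lborel :: complex measure"] \<eta> by simp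
  qed
qed

lemma Basis_complex_vec_image:
  "(Basis :: (complex ^ 'n) set) = (\<lambda>(i, b). axis i b) ` (UNIV \<times> Basis)"
  by (auto simp: Basis_vec_def)

lemma prod_Basis_complex_vec:
  "(\<Prod>b\<in>(Basis :: (complex ^ 'n) set). F b) = (\<Prod>i\<in>UNIV. \<Prod>b\<in>Basis. F (axis i b))"
proof -
  have "inj_on (\<lambda>(i, b). axis i b) (UNIV \<times> (Basis :: complex set))"
    by (auto simp: inj_on_def axis_eq_axis)
  then show ?thesis
    unfolding Basis_complex_vec_image
    by (subst prod.reindex) (simp_all add: prod.cartesian_product split_def)
qed

lemma box_complex_vec: "x \<in> box l u \<longleftrightarrow> (\<forall>i. x $ i \<in> box (l $ i) (u $ i))" for x :: "complex ^ 'n"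
  by (auto simp: mem_box Basis_vec_def inner_axis)

lemma measurable_vec_lambda:
  assumes "\<And>i. (\<lambda>x. f x i) \<in> borel_measurable M"
  shows "(\<lambda>x. (\<chi> i. f x i) :: complex ^ 'n) \<in> borel_measurable M"
proof (subst borel_measurable_euclidean_space, safe)
  fix b :: "complex ^ 'n" assume "b \<in> Basis"
  then obtain i c where b: "b = axis i c" by (auto simp: Basis_vec_def)
  show "(\<lambda>x. (\<chi> i. f x i) \<bullet> b) \<in> borel_measurable M"
    unfolding b inner_axis using assms[of i] by simp
qed

text \<open>The parameter \<open>T\<close> lets one box computation serve twice: the identity gives
  the description of Lebesgue measure as a product, a rotation gives invariance under rotating all
  coordinates together.\<close>

lemma lborel_complex_vec_eq:
  fixes T :: "complex \<Rightarrow> complex"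
  assumes T[measurable]: "T \<in> borel_measurable borel" and eq:
      "distr lborel borel T = (lborel :: complex measure)"
  shows "distr (Pi\<^sub>M (UNIV :: 'n set) (\<lambda>_. lborel)) borel (\<lambda>f. (\<chi> i. T (f i)))
      = (lborel :: (complex ^ 'n) measure)"
proof (rule lborel_eqI[symmetric])
  interpret product_sigma_finite "\<lambda>_::'n. lborel :: complex measure" ..
  have m[measurable]: "(\<lambda>f. (\<chi> i. T (f i)) :: complex ^ 'n) \<in> borel_measurable (Pi\<^sub>M UNIV (\<lambda>_. lborel))"
    by (rule measurable_vec_lambda) measurable
  fix l u :: "complex ^ 'n" assume lu: "\<And>b. b \<in> Basis \<Longrightarrow> l \<bullet> b \<le> u \<bullet> b"
  have "(\<lambda>f. (\<chi> i. T (f i))) -` box l u \<inter> space (Pi\<^sub>M UNIV (\<lambda>_. lborel))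
      = (\<Pi>\<^sub>E i\<in>UNIV. T -` box (l $ i) (u $ i))"
    by (auto simp: box_complex_vec space_PiM PiE_def Pi_def)
  then have "emeasure (distr (Pi\<^sub>M UNIV (\<lambda>_. lborel)) borel (\<lambda>f. (\<chi> i. T (f i)))) (box l u)
     = emeasure (Pi\<^sub>M UNIV (\<lambda>_. lborel)) (\<Pi>\<^sub>E i\<in>UNIV. T -` box (l $ i) (u $ i))"
    by (subst emeasure_distr) auto
  also have "\<dots> = (\<Prod>i\<in>UNIV. emeasure lborel (T -` box (l $ i) (u $ i)))"
  proof (rule emeasure_PiM[of UNIV "\<lambda>i. T -` box (l $ i) (u $ i)"])
    fix i
    have "T -` box (l $ i) (u $ i) \<inter> space borel \<in> sets borel" by measurable
    then show "T -` box (l $ i) (u $ i) \<in> sets lborel" by simp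
  qed simp
  also have "\<dots> = (\<Prod>i\<in>UNIV. ennreal (\<Prod>b\<in>Basis. (u $ i - l $ i) \<bullet> b))"
  proof (rule prod.cong)
    fix i
    have "emeasure lborel (T -` box (l $ i) (u $ i)) = emeasure (distr lborel borel T) (box (l $ i) (u $ i))"
      by (subst emeasure_distr) auto
    also have "\<dots> = ennreal (\<Prod>b\<in>Basis. (u $ i - l $ i) \<bullet> b)"
      unfolding eq using lu[of "axis i _"] by (intro emeasure_lborel_box) (auto simp: inner_axis
          Basis_vec_def)
    finally show "emeasure lborel (T -` box (l $ i) (u $ i)) = ennreal (\<Prod>b\<in>Basis. (u $ i - l $ i) \<bullet> b)" .
  qed simp
  also have "\<dots> = ennreal (\<Prod>i\<in>UNIV. \<Prod>b\<in>Basis. (u $ i - l $ i) \<bullet> b)"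
    using lu[of "axis _ _"] by (intro prod_ennreal prod_nonneg) (auto simp: inner_axis Basis_vec_def
        algebra_simps)
  also have "\<dots> = (\<Prod>b\<in>Basis. (u - l) \<bullet> b)"
    by (simp add: prod_Basis_complex_vec inner_axis)
  finally show "emeasure (distr (Pi\<^sub>M UNIV (\<lambda>_. lborel)) borel (\<lambda>f. (\<chi> i. T (f i)))) (box l u)
      = (\<Prod>b\<in>Basis. (u - l) \<bullet> b)" .
qed simp

lemma lborel_complex_vec_PiM:
  "(lborel :: (complex ^ 'n) measure) = distr (Pi\<^sub>M (UNIV :: 'n set) (\<lambda>_. lborel)) borel (\<lambda>f. (\<chi> i. f i))"
  using lborel_complex_vec_eq[of "\<lambda>z. z", where 'n = 'n] by (simp add: distr_id2)

lemma lborel_rotation_complex_vec: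
  assumes "cmod \<omega> = 1"
  shows "distr lborel borel ((*s) \<omega>) = (lborel :: (complex ^ 'n) measure)"
proof -
  have [measurable]: "(\<lambda>f. (\<chi> i. f i) :: complex ^ 'n) \<in> borel_measurable (Pi\<^sub>M UNIV (\<lambda>_. lborel))"
    by (rule measurable_vec_lambda) measurable
  have [measurable]: "(*s) \<omega> \<in> borel_measurable (borel :: (complex ^ 'n) measure)"
    unfolding vector_scalar_mult_def by (rule measurable_vec_lambda) (auto intro!:
        borel_measurable_continuous_onI continuous_intros)
  have "distr (lborel :: (complex ^ 'n) measure) borel ((*s) \<omega>)
      = distr (Pi\<^sub>M UNIV (\<lambda>_. lborel)) borel ((*s) \<omega> \<circ> (\<lambda>f. (\<chi> i. f i)))"
    by (subst lborel_complex_vec_PiM) (rule distr_distr; measurable)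
  also have "(*s) \<omega> \<circ> (\<lambda>f. (\<chi> i. f i)) = (\<lambda>f. (\<chi> i. \<omega> * f i))" by (auto simp: vec_eq_iff)
  also have "distr (Pi\<^sub>M (UNIV :: 'n set) (\<lambda>_. lborel)) borel (\<lambda>f. (\<chi> i. \<omega> * f i)) = lborel"
    using lborel_complex_vec_eq[OF _ lborel_rotation_complex[OF assms]] by simp
  finally show ?thesis .
qed

subsection \<open>Averages over roots of unity\<close>

definition unity_root :: "nat \<Rightarrow> complex" where
  "unity_root N = exp (2 * of_real pi * \<i> / of_nat N)"

lemma norm_unity_root [simp]: "cmod (unity_root N) = 1"
  by (simp add: unity_root_def norm_exp_eq_Re Re_divide)

lemma unity_root_power: "unity_root N ^ j = exp (2 * of_real pi * \<i> * of_nat j / of_nat N)"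
  unfolding unity_root_def by (subst exp_of_nat_mult[symmetric]) (simp add: field_simps)

lemma unity_root_power_eq_iff: "0 < N \<Longrightarrow> j < N \<Longrightarrow> m < N \<Longrightarrow> unity_root N ^ j = unity_root N ^ m \<longleftrightarrow> j = m"
  unfolding unity_root_power by (subst complex_root_unity_eq) auto

lemma unity_root_power_self: "0 < N \<Longrightarrow> unity_root N ^ N = 1"
  unfolding unity_root_power by simp

text \<open>The summands are the powers of an N-th root of unity q, so the sum is geometric. The
  bounds on j and m ensure that q = 1 only for j = m.\<close>

lemma unity_root_orthogonality:
  assumes "0 < N" "j < N" "m < N"
  shows "(\<Sum>k<N. cnj (unity_root N ^ k) ^ m * (unity_root N ^ k) ^ j) = (if j = m then of_nat N else 0)"
proof -
  define w where "w = unity_root N"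
  define q where "q = cnj w ^ m * w ^ j"
  have ww: "cnj w * w = 1" using complex_norm_square[of w] by (simp add: w_def mult.commute)
  have t: "cnj (w ^ k) ^ m * (w ^ k) ^ j = q ^ k" for k
    by (simp add: q_def power_mult_distrib power_mult[symmetric] mult.commute)
  show ?thesis
  proof (cases "j = m")
    case True
    then have "q = 1" using ww by (simp add: q_def power_mult_distrib[symmetric])
    then show ?thesis using True unfolding w_def[symmetric] t by simp
  next
    case False
    have "q \<noteq> 1"
    proof
      assume "q = 1"
      then have "w ^ m * q = w ^ m" by simp
      moreover have "w ^ m * q = (cnj w * w) ^ m * w ^ j" by (simp add: q_def power_mult_distrib)
      ultimately have "w ^ j = w ^ m" using ww by simp
      then show False using unity_root_power_eq_iff[OF assms] False by (simp add: w_def)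
    qed
    have "w ^ N = 1" using unity_root_power_self assms by (simp add: w_def)
    have "q ^ N = cnj (w ^ N) ^ m * (w ^ N) ^ j"
      by (simp add: q_def power_mult_distrib power_mult[symmetric] mult.commute)
    then have "q ^ N = 1" using \<open>w ^ N = 1\<close> by simp
    then show ?thesis using False \<open>q \<noteq> 1\<close> unfolding w_def[symmetric] t
      by (simp add: sum_gp_strict)
  qed
qed

text \<open>A discrete Fourier coefficient along the orbit of z under rotations, replacing the
  circle integral for the m-th Taylor term.\<close>

definition root_average :: "nat \<Rightarrow> nat \<Rightarrow> (complex \<Rightarrow> complex) \<Rightarrow> complex \<Rightarrow> complex" where
  "root_average N m h z = (\<Sum>k<N. cnj (unity_root N ^ k) ^ m * h (unity_root N ^ k * z)) / of_nat N"

text \<open>In the averaged power series the term of index j is eventually 0 unless j = m. Tannery's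
  theorem moves the limit inside the series, with the absolute values of the original terms as
  majorant.\<close>

lemma root_average_tendsto:
  assumes h: "h holomorphic_on ball 0 R" and z: "z \<in> ball 0 R"
  shows "(\<lambda>N. root_average N m h z) \<longlonglongrightarrow> (deriv ^^ m) h 0 / fact m * z ^ m"
proof -
  define a where "a j = (deriv ^^ j) h 0 / fact j" for j
  have hs: "(\<lambda>j. a j * w ^ j) sums h w" if "w \<in> ball 0 R" for w
    using holomorphic_power_series[OF h that] by (simp add: a_def)
  have "summable (\<lambda>j. norm (a j * z ^ j))"
  proof -
    have "cmod z < R" using z by simp
    \<comment> \<open>Convergence at the larger radius r gives absolute convergence at z.\<close>
    then obtain r where r: "cmod z < r" "r < R" using dense by blast
    have r0: "0 < r" using r(1) norm_ge_zero[of z] by linarith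
    have "summable (\<lambda>j. a j * (of_real r) ^ j)"
      using hs[of "of_real r"] r r0 by (auto simp: sums_iff)
    then show ?thesis by (rule powser_insidea) (use r r0 in simp)
  qed
  moreover define d where "d N j = (\<Sum>k<N. cnj (unity_root N ^ k) ^ m * (unity_root N ^ k) ^ j) /
      of_nat N" for N j
  have dle: "cmod (d N j) \<le> 1" for N j
  proof (cases "N = 0")
    case False
    have "cmod (\<Sum>k<N. cnj (unity_root N ^ k) ^ m * (unity_root N ^ k) ^ j) \<le> (\<Sum>k<N. 1)"
      by (rule order_trans[OF norm_sum]) (auto simp: norm_mult norm_power)
    then show ?thesis using False by (simp add: d_def norm_divide field_simps)
  qed (simp add: d_def)
  have dlim: "(\<lambda>N. d N j) \<longlonglongrightarrow> (if j = m then 1 else 0)" for j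
  proof (rule tendsto_eventually)
    have "d N j = (if j = m then 1 else 0)" if "N > max j m" for N
      using unity_root_orthogonality[of N j m] that by (simp add: d_def)
    then show "\<forall>\<^sub>F N in sequentially. d N j = (if j = m then 1 else 0)"
      using eventually_gt_at_top[of "max j m"] by (rule eventually_mono[rotated]) 
  qed
  have avg: "root_average N m h z = (\<Sum>j. d N j * (a j * z ^ j))" for N
  proof -
    have "(\<lambda>j. cnj (unity_root N ^ k) ^ m * (a j * (unity_root N ^ k * z) ^ j))
        sums (cnj (unity_root N ^ k) ^ m * h (unity_root N ^ k * z))" for k
      using z by (intro sums_mult hs) (simp add: norm_mult norm_power)
    then have "(\<lambda>j. (\<Sum>k<N. cnj (unity_root N ^ k) ^ m * (a j * (unity_root N ^ k * z) ^ j)) / of_nat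
        N) sums root_average N m h z"
      unfolding root_average_def by (intro sums_divide sums_sum)
    moreover have "(\<Sum>k<N. cnj (unity_root N ^ k) ^ m * (a j * (unity_root N ^ k * z) ^ j)) / of_nat
        N = d N j * (a j * z ^ j)" for j
      by (simp add: d_def sum_distrib_left power_mult_distrib mult_ac)
    ultimately show ?thesis by (simp add: sums_iff)
  qed
  have "(\<lambda>N. \<Sum>j. d N j * (a j * z ^ j)) \<longlonglongrightarrow> (\<Sum>j. (if j = m then 1 else 0) * (a j * z ^ j))"
  proof (rule tannerys_theorem[where M = "\<lambda>j. norm (a j * z ^ j)"
      and F = sequentially, THEN conjunct2, THEN conjunct2])
    show "\<And>j. ((\<lambda>N. d N j * (a j * z ^ j)) \<longlonglongrightarrow> (if j = m then 1 else 0) * (a j * z ^ j))"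
      by (intro tendsto_mult_right dlim)
    show "\<forall>\<^sub>F (j, N) in at_top \<times>\<^sub>F sequentially. norm (d N j * (a j * z ^ j)) \<le> norm (a j * z ^ j)"
      using dle by (auto simp: norm_mult mult_left_le_one_le intro!: always_eventually)
  qed (fact | simp)+
  moreover have "(\<Sum>j. (if j = m then 1 else 0) * (a j * z ^ j)) = a m * z ^ m"
  proof -
    have "(\<lambda>j. (if j = m then 1 else 0) * (a j * z ^ j)) = (\<lambda>j. if j = m then a j * z ^ j else 0)" by auto
    then show ?thesis using sums_single[of m "\<lambda>j. a j * z ^ j"] by (simp add: sums_iff)
  qed
  ultimately show ?thesis unfolding avg by (simp add: a_def)
qed

lemma root_average_norm_le:
  assumes "\<And>w. cmod w = cmod z \<Longrightarrow> cmod (h w) \<le> B" "0 \<le> B"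
  shows "cmod (root_average N m h z) \<le> B"
proof (cases "N = 0")
  case False
  have "cmod (\<Sum>k<N. cnj (unity_root N ^ k) ^ m * h (unity_root N ^ k * z)) \<le> (\<Sum>k<N. B)"
    by (rule order_trans[OF norm_sum], rule sum_mono) (use assms in \<open>auto simp: norm_mult norm_power\<close>)
  then show ?thesis using False by (simp add: root_average_def norm_divide field_simps)
qed (simp add: root_average_def assms)

subsection \<open>Spaces of square integrable holomorphic functions\<close>

text \<open>Fatou's lemma is applied to the squared moduli of s m - s n with m fixed and n tending
  to infinity. The limit function is thereby square integrable, and the convergence is in
  norm.\<close>

lemma l2_Fatou:
  assumes s: "\<And>n. s n \<in> L2 M" and g: "g \<in> borel_measurable M"
    and lim: "AE x in M. (\<lambda>n. s n x) \<longlonglongrightarrow> g x"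
    and C: "\<And>e. e > 0 \<Longrightarrow> \<exists>N. \<forall>m\<ge>N. \<forall>n\<ge>N. l2_norm M (s m - s n) < e"
  shows "g \<in> L2 M" "l2_tendsto M s g"
proof -
  have [measurable]: "s n \<in> borel_measurable M" "g \<in> borel_measurable M" for n using s g
      by (auto simp: L2_def)
  have key: "s m - g \<in> L2 M \<and> l2_norm M (s m - g) \<le> e"
    if N: "\<forall>m\<ge>N. \<forall>n\<ge>N. l2_norm M (s m - s n) < e" and m: "m \<ge> N" for N m e
  proof -
    have e0: "0 \<le> e" using N m l2_norm_nonneg[of M "s m - s m"] by (smt (verit))
    have nn: "(\<integral>\<^sup>+x. ennreal ((cmod (f x))\<^sup>2) \<partial>M) = ennreal ((l2_norm M f)\<^sup>2)" if "f \<in> L2 M" for f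
      using that unfolding l2_norm_sq by (intro nn_integral_eq_integral) (auto simp: L2_def)
    have "AE x in M. (\<lambda>n. ennreal ((cmod (s m x - s n x))\<^sup>2)) \<longlonglongrightarrow> ennreal ((cmod (s m x - g x))\<^sup>2)"
      using lim by eventually_elim (intro tendsto_intros, simp)
    then have "AE x in M. liminf (\<lambda>n. ennreal ((cmod (s m x - s n x))\<^sup>2)) = ennreal ((cmod (s m x - g x))\<^sup>2)"
      by eventually_elim (simp add: lim_imp_Liminf)
    then have "(\<integral>\<^sup>+x. ennreal ((cmod (s m x - g x))\<^sup>2) \<partial>M)
        = (\<integral>\<^sup>+x. liminf (\<lambda>n. ennreal ((cmod (s m x - s n x))\<^sup>2)) \<partial>M)"
      by (intro nn_integral_cong_AE) auto
    also have "\<dots> \<le> liminf (\<lambda>n. \<integral>\<^sup>+x. ennreal ((cmod (s m x - s n x))\<^sup>2) \<partial>M)"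
      by (rule nn_integral_liminf) measurable
    also have "\<dots> \<le> ennreal (e\<^sup>2)"
    proof (rule Liminf_le)
      show "\<forall>\<^sub>F n in sequentially. (\<integral>\<^sup>+x. ennreal ((cmod (s m x - s n x))\<^sup>2) \<partial>M) \<le> ennreal (e\<^sup>2)"
        using eventually_ge_at_top[of N]
      proof eventually_elim
        case (elim n)
        have "l2_norm M (s m - s n) \<le> e" using N m elim by (simp add: less_imp_le)
        then have "(l2_norm M (s m - s n))\<^sup>2 \<le> e\<^sup>2" by (intro power_mono) auto
        then show ?case using nn[of "s m - s n"] s by (simp add: L2_diff ennreal_leI)
      qed
    qed simp
    finally have le: "(\<integral>\<^sup>+x. ennreal ((cmod (s m x - g x))\<^sup>2) \<partial>M) \<le> ennreal (e\<^sup>2)" .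
    then have "integrable M (\<lambda>x. (cmod (s m x - g x))\<^sup>2)"
      by (intro integrableI_nonneg) (auto intro: le_less_trans)
    then have L: "s m - g \<in> L2 M" unfolding L2_def by (auto simp: fun_diff_def)
    have "(l2_norm M (s m - g))\<^sup>2 \<le> e\<^sup>2" using le nn[OF L] by simp
    then show ?thesis using L e0 power2_le_imp_le by blast
  qed
  obtain N where "\<forall>m\<ge>N. \<forall>n\<ge>N. l2_norm M (s m - s n) < 1" using C[of 1] by auto
  then have "s N - g \<in> L2 M" using key by blast
  from L2_diff[OF s this] have "s N - (s N - g) \<in> L2 M" .
  moreover have "s N - (s N - g) = g" by (simp add: fun_eq_iff)
  ultimately show "g \<in> L2 M" by metis
  show "l2_tendsto M s g"
    unfolding l2_tendsto_def LIMSEQ_iff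
  proof (intro allI impI)
    fix r :: real assume r: "r > 0"
    then obtain N where "\<forall>m\<ge>N. \<forall>n\<ge>N. l2_norm M (s m - s n) < r / 2" using C[of "r / 2"] by auto
    then have "\<forall>m\<ge>N. l2_norm M (s m - g) \<le> r / 2" using key by blast
    then show "\<exists>N. \<forall>m\<ge>N. norm (l2_norm M (s m - g) - 0) < r" using r by (intro exI[of _ N]) force
  qed
qed

lemma uniform_measure_lborel_eq:
  assumes "emeasure lborel U \<noteq> 0" "emeasure lborel U \<noteq> \<infinity>"
  shows "uniform_measure lborel U = density lborel (\<lambda>x. ennreal (indicator U x / measure lborel U))"
proof -
  have e: "emeasure lborel U = ennreal (measure lborel U)" using assms
      by (simp add: emeasure_eq_ennreal_measure)
  then have "measure lborel U > 0" using assms by (metis ennreal_0 measure_nonneg order_le_less)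
  then have "indicator U x / emeasure lborel U = ennreal (indicator U x / measure lborel U)" for x
    unfolding e by (auto simp: indicator_def divide_ennreal[symmetric])
  then show ?thesis unfolding uniform_measure_def by simp
qed

text \<open>Covers the disc and the polydisc at once. \<open>sc\<close> is the action of complex
  scalars: holomorphy means that the derivative respects it, and invariance of Lebesgue measure
  under its unimodular part supplies the mean value property.\<close>

locale holomorphic_L2 =
  fixes sc :: "complex \<Rightarrow> 'a::euclidean_space \<Rightarrow> 'a" and U :: "'a set"
  assumes bil: "bounded_bilinear sc"
    and norm_sc: "norm (sc c v) = cmod c * norm v"
    and rot: "cmod \<omega> = 1 \<Longrightarrow> distr lborel borel (sc \<omega>) = (lborel :: 'a measure)"
    and U: "open U" "bounded U" "U \<noteq> {}"
begin

definition cholo :: "('a \<Rightarrow> complex) \<Rightarrow> bool" where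
  "cholo f \<longleftrightarrow> (\<forall>z\<in>U. \<exists>D. (f has_derivative D) (at z) \<and> (\<forall>c v. D (sc c v) = c * D v))"

definition UM :: "'a measure" where "UM = uniform_measure lborel U"

definition HH :: "('a \<Rightarrow> complex) set" where
  "HH = {f. cholo f \<and> (\<forall>z. z \<notin> U \<longrightarrow> f z = 0) \<and> integrable UM (\<lambda>z. (cmod (f z))\<^sup>2)}"

lemma vol_ball: "0 < r \<Longrightarrow> 0 < measure lborel (ball (x::'a) r)"
  by (simp add: content_ball)

lemma emeasure_U: "emeasure lborel U \<noteq> 0" "emeasure lborel U \<noteq> \<infinity>"
proof -
  show fin: "emeasure lborel U \<noteq> \<infinity>" using emeasure_bounded_finite[OF U(2)] by simp
  obtain x r where r: "0 < r" "ball x r \<subseteq> U" using U by (meson all_not_in_conv open_contains_ball)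
  have "measure lborel (ball x r) > 0" using vol_ball[OF r(1)] .
  then have "emeasure lborel (ball x r) \<noteq> 0" by (auto simp: measure_def)
  moreover have "emeasure lborel (ball x r) \<le> emeasure lborel U" using r U by (intro emeasure_mono) auto
  ultimately show "emeasure lborel U \<noteq> 0" by auto
qed

definition V :: real where "V = measure lborel U"

lemma V_pos: "0 < V"
  using emeasure_U unfolding V_def by (metis emeasure_eq_ennreal_measure ennreal_0
      infinity_ennreal_def measure_nonneg order_le_less)

lemma UM_eq: "UM = density lborel (\<lambda>x. ennreal (indicator U x / V))"
  unfolding UM_def V_def by (rule uniform_measure_lborel_eq[OF emeasure_U])

lemma sets_UM [measurable_cong]: "sets UM = sets borel" by (simp add: UM_def)

lemma cholo_continuous: "cholo f \<Longrightarrow> continuous_on U f"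
  unfolding cholo_def continuous_on_eq_continuous_at[OF U(1)] by (meson has_derivative_continuous)

lemma cholo_measurable:
  assumes "cholo f" "\<And>z. z \<notin> U \<Longrightarrow> f z = 0"
  shows "f \<in> borel_measurable borel"
proof -
  have "(\<lambda>x. if x \<in> U then f x else 0) \<in> borel_measurable borel"
    by (rule borel_measurable_continuous_on_if) (use U cholo_continuous[OF assms(1)] in auto)
  moreover have "(\<lambda>x. if x \<in> U then f x else 0) = f" using assms(2) by auto
  ultimately show ?thesis by simp
qed

lemma HH_measurable: "f \<in> HH \<Longrightarrow> f \<in> borel_measurable borel"
  using cholo_measurable by (auto simp: HH_def)

lemma HH_L2: "f \<in> HH \<Longrightarrow> f \<in> L2 UM"
  using HH_measurable[of f] by (auto simp: L2_def HH_def measurable_cong_sets[OF sets_UM refl])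

text \<open>The mean value argument translates functions, which is possible for Lebesgue measure but
  not for the normalized measure on \<open>U\<close>. The extension by 0 makes the two norms
  proportional.\<close>

lemma HH_lborel:
  assumes "f \<in> HH"
  shows "f \<in> L2 lborel" "(l2_norm lborel f)\<^sup>2 = V * (l2_norm UM f)\<^sup>2"
proof -
  have [measurable]: "f \<in> borel_measurable borel" using HH_measurable[OF assms] .
  have Um[measurable]: "U \<in> sets borel" using U by simp
  have z: "indicator U x * (cmod (f x))\<^sup>2 = (cmod (f x))\<^sup>2" for x using assms
      by (auto simp: HH_def indicator_def)
  have "integrable UM (\<lambda>z. (cmod (f z))\<^sup>2)" using assms by (simp add: HH_def)
  then have "integrable lborel (\<lambda>x. (indicator U x / V) *\<^sub>R (cmod (f x))\<^sup>2)"
    unfolding UM_eq by (subst (asm) integrable_density) (use V_pos in auto)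
  then have "integrable lborel (\<lambda>x. V * ((indicator U x / V) *\<^sub>R (cmod (f x))\<^sup>2))"
      by (rule integrable_mult_right)
  then show "f \<in> L2 lborel" using V_pos by (simp add: L2_def z)
  have "(LINT x|UM. (cmod (f x))\<^sup>2) = (LINT x|lborel. (indicator U x / V) *\<^sub>R (cmod (f x))\<^sup>2)"
    unfolding UM_eq by (subst integral_density) (use V_pos in auto)
  also have "\<dots> = (LINT x|lborel. (cmod (f x))\<^sup>2) / V" by (simp add: z)
  finally show "(l2_norm lborel f)\<^sup>2 = V * (l2_norm UM f)\<^sup>2" using V_pos by (simp add: l2_norm_sq)
qed

text \<open>By the chain rule a function is holomorphic along each complex line. All facts about
  several variables are reduced to one variable in this way.\<close>

lemma cholo_line:
  assumes "cholo f" "\<And>t. t \<in> T \<Longrightarrow> w + sc t v \<in> U" "open T"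
  shows "(\<lambda>t. f (w + sc t v)) holomorphic_on T"
  unfolding holomorphic_on_open[OF assms(3)]
proof (intro ballI)
  interpret bounded_bilinear sc by (rule bil)
  fix t assume t: "t \<in> T"
  obtain D where D0: "(f has_derivative D) (at (w + sc t v))" "\<forall>c v. D (sc c v) = c * D v"
    using bspec[OF assms(1)[unfolded cholo_def] assms(2)[OF t]] by blast
  then have D: "(f has_derivative D) (at (w + sc t v))" "\<And>c v. D (sc c v) = c * D v" by blast+
  have "((\<lambda>t. w + sc t v) has_derivative (\<lambda>h. sc h v)) (at t)"
    by (auto intro!: derivative_eq_intros bounded_linear_imp_has_derivative bounded_linear_left)
  from has_derivative_compose[OF this D(1)] have "((\<lambda>t. f (w + sc t v)) has_derivative (\<lambda>h. h * D v)) (at t)"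
    by (simp add: D(2))
  then have "((\<lambda>t. f (w + sc t v)) has_field_derivative D v) (at t)"
    unfolding has_field_derivative_def by (rule has_derivative_eq_rhs) (simp add: fun_eq_iff)
  then show "\<exists>f'. ((\<lambda>t. f (w + sc t v)) has_field_derivative f') (at t)" by blast
qed

text \<open>Averaging the integrand over rotations by roots of unity leaves the integral unchanged,
  while the averages converge boundedly to the constant f w by the power series along each complex
  line.\<close>

lemma mean_value_ball:
  assumes f: "cholo f" "\<And>z. z \<notin> U \<Longrightarrow> f z = 0" and r: "ball w r \<subseteq> U" and \<rho>: "0 < \<rho>" "\<rho> < r"
  shows "integrable lborel (\<lambda>\<zeta>. indicator (ball 0 \<rho>) \<zeta> *\<^sub>R f (w + \<zeta>))"
    and "(LINT \<zeta>|lborel. indicator (ball 0 \<rho>) \<zeta> *\<^sub>R f (w + \<zeta>)) = measure lborel (ball (0::'a) \<rho>) *\<^sub>R f w"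
proof -
  interpret bounded_bilinear sc by (rule bil)
  have fm[measurable]: "f \<in> borel_measurable borel" using cholo_measurable f by blast
  have [measurable]: "ball (0::'a) \<rho> \<in> sets borel" "(\<lambda>\<zeta>. f (w + \<zeta>)) \<in> borel_measurable borel"
    by (auto intro!: measurable_compose[OF _ fm])
  have scm[measurable]: "sc c \<in> borel_measurable borel" for c
    by (intro borel_measurable_continuous_onI linear_continuous_on bounded_linear_right)
  have sub: "cball w \<rho> \<subseteq> ball w r" using \<rho> by auto
  have "bounded (f ` cball w \<rho>)"
    using continuous_on_subset[OF cholo_continuous[OF f(1)]] sub r
    by (intro compact_imp_bounded compact_continuous_image) auto
  then obtain B where B: "0 < B" "\<And>z. z \<in> cball w \<rho> \<Longrightarrow> cmod (f z) \<le> B" by (auto simp: bounded_pos)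
  define g where "g = (\<lambda>\<zeta>. indicator (ball 0 \<rho>) \<zeta> *\<^sub>R f (w + \<zeta>))"
  have gm[measurable]: "g \<in> borel_measurable borel" unfolding g_def by measurable
  have bi: "integrable lborel (\<lambda>\<zeta>. indicator (ball (0::'a) \<rho>) \<zeta> * B)"
    using emeasure_bounded_finite[OF bounded_ball] by (intro integrable_mult_left
        integrable_real_indicator) auto
  have gb: "norm (g \<zeta>) \<le> indicator (ball 0 \<rho>) \<zeta> * B" for \<zeta>
    using B(2)[of "w + \<zeta>"] by (auto simp: g_def indicator_def dist_norm)
  have gi: "integrable lborel g"
    by (rule Bochner_Integration.integrable_bound[OF bi])
        (use gb in \<open>auto simp: abs_of_pos[OF B(1)] abs_mult\<close>)
  then show "integrable lborel (\<lambda>\<zeta>. indicator (ball 0 \<rho>) \<zeta> *\<^sub>R f (w + \<zeta>))" by (simp add: g_def)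
  have gr: "integrable lborel (\<lambda>\<zeta>. g (sc \<omega> \<zeta>))" "(LINT \<zeta>|lborel. g (sc \<omega> \<zeta>)) = integral\<^sup>L lborel g"
    if "cmod \<omega> = 1" for \<omega>
    using integrable_distr_eq[of "sc \<omega>" lborel borel g] integral_distr[of
        "sc \<omega>" lborel borel g] rot[OF that] gi by auto
  define A where "A N \<zeta> = (\<Sum>k<N. g (sc (unity_root N ^ k) \<zeta>)) / of_nat N" for N \<zeta>
  have Am[measurable]: "A N \<in> borel_measurable borel" for N unfolding A_def by measurable
  have A1: "A N \<zeta> = indicator (ball 0 \<rho>) \<zeta> *\<^sub>R root_average N 0 (\<lambda>t. f (w + sc t \<zeta>)) 1" for N \<zeta>
    by (auto simp: A_def root_average_def g_def indicator_def norm_sc norm_power)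
  have Ai: "integral\<^sup>L lborel (A N) = integral\<^sup>L lborel g" if "N > 0" for N
  proof -
    have "integral\<^sup>L lborel (A N) = (\<Sum>k<N. integral\<^sup>L lborel g) / of_nat N"
      unfolding A_def by (simp add: gr norm_power)
    then show ?thesis using that by simp
  qed
  have lim: "(\<lambda>N. A N \<zeta>) \<longlonglongrightarrow> indicator (ball 0 \<rho>) \<zeta> *\<^sub>R f w" for \<zeta>
  proof (cases "\<zeta> \<in> ball 0 \<rho>")
    case True
    \<comment> \<open>For |t| < R the point w + t \<zeta> stays in the ball of radius r. Since
      \<rho> < r, the disc of radius R contains the point t = 1 at which the average is
      taken.\<close>
    define R where "R = r / \<rho>"
    have R: "R > 1" using \<rho> by (simp add: R_def)
    have "(\<lambda>t. f (w + sc t \<zeta>)) holomorphic_on ball 0 R"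
    proof (rule cholo_line[OF f(1)])
      fix t :: complex assume t: "t \<in> ball 0 R"
      have "norm (sc t \<zeta>) \<le> cmod t * \<rho>" using True by (simp add: norm_sc mult_left_mono)
      also have "\<dots> < R * \<rho>" using t \<rho> by simp
      also have "\<dots> = r" using \<rho> by (simp add: R_def)
      finally show "w + sc t \<zeta> \<in> U" using r by (auto simp: dist_norm subset_iff)
    qed simp
    from root_average_tendsto[OF this, of 1 0] show ?thesis using True R unfolding A1 by (simp add: zero_left)
  next
    case False
    then show ?thesis unfolding A1 by simp
  qed
  have Ab: "norm (A N \<zeta>) \<le> indicator (ball 0 \<rho>) \<zeta> * B" for N \<zeta>
  proof (cases "\<zeta> \<in> ball 0 \<rho>")
    case True
    have "cmod (root_average N 0 (\<lambda>t. f (w + sc t \<zeta>)) 1) \<le> B"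
      by (rule root_average_norm_le) (use B True in \<open>auto simp: dist_norm norm_sc\<close>)
    then show ?thesis using True unfolding A1 by simp
  next
    case False
    then show ?thesis unfolding A1 by simp
  qed
  have "(\<lambda>N. integral\<^sup>L lborel (A N)) \<longlonglongrightarrow> (LINT \<zeta>|lborel. indicator (ball (0::'a) \<rho>) \<zeta> *\<^sub>R f w)"
    by (rule integral_dominated_convergence[where w = "\<lambda>\<zeta>. indicator (ball 0 \<rho>) \<zeta> * B"])
        (use lim Ab bi in auto)
  moreover have "(\<lambda>N. integral\<^sup>L lborel (A N)) \<longlonglongrightarrow> integral\<^sup>L lborel g"
    by (rule tendsto_eventually) (use Ai in \<open>auto simp: eventually_sequentially intro!: exI[of _ 1]\<close>)
  ultimately have "integral\<^sup>L lborel g = (LINT \<zeta>|lborel. indicator (ball (0::'a) \<rho>) \<zeta> *\<^sub>R f w)"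
    using LIMSEQ_unique by blast
  also have "\<dots> = measure lborel (ball (0::'a) \<rho>) *\<^sub>R f w"
    using emeasure_bounded_finite[OF bounded_ball, of "0::'a" \<rho>]
    by (subst integral_scaleR_left) (auto intro!: integrable_real_indicator)
  finally show "(LINT \<zeta>|lborel. indicator (ball 0 \<rho>) \<zeta> *\<^sub>R f (w + \<zeta>))
      = measure lborel (ball (0::'a) \<rho>) *\<^sub>R f w"
    by (simp add: g_def)
qed

text \<open>The mean value is an inner product with the indicator of a ball, so Cauchy-Schwarz
  bounds it by the norm.\<close>

lemma point_evaluation_bound:
  assumes f: "f \<in> HH" and r: "ball w r \<subseteq> U" and \<rho>: "0 < \<rho>" "\<rho> < r"
  shows "cmod (f w) \<le> sqrt (V / measure lborel (ball (0::'a) \<rho>)) * l2_norm UM f"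
proof -
  define v where "v = measure lborel (ball (0::'a) \<rho>)"
  have v0: "0 < v" using vol_ball \<rho> by (simp add: v_def)
  have fh: "cholo f" "\<And>z. z \<notin> U \<Longrightarrow> f z = 0" using f by (auto simp: HH_def)
  have [measurable]: "f \<in> borel_measurable borel" using HH_measurable[OF f] .
  define F where "F = (\<lambda>\<zeta>. f (w + \<zeta>))"
  define K where "K = (\<lambda>\<zeta>::'a. indicator (ball 0 \<rho>) \<zeta> :: complex)"
  have Fm[measurable]: "F \<in> borel_measurable borel" unfolding F_def by measurable
  have i: "integrable lborel (\<lambda>x. (cmod (f x))\<^sup>2)" using HH_lborel(1)[OF f] by (simp add: L2_def)
  have d: "distr lborel borel ((+) w) = (lborel :: 'a measure)" by (rule lborel_distr_plus)
  have FL: "F \<in> L2 lborel" and Fn: "l2_norm lborel F = l2_norm lborel f"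
    unfolding L2_def l2_norm_def F_def
    using integrable_distr_eq[of "(+) w" lborel borel "\<lambda>x. (cmod (f x))\<^sup>2"]
      integral_distr[of "(+) w" lborel borel "\<lambda>x. (cmod (f x))\<^sup>2"] i d by auto
  have K2: "(\<lambda>x. (cmod (K x))\<^sup>2) = indicator (ball 0 \<rho>)" by (auto simp: K_def indicator_def)
  have KL: "K \<in> L2 lborel" using K2 emeasure_bounded_finite[OF bounded_ball]
    by (auto simp: L2_def K_def intro!: borel_measurable_indicator integrable_real_indicator)
  have Kn: "l2_norm lborel K = sqrt v" unfolding l2_norm_def K2 by (simp add: v_def)
  have "l2_inner lborel F K = (LINT \<zeta>|lborel. indicator (ball 0 \<rho>) \<zeta> *\<^sub>R f (w + \<zeta>))"
    unfolding l2_inner_def by (rule Bochner_Integration.integral_cong) (auto simp: F_def K_def indicator_def)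
  also have "\<dots> = v *\<^sub>R f w" unfolding v_def by (rule mean_value_ball(2)[OF fh r \<rho>])
  finally have "l2_inner lborel F K = v *\<^sub>R f w" .
  then have "v * cmod (f w) = cmod (l2_inner lborel F K)" using v0 by simp
  also have "\<dots> \<le> l2_norm lborel f * sqrt v" using l2_Cauchy_Schwarz[OF FL KL] by (simp add: Fn Kn)
  also have "l2_norm lborel f = sqrt V * l2_norm UM f"
    using HH_lborel(2)[OF f] V_pos by (intro power2_eq_imp_eq[OF _ l2_norm_nonneg]) (auto simp:
        power_mult_distrib)
  finally have "v * cmod (f w) \<le> sqrt V * l2_norm UM f * sqrt v" .
  then have "cmod (f w) \<le> sqrt V * l2_norm UM f * sqrt v / v" using v0 by (simp add: field_simps)
  also have "\<dots> = sqrt (V / v) * l2_norm UM f" using v0 by (simp add: real_sqrt_divide field_simps)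
  finally show ?thesis by (simp add: v_def)
qed

lemma locally_bounded_evaluation:
  assumes "w \<in> U"
  shows "\<exists>r C. 0 < r \<and> 0 < C \<and> ball w (2 * r) \<subseteq> U \<and> (\<forall>f\<in>HH. \<forall>x\<in>ball w (2 * r). cmod (f x) \<le> C * l2_norm UM f)"
proof -
  obtain R where R: "0 < R" "ball w R \<subseteq> U" using U(1) assms by (meson open_contains_ball)
  \<comment> \<open>A point of the ball of radius 2r about w has its own ball of radius 2r inside
    the ball of radius R = 4r, so one constant serves all these points.\<close>
  define r where "r = R / 4"
  define C where "C = sqrt (V / measure lborel (ball (0::'a) r))"
  have r0: "0 < r" using R by (simp add: r_def)
  have "cmod (f x) \<le> C * l2_norm UM f" if "f \<in> HH" "x \<in> ball w (2 * r)" for f x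
    unfolding C_def
  proof (rule point_evaluation_bound[OF that(1), of x "2 * r"])
    have "ball x (2 * r) \<subseteq> ball w R"
    proof
      fix y assume "y \<in> ball x (2 * r)"
      then show "y \<in> ball w R" using that(2) dist_triangle[of w y x] by (simp add: r_def)
    qed
    then show "ball x (2 * r) \<subseteq> U" using R by blast
  qed (use r0 in auto)
  moreover have "ball w (2 * r) \<subseteq> U" using R by (force simp: r_def)
  moreover have "0 < C" using V_pos vol_ball[OF r0] by (simp add: C_def)
  ultimately show ?thesis using r0 by blast
qed

lemma HH_eq0: "f \<in> HH \<Longrightarrow> l2_norm UM f = 0 \<Longrightarrow> f = 0"
proof
  fix w assume f: "f \<in> HH" "l2_norm UM f = 0"
  show "f w = 0 w"
  proof (cases "w \<in> U")
    case True
    then obtain r C where "0 < r" "\<forall>f\<in>HH. \<forall>x\<in>ball w (2 * r). cmod (f x) \<le> C * l2_norm UM f"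
      using locally_bounded_evaluation by blast
    then have "cmod (f w) \<le> C * l2_norm UM f" using f(1) by auto
    then show ?thesis using f by simp
  qed (use f in \<open>simp add: HH_def\<close>)
qed

lemma cholo_add:
  assumes "cholo f" "cholo g" shows "cholo (f + g)"
  unfolding cholo_def
proof
  fix z assume "z \<in> U"
  then obtain D D' where "(f has_derivative D) (at z)" "\<forall>c v. D (sc c v) = c * D v"
    "(g has_derivative D') (at z)" "\<forall>c v. D' (sc c v) = c * D' v" using assms unfolding cholo_def by meson
  then show "\<exists>D. ((f + g) has_derivative D) (at z) \<and> (\<forall>c v. D (sc c v) = c * D v)"
    by (intro exI[of _ "\<lambda>v. D v + D' v"] conjI) (auto simp: plus_fun_def distrib_left intro:
        has_derivative_add)
qed

lemma cholo_scale:
  assumes "cholo f" shows "cholo (\<lambda>x. a * f x)"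
  unfolding cholo_def
proof
  fix z assume "z \<in> U"
  then obtain D where "(f has_derivative D) (at z)" "\<forall>c v. D (sc c v) = c * D v"
    using assms unfolding cholo_def by meson
  then show "\<exists>D. ((\<lambda>x. a * f x) has_derivative D) (at z) \<and> (\<forall>c v. D (sc c v) = c * D v)"
    by (intro exI[of _ "\<lambda>v. a * D v"]) (auto intro: has_derivative_mult_right)
qed

lemma HH_subspace: "cfun.subspace HH"
proof (rule cfun.subspaceI)
  show "0 \<in> HH" by (auto simp: HH_def cholo_def zero_fun_def intro!: exI[of _ "\<lambda>_. 0"])
  fix f g c assume fg: "f \<in> HH" "g \<in> HH"
  show "f + g \<in> HH"
    using L2_add[OF HH_L2[OF fg(1)] HH_L2[OF fg(2)]] fg cholo_add by (auto simp: HH_def L2_def)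
  show "(\<lambda>x. c * f x) \<in> HH"
    using L2_scale[OF HH_L2[OF fg(1)]] fg cholo_scale by (auto simp: HH_def L2_def)
qed

text \<open>Cauchy's inequality on the complex line through x in direction h.\<close>

lemma derivative_bound:
  assumes f: "f \<in> HH" and r: "0 < r" "ball w (2 * r) \<subseteq> U" "\<And>x. x \<in> ball w (2 * r) \<Longrightarrow> cmod (f x) \<le> B"
    and x: "x \<in> ball w r" and D: "(f has_derivative D) (at x)" "\<And>c v. D (sc c v) = c * D v"
  shows "cmod (D h) \<le> 2 * B / r * norm h"
proof (cases "h = 0")
  case True
  then show ?thesis using D(2)[of 0 0] bounded_bilinear.zero_left[OF bil] by simp
next
  case False
  \<comment> \<open>For |t| < \<open>t0\<close> the displacement by t h is shorter than r, so the
    line stays in the ball of radius 2r. Using the closed disc of radius \<open>t0\<close>/2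
    produces the factor 2 in the bound.\<close>
  define t0 where "t0 = r / norm h"
  have t0: "t0 > 0" using False r by (simp add: t0_def)
  interpret bounded_bilinear sc by (rule bil)
  have inb: "x + sc t h \<in> ball w (2 * r)" if "t \<in> ball 0 t0" for t
  proof -
    have "norm (sc t h) < r" using that False by (simp add: norm_sc t0_def field_simps)
    then have "dist x (x + sc t h) < r" by (simp add: dist_norm)
    then show ?thesis using x dist_triangle[of w "x + sc t h" x] by simp
  qed
  have hol: "(\<lambda>t. f (x + sc t h)) holomorphic_on ball 0 t0"
    by (rule cholo_line) (use f r inb in \<open>auto simp: HH_def\<close>)
  have "((\<lambda>t. x + sc t h) has_derivative (\<lambda>s. sc s h)) (at 0)"
    by (auto intro!: derivative_eq_intros bounded_linear_imp_has_derivative bounded_linear_left)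
  moreover have "(f has_derivative D) (at (x + sc 0 h))" using D(1) by (simp add: zero_left)
  ultimately have "((\<lambda>t. f (x + sc t h)) has_derivative (\<lambda>s. D (sc s h))) (at 0)"
    by (rule has_derivative_compose)
  then have "((\<lambda>t. f (x + sc t h)) has_field_derivative D h) (at 0)"
    unfolding has_field_derivative_def by (rule has_derivative_eq_rhs) (simp add: fun_eq_iff D(2))
  then have dD: "deriv (\<lambda>t. f (x + sc t h)) 0 = D h" by (rule DERIV_imp_deriv)
  have "norm ((deriv ^^ 1) (\<lambda>t. f (x + sc t h)) 0) \<le> fact 1 * B / (t0 / 2) ^ 1"
  proof (rule Cauchy_inequality)
    show "(\<lambda>t. f (x + sc t h)) holomorphic_on ball 0 (t0 / 2)"
      by (rule holomorphic_on_subset[OF hol]) (use t0 in auto)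
    show "continuous_on (cball 0 (t0 / 2)) (\<lambda>t. f (x + sc t h))"
      by (rule continuous_on_subset[OF holomorphic_on_imp_continuous_on[OF hol]]) (use t0 in auto)
    show "norm (f (x + sc t h)) \<le> B" if "norm (0 - t) = t0 / 2" for t
      using that t0 by (intro r(3) inb) simp
  qed (use t0 in auto)
  then have "cmod (D h) \<le> B / (t0 / 2)" unfolding dD[symmetric] by simp
  also have "\<dots> = 2 * B / r * norm h" using False r by (simp add: t0_def field_simps)
  finally show ?thesis .
qed

text \<open>A norm-Cauchy sequence converges pointwise and, locally uniformly, in its derivatives.
  The limit is then differentiable with complex-linear derivative, and Fatou's lemma makes it the
  norm limit.\<close>

theorem HH_hilbert: "l2_hilbert UM HH"
proof -
  have "\<exists>f\<in>HH. l2_tendsto UM s f"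
    if s: "\<And>k. s k \<in> HH" and C: "\<And>e. e > 0 \<Longrightarrow> \<exists>N. \<forall>m\<ge>N. \<forall>n\<ge>N. l2_norm UM (s m - s n) < e" for s
  proof -
    have sd: "s m - s n \<in> HH" for m n using s HH_subspace cfun.subspace_diff by blast
    define D where "D n z = (SOME D. (s n has_derivative D) (at z) \<and> (\<forall>c v. D (sc c v) = c * D v))" for n z
    have "(s n has_derivative D n z) (at z) \<and> (\<forall>c v. D n z (sc c v) = c * D n z v)" if z: "z \<in> U" for n z
    proof -
      have "cholo (s n)" using s by (simp add: HH_def)
      then have "\<exists>D. (s n has_derivative D) (at z) \<and> (\<forall>c v. D (sc c v) = c * D v)"
        unfolding cholo_def using z by (rule bspec)
      then show ?thesis unfolding D_def by (rule someI_ex)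
    qed
    then have D: "\<And>n z. z \<in> U \<Longrightarrow> (s n has_derivative D n z) (at z)"
      "\<And>n z c v. z \<in> U \<Longrightarrow> D n z (sc c v) = c * D n z v" by blast+
    \<comment> \<open>Both the values at w and the derivatives near w are controlled by the norm,
      with a constant independent of the indices.\<close>
    have loc: "\<exists>r C. 0 < r \<and> 0 < C \<and> ball w r \<subseteq> U \<and> (\<forall>m n. \<forall>x\<in>ball w r. \<forall>h. cmod (D m x h - D n x h)
        \<le> C * l2_norm UM (s m - s n) * norm h)
       \<and> (\<forall>m n. cmod (s m w - s n w) \<le> C * l2_norm UM (s m - s n))" if w: "w \<in> U" for w
    proof -
      obtain r C where rC: "0 < r" "0 < C" "ball w (2 * r) \<subseteq> U"
         "\<And>f x. f \<in> HH \<Longrightarrow> x \<in> ball w (2 * r) \<Longrightarrow> cmod (f x) \<le> C * l2_norm UM f"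
        using locally_bounded_evaluation[OF w] by blast
      define C' where "C' = max C (2 * C / r)"
      have 1: "cmod (D m x h - D n x h) \<le> C' * l2_norm UM (s m - s n) * norm h" if x: "x \<in> ball w r"
          for m n x h
      proof -
        have xU: "x \<in> U" using x rC by force
        have d: "(s m - s n has_derivative (\<lambda>h. D m x h - D n x h)) (at x)"
          unfolding fun_diff_def by (intro has_derivative_diff D xU)
        have "cmod (D m x h - D n x h) \<le> 2 * (C * l2_norm UM (s m - s n)) / r * norm h"
          by (rule derivative_bound[OF sd rC(1,3) rC(4)[OF sd] x d]) (auto simp: D(2)[OF xU] algebra_simps)
        also have "\<dots> = (2 * C / r) * l2_norm UM (s m - s n) * norm h" by simp
        also have "\<dots> \<le> C' * l2_norm UM (s m - s n) * norm h" by (intro mult_right_mono) (auto simp: C'_def)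
        finally show ?thesis .
      qed
      have 2: "cmod (s m w - s n w) \<le> C' * l2_norm UM (s m - s n)" for m n
      proof -
        have "cmod ((s m - s n) w) \<le> C * l2_norm UM (s m - s n)" using rC by (intro rC(4) sd) auto
        also have "\<dots> \<le> C' * l2_norm UM (s m - s n)" by (intro mult_right_mono) (auto simp: C'_def)
        finally show ?thesis by simp
      qed
      have "0 < C'" "ball w r \<subseteq> U" using rC by (auto simp: C'_def)
      then show ?thesis using rC(1) 1 2 by blast
    qed
    have small: "\<exists>N. \<forall>m\<ge>N. \<forall>n\<ge>N. K * l2_norm UM (s m - s n) \<le> e" if "e > 0" "K \<ge> 0" for e K
    proof -
      have "0 < e / (K + 1)" using that by simp
      from C[OF this] obtain N where N: "\<forall>m\<ge>N. \<forall>n\<ge>N. l2_norm UM (s m - s n) < e / (K + 1)" ..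
      have "K * l2_norm UM (s m - s n) \<le> e" if "m \<ge> N" "n \<ge> N" for m n
      proof -
        have "K * l2_norm UM (s m - s n) \<le> K * (e / (K + 1))"
          using N that \<open>K \<ge> 0\<close> by (intro mult_left_mono) (auto intro: less_imp_le)
        also have "\<dots> \<le> e" using \<open>e > 0\<close> \<open>K \<ge> 0\<close> by (simp add: field_simps)
        finally show ?thesis .
      qed
      then show ?thesis by blast
    qed
    have "convergent (\<lambda>n. s n w)" if w: "w \<in> U" for w
    proof -
      obtain C' where C': "0 < C'" "\<And>m n. cmod (s m w - s n w) \<le> C' * l2_norm UM (s m - s n)"
          using loc[OF w] by blast
      have "Cauchy (\<lambda>n. s n w)"
      proof (rule CauchyI)
        fix e :: real assume "0 < e"
        then obtain N where "\<forall>m\<ge>N. \<forall>n\<ge>N. C' * l2_norm UM (s m - s n) \<le> e / 2" using small[of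
            "e/2" C'] C' by auto
        then have "\<forall>m\<ge>N. \<forall>n\<ge>N. cmod (s m w - s n w) \<le> e / 2" using C'(2) order_trans by blast
        then show "\<exists>N. \<forall>m\<ge>N. \<forall>n\<ge>N. cmod (s m w - s n w) < e"
          using \<open>0 < e\<close> by (intro exI[of _ N]) fastforce
      qed
      then show ?thesis by (simp add: Cauchy_convergent_iff)
    qed
    then obtain G0 where G0: "\<And>w. w \<in> U \<Longrightarrow> (\<lambda>n. s n w) \<longlonglongrightarrow> G0 w" unfolding convergent_def by metis
    define G where "G w = (if w \<in> U then G0 w else 0)" for w
    have Glim: "(\<lambda>n. s n w) \<longlonglongrightarrow> G w" for w
      using G0[of w] s by (cases "w \<in> U") (auto simp: G_def HH_def)
    have "convergent (\<lambda>n. D n w h)" if w: "w \<in> U" for w h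
    proof -
      obtain r C' where C': "0 < r" "0 < C'" "\<forall>m n. \<forall>x\<in>ball w r. \<forall>h. cmod (D m x h - D n x h)
          \<le> C' * l2_norm UM (s m - s n) * norm h" 
        using loc[OF w] by blast
      then have C'': "cmod (D m w h - D n w h) \<le> (C' * norm h) * l2_norm UM (s m - s n)" for m n
        by (simp add: mult_ac)
      have "Cauchy (\<lambda>n. D n w h)"
      proof (rule CauchyI)
        fix e :: real assume "0 < e"
        then obtain N where "\<forall>m\<ge>N. \<forall>n\<ge>N. (C' * norm h) * l2_norm UM (s m - s n) \<le> e / 2"
            using small[of "e/2" "C' * norm h"] C' by auto
        then have "\<forall>m\<ge>N. \<forall>n\<ge>N. cmod (D m w h - D n w h) \<le> e / 2" using C'' order_trans by blast
        then show "\<exists>N. \<forall>m\<ge>N. \<forall>n\<ge>N. cmod (D m w h - D n w h) < e"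
          using \<open>0 < e\<close> by (intro exI[of _ N]) fastforce
      qed
      then show ?thesis by (simp add: Cauchy_convergent_iff)
    qed
    then obtain D' where D': "\<And>w h. w \<in> U \<Longrightarrow> (\<lambda>n. D n w h) \<longlonglongrightarrow> D' w h" unfolding convergent_def by metis
    have GD: "(G has_derivative D' w) (at w)" if w: "w \<in> U" for w
    proof -
      obtain r C' where C': "0 < r" "0 < C'" "ball w r \<subseteq> U"
        "\<And>m n x h. x\<in>ball w r \<Longrightarrow> cmod (D m x h - D n x h) \<le> C' * l2_norm UM (s m - s n) * norm h" 
        using loc[OF w] by blast
      \<comment> \<open>The theorem on sequences of derivatives returns a limit of its own on the
        ball; uniqueness of pointwise limits later identifies it with G.\<close>
      have "\<exists>g. \<forall>x\<in>ball w r. (\<lambda>n. s n x) \<longlonglongrightarrow> g x \<and> (g has_derivative D' x) (at x within ball w r)"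
      proof (rule has_derivative_sequence[where f' = D])
        fix n x assume "x \<in> ball w r"
        then have "x \<in> U" using C' by blast
        then show "(s n has_derivative D n x) (at x within ball w r)"
            using D(1) has_derivative_at_withinI by blast
      next
        fix e :: real assume "e > 0"
        then obtain N where N0: "\<forall>m\<ge>N. \<forall>n\<ge>N. C' * l2_norm UM (s m - s n) \<le> e"
          using small[of e C'] C'(2) by auto
        have N: "C' * l2_norm UM (s m - s n) \<le> e" if "m \<ge> N" "n \<ge> N" for m n using N0 that by blast
        have "norm (D n x h - D' x h) \<le> e * norm h" if "n \<ge> N" "x \<in> ball w r" for n x h
        proof (rule LIMSEQ_le_const2)
          show "(\<lambda>m. norm (D n x h - D m x h)) \<longlonglongrightarrow> norm (D n x h - D' x h)"
            using that C' by (intro tendsto_intros D') auto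
          have "norm (D n x h - D m x h) \<le> e * norm h" if "m \<ge> N" for m
            using C'(4)[OF \<open>x \<in> ball w r\<close>, of n h m] N[OF \<open>n \<ge> N\<close> that] mult_right_mono[OF _
                norm_ge_zero[of h]]
            by (meson order_trans)
          then show "\<exists>K. \<forall>m\<ge>K. norm (D n x h - D m x h) \<le> e * norm h" by blast
        qed
        then show "\<forall>\<^sub>F n in sequentially. \<forall>x\<in>ball w r. \<forall>h. norm (D n x h - D' x h) \<le> e * norm h"
          unfolding eventually_sequentially by blast
      next
        show "w \<in> ball w r" using C' by simp
        show "(\<lambda>n. s n w) \<longlonglongrightarrow> G w" by (rule Glim)
      qed simp
      then obtain g where g: "\<And>x. x\<in>ball w r \<Longrightarrow> (\<lambda>n. s n x) \<longlonglongrightarrow> g x" "\<And>x. x\<in>ball w r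
          \<Longrightarrow> (g has_derivative D' x) (at x within ball w r)" by blast
      have "(g has_derivative D' w) (at w)"
        using g(2)[of w] C'(1) at_within_open[of w "ball w r"] by simp
      then show ?thesis
      proof (rule has_derivative_transform_within_open[where s = "ball w r"])
        fix x assume "x \<in> ball w r"
        then show "g x = G x" using g(1) Glim LIMSEQ_unique by blast
      qed (use C' in auto)
    qed
    have Dsc: "D' w (sc c v) = c * D' w v" if w: "w \<in> U" for w c v
    proof -
      have "(\<lambda>n. c * D n w v) \<longlonglongrightarrow> D' w (sc c v)" using D'[OF w, of "sc c v"] by (simp add: D(2)[OF w])
      moreover have "(\<lambda>n. c * D n w v) \<longlonglongrightarrow> c * D' w v" by (intro tendsto_mult_left D' w)
      ultimately show ?thesis using LIMSEQ_unique by blast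
    qed
    have Gc: "cholo G" unfolding cholo_def using GD Dsc by blast
    have G0': "\<And>z. z \<notin> U \<Longrightarrow> G z = 0" by (simp add: G_def)
    have Gm: "G \<in> borel_measurable UM" using cholo_measurable[OF Gc G0']
        by (simp add: measurable_cong_sets[OF sets_UM refl])
    have "G \<in> L2 UM" "l2_tendsto UM s G"
      using l2_Fatou[OF HH_L2[OF s] Gm _ C] Glim by auto
    moreover from this have "G \<in> HH" using Gc G0' by (simp add: HH_def L2_def)
    ultimately show ?thesis by blast
  qed
  then show ?thesis unfolding l2_hilbert_def using HH_L2 HH_subspace HH_eq0 by blast
qed

end

subsection \<open>The Bergman space of the disc\<close>

interpretation disc: holomorphic_L2 "(*)" "ball 0 1 :: complex set"
  rewrites "holomorphic_L2.UM (ball 0 1 :: complex set) = disc_measure"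
    and "holomorphic_L2.HH (*) (ball 0 1 :: complex set) = bergman_disc"
proof -
  show i: "holomorphic_L2 (*) (ball 0 1 :: complex set)"
    by (rule holomorphic_L2.intro) (auto simp: norm_mult lborel_rotation_complex bounded_bilinear_mult)
  show UM: "holomorphic_L2.UM (ball 0 1 :: complex set) = disc_measure"
    by (simp add: holomorphic_L2.UM_def[OF i] disc_measure_def)
  have "holomorphic_L2.cholo (*) (ball 0 1 :: complex set) f \<longleftrightarrow> f holomorphic_on ball 0 1" for f
  proof -
    have "(\<exists>D. (f has_derivative D) (at z) \<and> (\<forall>c v. D (c * v) = c * D v))
        \<longleftrightarrow> (\<exists>f'. (f has_field_derivative f') (at z))" for z
    proof
      assume "\<exists>D. (f has_derivative D) (at z) \<and> (\<forall>c v. D (c * v) = c * D v)"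
      then obtain D where D: "(f has_derivative D) (at z)" "\<forall>c v. D (c * v) = c * D v" by blast
      \<comment> \<open>A complex-linear map of the plane is multiplication by its value at
        1.\<close>
      have "D = (*) (D 1)"
      proof
        fix x show "D x = D 1 * x" using D(2)[rule_format, of x 1] by simp
      qed
      then show "\<exists>f'. (f has_field_derivative f') (at z)" using D(1)
          unfolding has_field_derivative_def by metis
    next
      assume "\<exists>f'. (f has_field_derivative f') (at z)"
      then obtain d where "(f has_derivative (*) d) (at z)" unfolding has_field_derivative_def by blast
      then show "\<exists>D. (f has_derivative D) (at z) \<and> (\<forall>c v. D (c * v) = c * D v)"
        by (intro exI[of _ "(*) d"]) auto
    qed
    then show ?thesis
      unfolding holomorphic_L2.cholo_def[OF i] holomorphic_on_open[OF open_ball] by simp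
  qed
  then show "holomorphic_L2.HH (*) (ball 0 1 :: complex set) = bergman_disc"
    unfolding holomorphic_L2.HH_def[OF i] bergman_disc_def UM by simp
qed

abbreviation dip :: "(complex \<Rightarrow> complex) \<Rightarrow> (complex \<Rightarrow> complex) \<Rightarrow> complex" where
  "dip \<equiv> l2_inner disc_measure"

abbreviation dnorm :: "(complex \<Rightarrow> complex) \<Rightarrow> real" where
  "dnorm \<equiv> l2_norm disc_measure"

lemmas bergman_disc_hilbert = disc.HH_hilbert
lemmas bergman_disc_L2 = disc.HH_L2

section \<open>Rotation invariance and radial moments of the normalized area measure\<close>

lemma sets_disc_measure [measurable_cong, simp]: "sets disc_measure = sets borel"
  by (simp add: disc_measure_def)

lemma space_disc_measure [simp]: "space disc_measure = UNIV"
  by (simp add: disc_measure_def)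

lemma measurable_disc_measure: "f \<in> borel_measurable borel \<Longrightarrow> f \<in> borel_measurable disc_measure"
  by (simp add: measurable_cong_sets[OF sets_disc_measure refl])

lemma prob_space_disc: "prob_space disc_measure"
  unfolding disc_measure_def by (rule prob_space_uniform_measure[OF disc.emeasure_U])

interpretation disc_prob: prob_space disc_measure
  by (rule prob_space_disc)

lemma AE_disc: "AE z in disc_measure. z \<in> ball 0 1"
  unfolding disc_measure_def by (rule AE_uniform_measureI) auto

lemma AE_disc_id: "AE z in disc_measure. cmod z \<le> 1"
  using AE_disc by eventually_elim simp

lemma id_disc_measurable: "(\<lambda>z. z) \<in> borel_measurable disc_measure" "cnj \<in> borel_measurable disc_measure"
  by (auto intro!: measurable_disc_measure borel_measurable_continuous_onI continuous_intros)

lemma disc_rotation: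
  assumes "cmod \<omega> = 1"
  shows "distr disc_measure borel ((*) \<omega>) = disc_measure"
proof (rule measure_eqI)
  fix A assume "A \<in> sets (distr disc_measure borel ((*) \<omega>))"
  then have A[measurable]: "A \<in> sets borel" by simp
  have m[measurable]: "(*) \<omega> \<in> borel_measurable borel" by (intro borel_measurable_continuous_onI
      continuous_intros)
  have B: "(*) \<omega> -` X \<in> sets borel" if "X \<in> sets borel" for X using measurable_sets[OF m that] by simp
  have "emeasure (distr disc_measure borel ((*) \<omega>)) A = emeasure disc_measure ((*) \<omega> -` A)"
    by (subst emeasure_distr) (auto intro: measurable_disc_measure)
  also have "\<dots> = emeasure lborel (ball 0 1 \<inter> (*) \<omega> -` A) / emeasure lborel (ball 0 1 :: complex set)"
    unfolding disc_measure_def by (subst emeasure_uniform_measure) (auto intro: B)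
  also have "ball 0 1 \<inter> (*) \<omega> -` A = (*) \<omega> -` (ball 0 1 \<inter> A) \<inter> space lborel"
    using assms by (auto simp: norm_mult)
  also have "emeasure lborel \<dots> = emeasure (distr lborel borel ((*) \<omega>)) (ball 0 1 \<inter> A)"
    by (subst emeasure_distr) auto
  also have "\<dots> = emeasure lborel (ball 0 1 \<inter> A)" by (simp add: lborel_rotation_complex[OF assms])
  also have "\<dots> / emeasure lborel (ball 0 1 :: complex set) = emeasure disc_measure A"
    unfolding disc_measure_def by (subst emeasure_uniform_measure) auto
  finally show "emeasure (distr disc_measure borel ((*) \<omega>)) A = emeasure disc_measure A" .
qed simp

lemma disc_integral_rotation:
  fixes g :: "complex \<Rightarrow> complex"
  assumes "g \<in> borel_measurable borel" "cmod \<omega> = 1"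
  shows "(LINT z|disc_measure. g (\<omega> * z)) = integral\<^sup>L disc_measure g"
proof -
  have "(*) \<omega> \<in> borel_measurable disc_measure" 
    by (intro measurable_disc_measure borel_measurable_continuous_onI continuous_intros)
  then show ?thesis
    using integral_distr[of "(*) \<omega>" disc_measure borel g] disc_rotation[OF assms(2)] assms(1) by simp
qed

lemma disc_integrable_rotation:
  fixes g :: "complex \<Rightarrow> complex"
  assumes "g \<in> borel_measurable borel" "cmod \<omega> = 1" "integrable disc_measure g"
  shows "integrable disc_measure (\<lambda>z. g (\<omega> * z))"
proof -
  have "(*) \<omega> \<in> borel_measurable disc_measure" 
    by (intro measurable_disc_measure borel_measurable_continuous_onI continuous_intros)
  then show ?thesis
    using integrable_distr_eq[of "(*) \<omega>" disc_measure borel g] disc_rotation[OF assms(2)] assms(1,3) by simp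
qed

lemma measure_disc_cball:
  assumes "0 \<le> r" "r \<le> 1"
  shows "measure disc_measure {z. cmod z \<le> r} = r\<^sup>2"
\<comment> \<open>The intersection with the open unit disc is the closed disc of radius r only for r
  < 1; at r = 1 the missing circle makes a separate argument necessary.\<close>
proof (cases "r = 1")
  case True
  have "AE z in disc_measure. z \<in> {z. cmod z \<le> r}" using AE_disc_id True by simp
  moreover have "{z::complex. cmod z \<le> r} \<in> sets borel" by measurable
  ultimately show ?thesis using disc_prob.prob_eq_1[of "{z. cmod z \<le> r}"] True by simp
next
  case False
  then have r: "r < 1" using assms by simp
  have "measure disc_measure {z. cmod z \<le> r} = measure lborel (ball 0 1 \<inter> {z. cmod z
      \<le> r}) / measure lborel (ball 0 1 :: complex set)"
    unfolding disc_measure_def by (rule measure_uniform_measure[OF disc.emeasure_U]) simp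
  also have "ball 0 1 \<inter> {z. cmod z \<le> r} = cball 0 r" using r by auto
  also have "measure lborel (cball 0 r :: complex set) = pi * r\<^sup>2"
    using assms by (simp add: content_cball unit_ball_vol_2)
  also have "measure lborel (ball 0 1 :: complex set) = pi" by (simp add: content_ball unit_ball_vol_2)
  finally show ?thesis by simp
qed

text \<open>The squared modulus of a random point of the disc is uniformly distributed on the unit
  interval; this replaces integration in polar coordinates.\<close>

lemma distr_disc_norm_sq: "distr disc_measure borel (\<lambda>z. (cmod z)\<^sup>2) = uniform_measure lborel {0..1}"
proof (rule cdf_unique)
  have m[measurable]: "(\<lambda>z. (cmod z)\<^sup>2) \<in> borel_measurable disc_measure"
    by (intro measurable_disc_measure) measurable
  show "real_distribution (distr disc_measure borel (\<lambda>z. (cmod z)\<^sup>2))"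
    by (rule disc_prob.real_distribution_distr) simp
  show "real_distribution (uniform_measure lborel {0..1})"
    unfolding real_distribution_def real_distribution_axioms_def
    by (auto intro!: prob_space_uniform_measure)
  show "cdf (distr disc_measure borel (\<lambda>z. (cmod z)\<^sup>2)) = cdf (uniform_measure lborel {0..1})"
  proof
    fix t :: real
    have 1: "cdf (distr disc_measure borel (\<lambda>z. (cmod z)\<^sup>2)) t = measure disc_measure {z. (cmod z)\<^sup>2 \<le> t}"
      unfolding cdf_def by (subst measure_distr) (auto simp: vimage_def)
    have 2: "cdf (uniform_measure lborel {0..1}) t = measure lborel ({0..1} \<inter> {..t})"
      unfolding cdf_def by (subst measure_uniform_measure) auto
    consider "t < 0" | "0 \<le> t" "t \<le> 1" | "1 < t" by linarith
    then show "cdf (distr disc_measure borel (\<lambda>z. (cmod z)\<^sup>2)) t = cdf (uniform_measure lborel {0..1}) t"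
    proof cases
      case 1
      then have "{z. (cmod z)\<^sup>2 \<le> t} = {}" "{0..1} \<inter> {..t} = {}"
        by (auto simp: not_le intro: less_le_trans)
      then show ?thesis unfolding \<open>cdf (distr _ _ _) t = _\<close> 2 by simp
    next
      case a: 2
      have "{z. (cmod z)\<^sup>2 \<le> t} = {z. cmod z \<le> sqrt t}"
        using real_le_rsqrt real_sqrt_ge_0_iff a by (auto simp: real_le_rsqrt) (metis norm_ge_zero
            power_mono real_sqrt_pow2)
      moreover have "{0..1} \<inter> {..t} = {0..t}" using a by auto
      ultimately show ?thesis unfolding 1 2 using a measure_disc_cball[of "sqrt t"] by simp
    next
      case b: 3
      have "AE z in disc_measure. z \<in> {z. (cmod z)\<^sup>2 \<le> t}"
        using AE_disc_id by eventually_elim (use b in \<open>auto intro: order_trans[OF power_le_one]\<close>)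
      moreover have "{z::complex. (cmod z)\<^sup>2 \<le> t} \<in> sets borel" by measurable
      ultimately have "measure disc_measure {z. (cmod z)\<^sup>2 \<le> t} = 1"
        using disc_prob.prob_eq_1[of "{z. (cmod z)\<^sup>2 \<le> t}"] by simp
      moreover have "{0..1} \<inter> {..t} = {0..1}" using b by auto
      ultimately show ?thesis unfolding 1 2 by simp
    qed
  qed
qed

text \<open>The squared modulus is uniform on the unit interval, so this is its m-th moment. It is
  the squared norm of z^m, the origin of all weights below.\<close>

lemma disc_integral_power: "(LINT z|disc_measure. (cmod z) ^ (2 * m)) = 1 / (Suc m)"
proof -
  have m[measurable]: "(\<lambda>z. (cmod z)\<^sup>2) \<in> borel_measurable disc_measure"
    by (intro measurable_disc_measure) measurable
  have e: "uniform_measure lborel {0..1::real} = density lborel (\<lambda>x. ennreal (indicator {0..1} x))"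
    by (subst uniform_measure_lborel_eq) auto
  have "(LINT z|disc_measure. (cmod z) ^ (2 * m)) = (LINT z|disc_measure. ((cmod z)\<^sup>2) ^ m)"
      by (simp add: power_mult)
  also have "\<dots> = (LINT u|distr disc_measure borel (\<lambda>z. (cmod z)\<^sup>2). u ^ m)"
    by (subst integral_distr) auto
  also have "\<dots> = (LINT u|lborel. indicator {0..1} u *\<^sub>R u ^ m)"
    unfolding distr_disc_norm_sq e by (subst integral_density) auto
  also have "\<dots> = (LINT u|lborel. u ^ m * indicator {0..1} u)" by (simp add: mult.commute)
  also have "\<dots> = 1 / (Suc m)" by (subst integral_power) auto
  finally show ?thesis .
qed

section \<open>Monomials and Taylor coefficients\<close>

definition mono_fn :: "nat \<Rightarrow> complex \<Rightarrow> complex" where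
  "mono_fn m z = (if z \<in> ball 0 1 then z ^ m else 0)"

lemma mono_fn_holomorphic: "mono_fn m holomorphic_on ball 0 1"
  by (rule holomorphic_transform[of "\<lambda>z. z ^ m"]) (auto simp: mono_fn_def intro!: holomorphic_intros)

lemma mono_fn_measurable [measurable]: "mono_fn m \<in> borel_measurable borel"
  unfolding mono_fn_def by (rule borel_measurable_continuous_on_if) (auto intro!: continuous_intros)

lemma mono_fn_le: "cmod (mono_fn m z) \<le> 1"
  by (auto simp: mono_fn_def norm_power power_le_one)

lemma mono_fn_bergman: "mono_fn m \<in> bergman_disc"
proof -
  have "integrable disc_measure (\<lambda>z. (cmod (mono_fn m z))\<^sup>2)"
  proof (rule disc_prob.integrable_const_bound[of _ 1])
    show "AE x in disc_measure. norm ((cmod (mono_fn m x))\<^sup>2) \<le> 1" using mono_fn_le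
        by (auto simp: power_le_one)
    show "(\<lambda>z. (cmod (mono_fn m z))\<^sup>2) \<in> borel_measurable disc_measure"
        by (intro measurable_disc_measure) measurable
  qed
  then show ?thesis unfolding bergman_disc_def using mono_fn_holomorphic by (auto simp: mono_fn_def)
qed

lemma mono_fn_norm: "(dnorm (mono_fn m))\<^sup>2 = 1 / Suc m"
proof -
  have "(LINT z|disc_measure. (cmod (mono_fn m z))\<^sup>2) = (LINT z|disc_measure. (cmod z) ^ (2 * m))"
  proof (rule integral_cong_AE)
    show "AE z in disc_measure. (cmod (mono_fn m z))\<^sup>2 = (cmod z) ^ (2 * m)"
      using AE_disc by eventually_elim (auto simp: mono_fn_def norm_power power_mult[symmetric] mult.commute)
  qed (intro measurable_disc_measure; measurable)+
  then show ?thesis by (simp add: l2_norm_sq disc_integral_power)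
qed

text \<open>Rotation by a root of unity of order above both exponents multiplies the inner product
  by a factor different from 1, yet leaves it unchanged.\<close>

lemma mono_fn_orthogonal:
  assumes "j \<noteq> m"
  shows "dip (mono_fn j) (mono_fn m) = 0"
proof -
  define N where "N = Suc (max j m)"
  define w where "w = unity_root N"
  have w: "cmod w = 1" by (simp add: w_def)
  have ww: "cnj w * w = 1" using w complex_norm_square[of w] by (simp add: mult.commute)
  let ?g = "\<lambda>z. mono_fn j z * cnj (mono_fn m z)"
  have r: "mono_fn i (w * z) = w ^ i * mono_fn i z" for i z
    using w by (auto simp: mono_fn_def norm_mult power_mult_distrib)
  have "integral\<^sup>L disc_measure ?g = (LINT z|disc_measure. ?g (w * z))"
    by (rule disc_integral_rotation[OF _ w, symmetric]) measurable
  also have "\<dots> = (LINT z|disc_measure. (w ^ j * cnj w ^ m) * ?g z)"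
      by (simp only: r complex_cnj_mult complex_cnj_power mult.assoc mult.left_commute)
  also have "\<dots> = (w ^ j * cnj w ^ m) * integral\<^sup>L disc_measure ?g" by (rule integral_mult_right_zero)
  finally have e: "integral\<^sup>L disc_measure ?g = (w ^ j * cnj w ^ m) * integral\<^sup>L disc_measure ?g" .
  have "w ^ j * cnj w ^ m \<noteq> 1"
  proof
    assume "w ^ j * cnj w ^ m = 1"
    then have "w ^ j * cnj w ^ m * w ^ m = w ^ m" by simp
    then have "w ^ j * (cnj w * w) ^ m = w ^ m" by (simp add: power_mult_distrib mult.assoc)
    then have "w ^ j = w ^ m" using ww by simp
    then show False using unity_root_power_eq_iff[of N j m] assms by (simp add: w_def N_def less_Suc_eq_le)
  qed
  then show ?thesis using e unfolding l2_inner_def by simp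
qed

text \<open>Averaging over rotations isolates the \<open>m\<close>-th Taylor coefficient on each smaller disc.\<close>

lemma bergman_coefficient_ball:
  assumes h: "h \<in> bergman_disc" and r: "0 < r" "r < 1"
  shows "(LINT z|disc_measure. indicator (ball 0 r) z *\<^sub>R (h z * cnj (mono_fn m z)))
    = (deriv ^^ m) h 0 / fact m * (LINT z|disc_measure. indicator (ball 0 r) z *\<^sub>R of_real ((cmod z)
        ^ (2 * m)))"
proof -
  have hol: "h holomorphic_on ball 0 1" using h by (simp add: bergman_disc_def)
  have [measurable]: "h \<in> borel_measurable borel" using disc.HH_measurable[OF h] .
  \<comment> \<open>The reason for the smaller radius: there h is bounded, which gives a constant
    dominating all averages.\<close>
  have "bounded (h ` cball 0 r)"
    by (intro compact_imp_bounded compact_continuous_image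
        continuous_on_subset[OF holomorphic_on_imp_continuous_on[OF hol]]) (use r in auto)
  then obtain B where B: "0 < B" "\<And>z. z \<in> cball 0 r \<Longrightarrow> cmod (h z) \<le> B" by (auto simp: bounded_pos)
  define g where "g z = indicator (ball 0 r) z *\<^sub>R (h z * cnj (mono_fn m z))" for z
  have [measurable]: "ball (0::complex) r \<in> sets borel" by simp
  have gm[measurable]: "g \<in> borel_measurable borel" unfolding g_def by measurable
  have gb: "cmod (g z) \<le> B" for z
    using B mono_fn_le[of m z] mult_mono[of "cmod (h z)" B "cmod (mono_fn m z)" 1]
    by (auto simp: g_def indicator_def norm_mult)
  have gi: "integrable disc_measure g"
    by (rule disc_prob.integrable_const_bound[of _ B]) (use gb in \<open>auto intro: measurable_disc_measure\<close>)
  define A where "A N z = (\<Sum>k<N. g (unity_root N ^ k * z)) / of_nat N" for N z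
  have Am[measurable]: "A N \<in> borel_measurable borel" for N unfolding A_def by measurable
  have A1: "A N z = indicator (ball 0 r) z *\<^sub>R (cnj (mono_fn m z) * root_average N m h z)" for N z
  proof -
    have "g (unity_root N ^ k * z) = indicator (ball 0 r) z *\<^sub>R (cnj (mono_fn m z) * (cnj
        (unity_root N ^ k) ^ m * h (unity_root N ^ k * z)))" for k
      by (auto simp: g_def indicator_def norm_mult norm_power mono_fn_def power_mult_distrib)
    then show ?thesis by (simp add: A_def root_average_def scaleR_sum_right sum_distrib_left
        sum_divide_distrib)
  qed
  have Ai: "integral\<^sup>L disc_measure (A N) = integral\<^sup>L disc_measure g" if "N > 0" for N
  proof -
    have "integral\<^sup>L disc_measure (A N) = (\<Sum>k<N. integral\<^sup>L disc_measure g) / of_nat N"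
      unfolding A_def using gi by (simp add: disc_integral_rotation disc_integrable_rotation norm_power)
    then show ?thesis using that by simp
  qed
  have lim: "(\<lambda>N. A N z) \<longlonglongrightarrow> (deriv ^^ m) h 0 / fact m * (indicator (ball 0 r) z *\<^sub>R of_real ((cmod z)
      ^ (2 * m)))" for z
  proof (cases "z \<in> ball 0 r")
    case True
    then have z: "z \<in> ball 0 1" using r by auto
    have "(\<lambda>N. cnj (mono_fn m z) * root_average N m h z)
        \<longlonglongrightarrow> cnj (mono_fn m z) * ((deriv ^^ m) h 0 / fact m * z ^ m)"
      by (intro tendsto_mult_left root_average_tendsto[OF hol z])
    moreover have "cnj (mono_fn m z) * z ^ m = of_real ((cmod z) ^ (2 * m))"
    proof -
      have "cnj (mono_fn m z) * z ^ m = (z * cnj z) ^ m" using z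
          by (simp add: mono_fn_def power_mult_distrib mult.commute)
      also have "\<dots> = of_real ((cmod z) ^ (2 * m))"
        by (simp only: complex_norm_square[symmetric] power_mult of_real_power)
      finally show ?thesis .
    qed
    ultimately have "(\<lambda>N. cnj (mono_fn m z) * root_average N m h z)
        \<longlonglongrightarrow> (deriv ^^ m) h 0 / fact m * of_real ((cmod z) ^ (2 * m))"
      by (metis (no_types, lifting) mult.left_commute)
    then show ?thesis using True unfolding A1 by simp
  next
    case False
    then show ?thesis unfolding A1 by simp
  qed
  have Ab: "norm (A N z) \<le> B" for N z
  proof (cases "z \<in> ball 0 r")
    case True
    have "cmod (root_average N m h z) \<le> B"
      by (rule root_average_norm_le) (use B True in auto)
    then show ?thesis using True mono_fn_le[of m z] mult_mono[of "cmod (mono_fn m z)" 1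
        "cmod (root_average N m h z)" B]
      unfolding A1 by (simp add: norm_mult)
  next
    case False
    then show ?thesis unfolding A1 using B by simp
  qed
  have "(\<lambda>N. integral\<^sup>L disc_measure (A N)) \<longlonglongrightarrow>
     (LINT z|disc_measure. (deriv ^^ m) h 0 / fact m * (indicator (ball 0 r) z *\<^sub>R of_real ((cmod z)
         ^ (2 * m))))"
    by (rule integral_dominated_convergence[where w = "\<lambda>_. B"])
      (use lim Ab in \<open>auto intro!: measurable_disc_measure\<close>)
  moreover have "(\<lambda>N. integral\<^sup>L disc_measure (A N)) \<longlonglongrightarrow> integral\<^sup>L disc_measure g"
    by (rule tendsto_eventually) (use Ai in \<open>auto simp: eventually_sequentially intro!: exI[of _ 1]\<close>)
  ultimately have "integral\<^sup>L disc_measure g = (LINT z|disc_measure. (deriv ^^ m) h 0 / fact m *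
      (indicator (ball 0 r) z *\<^sub>R of_real ((cmod z) ^ (2 * m))))"
    using LIMSEQ_unique by blast
  also have "\<dots> = (deriv ^^ m) h 0 / fact m * (LINT z|disc_measure. indicator (ball 0 r) z *\<^sub>R
      of_real ((cmod z) ^ (2 * m)))"
    by (rule integral_mult_right_zero)
  finally show ?thesis unfolding g_def .
qed

text \<open>Dominated convergence with majorant |F|. The radii are positive and below 1, as the
  formula on smaller discs demands.\<close>

lemma disc_integral_exhaust:
  fixes F :: "complex \<Rightarrow> complex"
  assumes F: "integrable disc_measure F"
  shows "(\<lambda>k. LINT z|disc_measure. indicator (ball 0 (1 - 1 / real (k + 2))) z *\<^sub>R F z)
      \<longlonglongrightarrow> integral\<^sup>L disc_measure F"
proof (rule integral_dominated_convergence[where w = "\<lambda>z. norm (F z)"])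
  have [measurable]: "F \<in> borel_measurable disc_measure" using F by auto
  show "(\<lambda>z. indicator (ball 0 (1 - 1 / real (k + 2))) z *\<^sub>R F z) \<in> borel_measurable disc_measure" for k
    by (intro borel_measurable_scaleR measurable_disc_measure borel_measurable_indicator) auto
  show "AE z in disc_measure. (\<lambda>k. indicator (ball 0 (1 - 1 / real (k + 2))) z *\<^sub>R F z) \<longlonglongrightarrow> F z"
    using AE_disc
  proof eventually_elim
    case (elim z)
    have "(\<lambda>k. 1 - 1 / real (k + 2)) \<longlonglongrightarrow> 1" by real_asymp
    moreover have "cmod z < 1" using elim by simp
    ultimately have "\<forall>\<^sub>F k in sequentially. cmod z < 1 - 1 / real (k + 2)" by (rule order_tendstoD)
    then have "\<forall>\<^sub>F k in sequentially. indicator (ball 0 (1 - 1 / real (k + 2))) z *\<^sub>R F z = F z"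
      by eventually_elim simp
    then show ?case by (rule tendsto_eventually)
  qed
  show "AE z in disc_measure. norm (indicator (ball 0 (1 - 1 / real (k + 2))) z *\<^sub>R F z) \<le> norm (F z)" for k
    by (auto simp: indicator_def)
qed (use F in auto)

text \<open>The formula on smaller discs in the limit of radius 1. The factor m + 1 is the
  reciprocal of the squared norm of z^m.\<close>

lemma bergman_coefficient:
  assumes h: "h \<in> bergman_disc"
  shows "(deriv ^^ m) h 0 / fact m = of_nat (Suc m) * dip h (mono_fn m)"
proof -
  define a where "a = (deriv ^^ m) h 0 / fact m"
  define r where "r k = 1 - 1 / real (k + 2)" for k
  have r: "0 < r k" "r k < 1" for k by (auto simp: r_def field_simps)
  have i1: "integrable disc_measure (\<lambda>z. h z * cnj (mono_fn m z))"
    by (intro L2_prod_integrable bergman_disc_L2 h mono_fn_bergman)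
  have i2: "integrable disc_measure (\<lambda>z. complex_of_real ((cmod z) ^ (2 * m)))"
  proof (rule disc_prob.integrable_const_bound[of _ 1])
    show "AE z in disc_measure. norm (complex_of_real ((cmod z) ^ (2 * m))) \<le> 1"
      using AE_disc_id by eventually_elim (auto simp: norm_power power_le_one)
    show "(\<lambda>z. complex_of_real ((cmod z) ^ (2 * m))) \<in> borel_measurable disc_measure"
        by (intro measurable_disc_measure) measurable
  qed
  have 1: "(\<lambda>k. LINT z|disc_measure. indicator (ball 0 (r k)) z *\<^sub>R (h z * cnj (mono_fn m z)))
      \<longlonglongrightarrow> dip h (mono_fn m)"
    unfolding r_def l2_inner_def by (rule disc_integral_exhaust[OF i1])
  have 2: "(\<lambda>k. a * (LINT z|disc_measure. indicator (ball 0 (r k)) z *\<^sub>R of_real ((cmod z) ^ (2 *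
      m)))) \<longlonglongrightarrow> a * (LINT z|disc_measure. complex_of_real ((cmod z) ^ (2 * m)))"
    unfolding r_def by (intro tendsto_mult_left disc_integral_exhaust[OF i2])
  have "dip h (mono_fn m) = a * (LINT z|disc_measure. complex_of_real ((cmod z) ^ (2 * m)))"
    using 1 2 LIMSEQ_unique unfolding bergman_coefficient_ball[OF h r] a_def[symmetric] by blast
  also have "\<dots> = a / of_nat (Suc m)" by (simp add: disc_integral_power del: of_real_power)
  finally show ?thesis by (simp add: a_def del: of_nat_Suc)
qed

lemma bergman_total:
  assumes h: "h \<in> bergman_disc" and z: "\<And>m. dip h (mono_fn m) = 0"
  shows "h = 0"
proof
  fix w
  show "h w = 0 w"
  proof (cases "w \<in> ball 0 1")
    case True
    have "h holomorphic_on ball 0 1" using h by (simp add: bergman_disc_def)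
    from holomorphic_power_series[OF this True] show ?thesis
      unfolding bergman_coefficient[OF h] z by (simp add: sums_iff)
  next
    case False
    then show ?thesis using h by (auto simp: bergman_disc_def)
  qed
qed

text \<open>An inner product with the unnormalized monomial, hence the Taylor coefficient divided by
  m + 1 and not an orthonormal coordinate. With this choice the adjoint shift has no
  weights.\<close>

abbreviation coef :: "(complex \<Rightarrow> complex) \<Rightarrow> nat \<Rightarrow> complex" where
  "coef f m \<equiv> dip f (mono_fn m)"

section \<open>Multiplication by z and its adjoint in coefficients\<close>

abbreviation mult_z :: "(complex \<Rightarrow> complex) \<Rightarrow> complex \<Rightarrow> complex" where
  "mult_z \<equiv> mult_op (\<lambda>z. z)"

abbreviation mult_z_adj :: "(complex \<Rightarrow> complex) \<Rightarrow> complex \<Rightarrow> complex" where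
  "mult_z_adj \<equiv> compression disc_measure bergman_disc cnj"

lemma AE_disc_cnj: "AE z in disc_measure. cmod (cnj z) \<le> 1"
  using AE_disc_id by simp

lemmas disc_id_ok = id_disc_measurable(1) AE_disc_id
lemmas disc_cnj_ok = id_disc_measurable(2) AE_disc_cnj

lemma mult_z_L2: "f \<in> L2 disc_measure \<Longrightarrow> mult_z f \<in> L2 disc_measure"
  "f \<in> L2 disc_measure \<Longrightarrow> dnorm (mult_z f) \<le> dnorm f"
  using mult_op_L2[OF _ disc_id_ok] by auto

lemma mult_cnj_L2: "f \<in> L2 disc_measure \<Longrightarrow> mult_op cnj f \<in> L2 disc_measure"
  using mult_op_L2(1)[OF _ disc_cnj_ok] by auto

lemma mult_z_bergman:
  assumes "f \<in> bergman_disc" shows "mult_z f \<in> bergman_disc"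
proof -
  have "mult_z f \<in> L2 disc_measure" by (intro mult_z_L2 bergman_disc_L2 assms)
  moreover have "mult_z f holomorphic_on ball 0 1"
    unfolding mult_op_def using assms by (intro holomorphic_intros) (simp add: bergman_disc_def)
  ultimately show ?thesis using assms by (simp add: bergman_disc_def L2_def mult_op_def)
qed

lemma mult_z_adj_bergman: "f \<in> bergman_disc \<Longrightarrow> mult_z_adj f \<in> bergman_disc"
  by (rule compression_in[OF bergman_disc_hilbert disc_cnj_ok])

lemma mult_z_adj_inner:
  assumes "f \<in> bergman_disc" "g \<in> bergman_disc"
  shows "dip (mult_z_adj f) g = dip f (mult_z g)"
    and "dip g (mult_z_adj f) = dip (mult_z g) f"
proof -
  show *: "dip (mult_z_adj f) g = dip f (mult_z g)"
    using compression_inner(1)[OF bergman_disc_hilbert disc_cnj_ok assms] mult_op_inner[of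
        disc_measure cnj f g] by simp
  show "dip g (mult_z_adj f) = dip (mult_z g) f"
    using * by (metis l2_inner_cnj)
qed

text \<open>Parseval's formula for the normalized monomials sqrt(m+1) z^m, rewritten in terms of
  \<open>coef\<close>; the two square roots combine to the weight m + 1.\<close>

lemma bergman_inner_sums:
  assumes f: "f \<in> bergman_disc" and g: "g \<in> bergman_disc"
  shows "(\<lambda>m. of_nat (Suc m) * (coef f m * cnj (coef g m))) sums dip f g"
proof -
  define u where "u m = (\<lambda>z. of_real (sqrt (Suc m)) * mono_fn m z)" for m
  have u: "u m \<in> bergman_disc" for m
    unfolding u_def by (intro cfun.subspace_scale[OF disc.HH_subspace] mono_fn_bergman)
  have cu: "dip h (u m) = of_real (sqrt (Suc m)) * coef h m" for h m
    unfolding u_def by (simp only: l2_inner_scale_right complex_cnj_complex_of_real)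
  have un: "dnorm (u m) = 1" for m
  proof -
    have "(dnorm (u m))\<^sup>2 = 1"
      unfolding u_def l2_norm_scale norm_of_real by (simp add: power_mult_distrib mono_fn_norm del:
          of_nat_Suc)
    then show ?thesis using l2_norm_nonneg[of disc_measure "u m"] by (simp add: power2_eq_1_iff)
  qed
  have uo: "dip (u j) (u k) = 0" if "j \<noteq> k" for j k
    unfolding cu using mono_fn_orthogonal[OF that] by (simp add: u_def l2_inner_scale_left)
  have "(\<lambda>m. dip f (u m) * cnj (dip g (u m))) sums dip f g"
  proof (rule Parseval[OF bergman_disc_hilbert u un uo _ f g])
    fix h assume "h \<in> bergman_disc" "\<And>k. dip h (u k) = 0"
    then show "h = 0" unfolding cu by (intro bergman_total) auto
  qed
  moreover have "dip f (u m) * cnj (dip g (u m)) = of_nat (Suc m) * (coef f m * cnj (coef g m))" for m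
  proof -
    have "complex_of_real (sqrt (Suc m)) * complex_of_real (sqrt (Suc m)) = of_nat (Suc m)"
      by (metis of_nat_0_le_iff of_real_mult of_real_of_nat_eq real_sqrt_mult_self abs_of_nonneg)
    then show ?thesis unfolding cu complex_cnj_mult complex_cnj_complex_of_real
      by (metis (no_types, lifting) mult.assoc mult.left_commute)
  qed
  ultimately show ?thesis by simp
qed

lemma sums_norm_sq:
  assumes "(\<lambda>m. of_real (w m) * (c m * cnj (c m))) sums of_real s"
  shows "(\<lambda>m. w m * (cmod (c m))\<^sup>2) sums s"
proof -
  have "(\<lambda>m. of_real (w m) * (c m * cnj (c m))) = (\<lambda>m. complex_of_real (w m * (cmod (c m))\<^sup>2))"
    by (rule ext) (metis complex_norm_square of_real_mult of_real_power)
  then show ?thesis using assms by (simp only: sums_of_real_iff)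
qed

lemma bergman_norm_sums:
  assumes f: "f \<in> bergman_disc"
  shows "(\<lambda>m. real (Suc m) * (cmod (coef f m))\<^sup>2) sums (dnorm f)\<^sup>2"
  using bergman_inner_sums[OF f f] unfolding l2_inner_self by (intro sums_norm_sq) simp

lemma coef_mono_fn: "coef (mono_fn j) m = (if j = m then 1 / of_nat (Suc m) else 0)"
  by (simp add: mono_fn_orthogonal l2_inner_self mono_fn_norm del: of_nat_Suc)

text \<open>Multiplication by z sends each monomial to the next, so its adjoint is the plain
  backward shift on \<open>coef\<close>.\<close>

lemma coef_mult_z_adj:
  assumes f: "f \<in> bergman_disc"
  shows "coef (mult_z_adj f) m = coef f (Suc m)"
proof -
  have "mult_z (mono_fn m) = mono_fn (Suc m)" by (auto simp: mult_op_def mono_fn_def fun_eq_iff)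
  then show ?thesis by (simp add: mult_z_adj_inner[OF f mono_fn_bergman])
qed

text \<open>The adjoint applied to z^m has a single nonzero coefficient, at m - 1, which collapses
  the inner product series. For m = 0 the factor m cancels the meaningless index.\<close>

lemma coef_mult_z:
  assumes f: "f \<in> bergman_disc"
  shows "coef (mult_z f) m = of_nat m / of_nat (Suc m) * coef f (m - 1)"
proof -
  have "(\<lambda>j. of_nat (Suc j) * (coef f j * cnj (coef (mult_z_adj (mono_fn m)) j))) sums coef (mult_z f) m"
    using bergman_inner_sums[OF f mult_z_adj_bergman[OF mono_fn_bergman], of m]
    by (simp only: mult_z_adj_inner(2)[OF mono_fn_bergman f])
  moreover have "(\<lambda>j. of_nat (Suc j) * (coef f j * cnj (coef (mult_z_adj (mono_fn m)) j)))
     = (\<lambda>j. if j = m - 1 then of_nat m / of_nat (Suc m) * coef f (m - 1) else 0)"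
    by (cases m) (auto simp: fun_eq_iff coef_mult_z_adj[OF mono_fn_bergman] coef_mono_fn simp del: of_nat_Suc)
  ultimately show ?thesis using sums_unique2 sums_single[of "m - 1"
      "\<lambda>j. of_nat m / of_nat (Suc m) * coef f (m - 1)"]
    by (auto simp: sums_iff)
qed

lemma mult_z_adj_inner_sums:
  assumes f: "f \<in> bergman_disc" and g: "g \<in> bergman_disc"
  shows "(\<lambda>m. of_nat m * (coef f m * cnj (coef g m))) sums dip (mult_z_adj f) (mult_z_adj g)"
proof -
  have "(\<lambda>m. of_nat (Suc m) * (coef f (Suc m) * cnj (coef g (Suc m)))) sums dip (mult_z_adj f) (mult_z_adj g)"
    using bergman_inner_sums[OF mult_z_adj_bergman[OF f] mult_z_adj_bergman[OF g]]
    by (simp only: coef_mult_z_adj[OF f] coef_mult_z_adj[OF g])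
  from sums_Suc[OF this] show ?thesis by simp
qed

text \<open>The weight is m + 2, belonging to the shifted index, times the square of the shift
  factor (m+1)/(m+2). The term of index 0 vanishes and the series is reindexed.\<close>

lemma mult_z_inner_sums:
  assumes f: "f \<in> bergman_disc" and g: "g \<in> bergman_disc"
  shows "(\<lambda>m. of_real ((real (Suc m))\<^sup>2 / real (Suc (Suc m))) * (coef f m * cnj (coef g m)))
      sums dip (mult_z f) (mult_z g)"
proof -
  let ?F = "\<lambda>m. of_nat (Suc m) * (coef (mult_z f) m * cnj (coef (mult_z g) m))"
  have F: "?F sums dip (mult_z f) (mult_z g)"
    by (intro bergman_inner_sums mult_z_bergman f g)
  have "?F 0 = 0" by (simp add: coef_mult_z[OF f])
  then have "?F sums (dip (mult_z f) (mult_z g) + ?F 0)" using F by (simp only: add_0_right)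
  then have "(\<lambda>m. ?F (Suc m)) sums dip (mult_z f) (mult_z g)"
    using sums_Suc_iff[of ?F "dip (mult_z f) (mult_z g)"] by (rule iffD2[rotated])
  moreover have "?F (Suc m) = of_real ((real (Suc m))\<^sup>2 / real (Suc (Suc m))) * (coef f m * cnj
      (coef g m))" for m
  proof -
    define a b :: complex where "a = of_nat (Suc m)" and "b = of_nat (Suc (Suc m))"
    have b0: "b \<noteq> 0" unfolding b_def by (simp only: of_nat_eq_0_iff)
    have "?F (Suc m) = b * ((a / b * coef f m) * cnj (a / b * coef g m))"
      unfolding coef_mult_z[OF f] coef_mult_z[OF g] a_def b_def by simp
    also have "cnj (a / b * coef g m) = a / b * cnj (coef g m)" by (simp add: a_def b_def)
    also have "b * ((a / b * coef f m) * (a / b * cnj (coef g m))) = a\<^sup>2 / b * (coef f m * cnj (coef g m))"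
      using b0 by (simp add: field_simps power2_eq_square)
    also have "a\<^sup>2 / b = of_real ((real (Suc m))\<^sup>2 / real (Suc (Suc m)))" by (simp add: a_def b_def)
    finally show ?thesis .
  qed
  ultimately show ?thesis by simp
qed

text \<open>The weights of z f and f have ratio (m+1)/(m+2), at least 1/2. It makes z
  \<open>S\<close> closed.\<close>

lemma mult_z_bounded_below:
  assumes f: "f \<in> bergman_disc"
  shows "dnorm f \<le> 2 * dnorm (mult_z f)"
proof (rule power2_le_imp_le)
  have "(\<lambda>m. (real (Suc m))\<^sup>2 / real (Suc (Suc m)) * (cmod (coef f m))\<^sup>2) sums (dnorm (mult_z f))\<^sup>2"
    using mult_z_inner_sums[OF f f] unfolding l2_inner_self by (rule sums_norm_sq)
  then have "(\<lambda>m. 4 * ((real (Suc m))\<^sup>2 / real (Suc (Suc m)) * (cmod (coef f m))\<^sup>2))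
      sums (4 * (dnorm (mult_z f))\<^sup>2)"
    by (rule sums_mult)
  from sums_le[OF _ bergman_norm_sums[OF f] this]
  have "(dnorm f)\<^sup>2 \<le> 4 * (dnorm (mult_z f))\<^sup>2"
  proof -
    have "real (Suc m) * (cmod (coef f m))\<^sup>2 \<le> 4 * ((real (Suc m))\<^sup>2 / real (Suc (Suc m)) * (cmod
        (coef f m))\<^sup>2)" for m
    proof -
      have "real (Suc m) \<le> 4 * ((real (Suc m))\<^sup>2 / real (Suc (Suc m)))"
        by (simp add: field_simps power2_eq_square)
      from mult_right_mono[OF this, of "(cmod (coef f m))\<^sup>2"] show ?thesis by simp
    qed
    then show ?thesis using sums_le[OF _ bergman_norm_sums[OF f] \<open>_ sums (4 * _)\<close>] by blast
  qed
  then show "(dnorm f)\<^sup>2 \<le> (2 * dnorm (mult_z f))\<^sup>2" by (simp add: power_mult_distrib)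
qed simp

lemma coef_le: 
  assumes "f \<in> bergman_disc" shows "cmod (coef f m) \<le> dnorm f"
proof -
  have "(dnorm (mono_fn m))\<^sup>2 \<le> 1" by (simp add: mono_fn_norm field_simps)
  then have "dnorm (mono_fn m) \<le> 1" by (metis abs_square_le_1 abs_of_nonneg l2_norm_nonneg)
  then have "dnorm f * dnorm (mono_fn m) \<le> dnorm f * 1"
    by (intro mult_left_mono) auto
  then show ?thesis
    using l2_Cauchy_Schwarz[OF bergman_disc_L2[OF assms] bergman_disc_L2[OF mono_fn_bergman], of m] by simp
qed

text \<open>A sesquilinear form with bounded weights is small up to finitely many coefficients, because
  the inner product carries the weight \<open>m + 1\<close>.\<close>

lemma weighted_form_bound:
  assumes q: "q \<in> bergman_disc" and x: "x \<in> bergman_disc"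
    and w: "\<And>m. \<bar>w m\<bar> \<le> 1"
    and F: "(\<lambda>m. of_real (w m) * (coef q m * cnj (coef x m))) sums F"
  shows "cmod F \<le> (dnorm q / real (Suc N) + (\<Sum>m<N. cmod (coef q m))) * dnorm x"
proof -
  define a b where "a = dnorm q" and "b = dnorm x"
  have b0: "0 \<le> b" by (simp add: b_def)
  \<comment> \<open>These are the absolute values of the terms of the inner product; by
    Cauchy-Schwarz their partial sums are at most the product of the norms.\<close>
  define g where "g m = real (Suc m) * (cmod (coef q m) * cmod (coef x m))" for m
  have gs: "(\<Sum>m<n. g m) \<le> a * b" for n
  proof -
    have L: "L2_set (\<lambda>m. sqrt (Suc m) * cmod (coef h m)) {..<n} \<le> dnorm h" if h: "h \<in> bergman_disc" for h
    proof -
      have "(\<Sum>m<n. (sqrt (Suc m) * cmod (coef h m))\<^sup>2) = (\<Sum>m<n. real (Suc m) * (cmod (coef h m))\<^sup>2)"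
        by (simp add: power_mult_distrib)
      also have "\<dots> \<le> (\<Sum>m. real (Suc m) * (cmod (coef h m))\<^sup>2)"
        using bergman_norm_sums[OF h] by (intro sum_le_suminf) (auto simp: sums_iff)
      also have "\<dots> = (dnorm h)\<^sup>2" using bergman_norm_sums[OF h] by (simp add: sums_iff)
      finally show ?thesis unfolding L2_set_def by (intro real_le_lsqrt) (auto intro: sum_nonneg)
    qed
    have "g m = \<bar>sqrt (Suc m) * cmod (coef q m)\<bar> * \<bar>sqrt (Suc m) * cmod (coef x m)\<bar>" for m
      by (simp add: g_def abs_mult)
    then have "(\<Sum>m<n. g m) \<le> L2_set (\<lambda>m. sqrt (Suc m) * cmod (coef q m)) {..<n} * L2_set (\<lambda>m. sqrt
        (Suc m) * cmod (coef x m)) {..<n}"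
      using L2_set_mult_ineq[of "\<lambda>m. sqrt (Suc m) * cmod (coef q m)"
          "\<lambda>m. sqrt (Suc m) * cmod (coef x m)" "{..<n}"] by simp
    also have "\<dots> \<le> a * b" unfolding a_def b_def by (intro mult_mono L q x) auto
    finally show ?thesis .
  qed
  have "cmod (\<Sum>m<n. of_real (w m) * (coef q m * cnj (coef x m))) \<le> (a / real (Suc N)
      + (\<Sum>m<N. cmod (coef q m))) * b" for n
  proof -
    \<comment> \<open>Below N a coefficient of x is bounded by its norm; from N on the weight m + 1
      is at least N + 1, so the unweighted term is at most g m / (N + 1).\<close>
    have t: "cmod (of_real (w m) * (coef q m * cnj (coef x m))) \<le> (if m
        < N then cmod (coef q m) * b else 0) + g m / real (Suc N)" for m
    proof -
      have "cmod (of_real (w m) * (coef q m * cnj (coef x m))) = \<bar>w m\<bar> * (cmod (coef q m) * cmod (coef x m))"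
        by (simp add: norm_mult)
      also have "\<dots> \<le> 1 * (cmod (coef q m) * cmod (coef x m))" using w by (intro mult_right_mono) auto
      also have "\<dots> \<le> (if m < N then cmod (coef q m) * b else 0) + g m / real (Suc N)"
      proof (cases "m < N")
        case True
        have "cmod (coef q m) * cmod (coef x m) \<le> cmod (coef q m) * b" using coef_le[OF x]
            by (intro mult_left_mono) (auto simp: b_def)
        then show ?thesis using True by (simp add: g_def add_increasing2)
      next
        case False
        then have "real (Suc N) * (cmod (coef q m) * cmod (coef x m)) \<le> g m" unfolding g_def
            by (intro mult_right_mono) auto
        then show ?thesis using False by (simp add: field_simps)
      qed
      finally show ?thesis .
    qed
    have "cmod (\<Sum>m<n. of_real (w m) * (coef q m * cnj (coef x m))) \<le> (\<Sum>m<n. (if m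
        < N then cmod (coef q m) * b else 0) + g m / real (Suc N))"
      by (intro sum_norm_le t)
    also have "\<dots> = (\<Sum>m<n. if m < N then cmod (coef q m) * b else 0) + (\<Sum>m<n. g m) / real (Suc N)"
      by (simp add: sum.distrib sum_divide_distrib)
    also have "(\<Sum>m<n. if m < N then cmod (coef q m) * b else 0) \<le> (\<Sum>m<N. cmod (coef q m) * b)"
    proof -
      have "(\<Sum>m<n. if m < N then cmod (coef q m) * b else 0) = (\<Sum>m\<in>{..<n} \<inter> {..<N}. cmod (coef q m) * b)"
        by (simp add: sum.inter_restrict)
      also have "\<dots> \<le> (\<Sum>m<N. cmod (coef q m) * b)" using b0 by (intro sum_mono2) auto
      finally show ?thesis .
    qed
    also have "(\<Sum>m<n. g m) / real (Suc N) \<le> a * b / real (Suc N)" using gs by (intro divide_right_mono) auto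
    finally show ?thesis by (simp add: sum_distrib_right distrib_right)
  qed
  moreover have "(\<lambda>n. cmod (\<Sum>m<n. of_real (w m) * (coef q m * cnj (coef x m)))) \<longlonglongrightarrow> cmod F"
    using F unfolding sums_def by (rule tendsto_norm)
  ultimately show ?thesis unfolding a_def b_def by (intro LIMSEQ_le_const2) auto
qed

text \<open>The weight of the difference is (m+1) - (m+1)^2/(m+2) = (m+1)/(m+2), at most 1.\<close>

lemma mult_z_inner_near_isometric:
  assumes q: "q \<in> bergman_disc" and x: "x \<in> bergman_disc"
  shows "cmod (dip q x - dip (mult_z q) (mult_z x))
     \<le> (dnorm q / real (Suc N) + (\<Sum>m<N. cmod (coef q m))) * dnorm x"
proof (rule weighted_form_bound[OF q x, where w = "\<lambda>m. real (Suc m) / real (Suc (Suc m))"])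
  have "(\<lambda>m. of_nat (Suc m) * (coef q m * cnj (coef x m)) - of_real ((real (Suc m))\<^sup>2 / real (Suc
      (Suc m))) * (coef q m * cnj (coef x m)))
     sums (dip q x - dip (mult_z q) (mult_z x))"
    by (intro sums_diff bergman_inner_sums mult_z_inner_sums q x)
  moreover have "of_nat (Suc m) * c - of_real ((real (Suc m))\<^sup>2 / real (Suc (Suc m))) * c
      = of_real (real (Suc m) / real (Suc (Suc m))) * c" for m and c :: complex
  proof -
    have "real (Suc m) - (real (Suc m))\<^sup>2 / real (Suc (Suc m)) = real (Suc m) / real (Suc (Suc m))"
      by (simp add: field_simps power2_eq_square)
    then have "of_nat (Suc m) - complex_of_real ((real (Suc m))\<^sup>2 / real (Suc (Suc m)))
        = of_real (real (Suc m) / real (Suc (Suc m)))"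
      by (metis of_real_diff of_real_of_nat_eq)
    then show ?thesis by (metis left_diff_distrib)
  qed
  ultimately show "(\<lambda>m. of_real (real (Suc m) / real (Suc (Suc m))) * (coef q m * cnj (coef x m)))
      sums (dip q x - dip (mult_z q) (mult_z x))"
    by simp
  show "\<bar>real (Suc m) / real (Suc (Suc m))\<bar> \<le> 1" for m by simp
qed

text \<open>This is the form of the self-commutator of the Bergman shift; its weight is
  (m+1)^2/(m+2) - m = 1/(m+2).\<close>

lemma mult_z_inner_near_adj:
  assumes q: "q \<in> bergman_disc" and x: "x \<in> bergman_disc"
  shows "cmod (dip (mult_z q) (mult_z x) - dip (mult_z_adj q) (mult_z_adj x))
     \<le> (dnorm q / real (Suc N) + (\<Sum>m<N. cmod (coef q m))) * dnorm x"
proof (rule weighted_form_bound[OF q x, where w = "\<lambda>m. 1 / real (Suc (Suc m))"])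
  have "(\<lambda>m. of_real ((real (Suc m))\<^sup>2 / real (Suc (Suc m))) * (coef q m * cnj (coef x m)) - of_nat
      m * (coef q m * cnj (coef x m)))
     sums (dip (mult_z q) (mult_z x) - dip (mult_z_adj q) (mult_z_adj x))"
    by (intro sums_diff mult_z_inner_sums mult_z_adj_inner_sums q x)
  moreover have "of_real ((real (Suc m))\<^sup>2 / real (Suc (Suc m))) * c - of_nat m * c
      = of_real (1 / real (Suc (Suc m))) * c" for m and c :: complex
  proof -
    have "(real (Suc m))\<^sup>2 / real (Suc (Suc m)) - real m = 1 / real (Suc (Suc m))"
      by (simp add: field_simps power2_eq_square)
    then have "complex_of_real ((real (Suc m))\<^sup>2 / real (Suc (Suc m))) - of_nat m
        = of_real (1 / real (Suc (Suc m)))"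
      by (metis of_real_diff of_real_of_nat_eq)
    then show ?thesis by (metis left_diff_distrib)
  qed
  ultimately show "(\<lambda>m. of_real (1 / real (Suc (Suc m))) * (coef q m * cnj (coef x m)))
      sums (dip (mult_z q) (mult_z x) - dip (mult_z_adj q) (mult_z_adj x))"
    by simp
  show "\<bar>1 / real (Suc (Suc m))\<bar> \<le> 1" for m by simp
qed

subsection \<open>Quotient modules of the disc\<close>

abbreviation self_commutator :: "'a measure \<Rightarrow> ('a \<Rightarrow> complex) set \<Rightarrow> ('a \<Rightarrow> complex) \<Rightarrow> ('a \<Rightarrow> complex) \<Rightarrow>
    'a \<Rightarrow> complex" where
  "self_commutator M Q \<phi> \<equiv> commutator (compression M Q \<phi>) (compression M Q (\<lambda>x. cnj (\<phi> x)))"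

locale disc_quotient =
  fixes Q S
  assumes quot: "disc_quotient_module Q"
    and S_eq: "S = ominus disc_measure bergman_disc Q"
begin

abbreviation Cz :: "(complex \<Rightarrow> complex) \<Rightarrow> complex \<Rightarrow> complex" where "Cz \<equiv> compression disc_measure Q (\<lambda>z. z)"
abbreviation Cz_adj :: "(complex \<Rightarrow> complex) \<Rightarrow> complex \<Rightarrow> complex" where
    "Cz_adj \<equiv> compression disc_measure Q cnj"
abbreviation T :: "(complex \<Rightarrow> complex) \<Rightarrow> complex \<Rightarrow> complex" where "T \<equiv> self_commutator disc_measure Q (\<lambda>z. z)"

lemma Q_hilbert: "l2_hilbert disc_measure Q"
  using quot l2_hilbert_closed_subspace[OF bergman_disc_hilbert]
  by (simp add: disc_quotient_module_def quotient_module_def)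

lemma Q_bergman: "q \<in> Q \<Longrightarrow> q \<in> bergman_disc"
  using quot by (auto simp: disc_quotient_module_def quotient_module_def closed_subspace_def)

lemma S_hilbert: "l2_hilbert disc_measure S"
  unfolding S_eq by (rule l2_hilbert_ominus[OF bergman_disc_hilbert]) (use Q_bergman bergman_disc_L2 in blast)

lemma S_bergman: "s \<in> S \<Longrightarrow> s \<in> bergman_disc"
  by (simp add: S_eq ominus_def)

lemma S_Q_orthogonal: "s \<in> S \<Longrightarrow> q \<in> Q \<Longrightarrow> dip s q = 0" "s \<in> S \<Longrightarrow> q \<in> Q \<Longrightarrow> dip q s = 0"
  using l2_inner_commute_zero by (auto simp: S_eq ominus_def)

lemma mult_z_S: "s \<in> S \<Longrightarrow> mult_z s \<in> S"
  using quot unfolding disc_quotient_module_def quotient_module_def S_eq by auto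

lemma Q_if_orthogonal: "h \<in> bergman_disc \<Longrightarrow> (\<And>s. s \<in> S \<Longrightarrow> dip h s = 0) \<Longrightarrow> h \<in> Q"
  unfolding S_eq by (rule ominus_ominus[OF bergman_disc_hilbert Q_hilbert]) (use Q_bergman in blast)+

lemma Q_L2: "q \<in> Q \<Longrightarrow> q \<in> L2 disc_measure" and S_L2: "s \<in> S \<Longrightarrow> s \<in> L2 disc_measure"
  using Q_bergman S_bergman bergman_disc_L2 by auto

lemma Cz_in: "q \<in> Q \<Longrightarrow> Cz q \<in> Q" and Cz_adj_in: "q \<in> Q \<Longrightarrow> Cz_adj q \<in> Q"
  using compression_in[OF Q_hilbert disc_id_ok] compression_in[OF Q_hilbert disc_cnj_ok] by auto

text \<open>Dual to the invariance of \<open>S\<close> under multiplication by z.\<close>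

lemma mult_z_adj_Q:
  assumes q: "q \<in> Q" shows "mult_z_adj q \<in> Q"
proof (rule Q_if_orthogonal)
  show "mult_z_adj q \<in> bergman_disc" by (intro mult_z_adj_bergman Q_bergman q)
  fix s assume s: "s \<in> S"
  show "dip (mult_z_adj q) s = 0"
    using S_Q_orthogonal(2)[OF mult_z_S[OF s] q] by (simp add: mult_z_adj_inner Q_bergman[OF q]
        S_bergman[OF s])
qed

text \<open>As \<open>Q\<close> is invariant under the adjoint shift, nothing is lost in projecting.
  Only \<open>Cz\<close> involves a genuine projection; \<open>Cz_adj\<close> shifts
  coefficients.\<close>

lemma Cz_adj_eq:
  assumes q: "q \<in> Q" shows "Cz_adj q = mult_z_adj q"
  unfolding compression_def[of disc_measure Q]
proof (rule proj_unique[OF Q_hilbert _ mult_z_adj_Q[OF q]])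
  show L: "mult_op cnj q \<in> L2 disc_measure" by (intro mult_cnj_L2 Q_L2 q)
  fix g assume g: "g \<in> Q"
  show "dip (mult_op cnj q - mult_z_adj q) g = 0"
    using L compression_inner(1)[OF bergman_disc_hilbert disc_cnj_ok Q_bergman[OF q] Q_bergman[OF g]]
    by (subst l2_inner_diff_left) (auto simp: Q_L2 g mult_z_adj_Q[OF q])
qed

lemma Cz_inner: "q \<in> Q \<Longrightarrow> x \<in> Q \<Longrightarrow> dip (Cz q) x = dip q (Cz_adj x)"
  using compression_adjoint[OF Q_hilbert disc_id_ok] by simp

lemma Cz_adj_inner: "q \<in> Q \<Longrightarrow> x \<in> Q \<Longrightarrow> dip (Cz_adj q) x = dip q (Cz x)"
  by (metis Cz_inner l2_inner_cnj)

lemma T_eq: "T f = Cz (Cz_adj f) - Cz_adj (Cz f)"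
  by (simp add: commutator_def)

lemma T_in: "q \<in> Q \<Longrightarrow> T q \<in> Q"
  unfolding T_eq using l2_hilbert_subspace[OF Q_hilbert] by (intro cfun.subspace_diff Cz_in Cz_adj_in) auto

lemma T_inner:
  assumes q: "q \<in> Q" and x: "x \<in> Q"
  shows "dip (T q) x = dip (Cz_adj q) (Cz_adj x) - dip (Cz q) (Cz x)"
    and "dip (T q) x = dip q (T x)"
proof -
  have *: "dip (T q) x = dip (Cz_adj q) (Cz_adj x) - dip (Cz q) (Cz x)"
    if "q \<in> Q" "x \<in> Q" for q x unfolding T_eq using that
    by (subst l2_inner_diff_left) (auto simp: Q_L2 Cz_in Cz_adj_in Cz_inner Cz_adj_inner)
  show "dip (T q) x = dip (Cz_adj q) (Cz_adj x) - dip (Cz q) (Cz x)"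
    by (rule *[OF q x])
  have "dip q (T x) = cnj (dip (T x) q)" by (simp add: l2_inner_cnj)
  then show "dip (T q) x = dip q (T x)"
    unfolding *[OF q x] *[OF x q] by (simp add: l2_inner_cnj)
qed

text \<open>In terms of coefficients \<open>1 - 2 M\<^sub>z M\<^sub>z\<^sup>* + M\<^sub>z\<^sup>2 M\<^sub>z\<^sup>*\<^sup>2\<close> is the projection onto the
  constants. If \<open>C\<^sub>z\<close> is normal, it compresses to \<open>(1 - C\<^sub>z C\<^sub>z\<^sup>*)\<^sup>2\<close>, so \<open>C\<^sub>z\<^sup>*\<close> is isometric on
  the elements vanishing at 0; but \<open>M\<^sub>z\<^sup>*\<close> strictly decreases norms.\<close>

lemma normal_eq0:
  assumes N: "\<And>v. v \<in> Q \<Longrightarrow> T v = 0" and f: "f \<in> Q" and f0: "coef f 0 = 0"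
  shows "f = 0"
proof -
  define B where "B = mult_z_adj"
  have fH: "f \<in> bergman_disc" using Q_bergman f .
  have BQ: "B q \<in> Q" if "q \<in> Q" for q unfolding B_def by (rule mult_z_adj_Q[OF that])
  have BH: "B f \<in> bergman_disc" "B (B f) \<in> bergman_disc" using Q_bergman BQ f by blast+
  \<comment> \<open>The form in which normality is used: \<open>Cz\<close> commutes with the
    restricted backward shift B.\<close>
  have CB: "Cz (B q) = B (Cz q)" if "q \<in> Q" for q
    using N[OF that] unfolding T_eq B_def by (simp add: Cz_adj_eq that Cz_in)
  have adj: "dip (B q) x = dip q (Cz x)" if "q \<in> Q" "x \<in> Q" for q x
    using Cz_adj_inner[OF that] by (simp add: B_def Cz_adj_eq that)
  let ?n = "\<lambda>g. (dnorm g)\<^sup>2"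
  \<comment> \<open>g is \<open>Cz\<close> applied to \<open>Cz_adj\<close> f; the aim is f = g, by
    showing that the squared norm of f - g is the alternating sum of norms formed below.\<close>
  define g where "g = Cz (B f)"
  have gQ: "g \<in> Q" unfolding g_def by (intro Cz_in BQ f)
  have n1: "dip f g = of_real (?n (B f))"
    using adj[OF f BQ[OF f]] by (simp add: g_def l2_inner_self)
  \<comment> \<open>Moving B across the inner product and past \<open>Cz\<close> turns the norm of
    B(B f) into the norm of g.\<close>
  have "dip (B (B f)) (B (B f)) = dip (B f) (Cz (B (B f)))"
    by (rule adj[OF BQ[OF f] BQ[OF BQ[OF f]]])
  also have "Cz (B (B f)) = B g" unfolding g_def using CB[OF BQ[OF f]] .
  also have "dip (B f) (B g) = dip f (Cz (B g))" by (rule adj[OF f BQ[OF gQ]])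
  also have "Cz (B g) = B (Cz g)" by (rule CB[OF gQ])
  also have "dip f (B (Cz g)) = dip (Cz f) (Cz g)"
    using Cz_inner[OF f Cz_in[OF gQ]] by (simp add: B_def Cz_adj_eq Cz_in gQ)
  also have "\<dots> = dip (B (Cz f)) g" by (rule adj[OF Cz_in[OF f] gQ, symmetric])
  also have "B (Cz f) = g" unfolding g_def using CB[OF f] by simp
  finally have n2: "?n (B (B f)) = ?n g" unfolding l2_inner_self of_real_eq_iff .
  have s0: "(\<lambda>m. real (Suc m) * (cmod (coef f m))\<^sup>2) sums ?n f" by (rule bergman_norm_sums[OF fH])
  have s1: "(\<lambda>m. real m * (cmod (coef f m))\<^sup>2) sums ?n (B f)"
    using mult_z_adj_inner_sums[OF fH fH] unfolding l2_inner_self B_def by (intro sums_norm_sq) simp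
  have s2: "(\<lambda>m. real (m - 1) * (cmod (coef f m))\<^sup>2) sums ?n (B (B f))"
  proof -
    have "(\<lambda>m. real m * (cmod (coef (B f) m))\<^sup>2) sums ?n (B (B f))"
      using mult_z_adj_inner_sums[OF BH(1) BH(1)] unfolding l2_inner_self B_def by (intro sums_norm_sq) simp
    then have "(\<lambda>m. real (Suc m - 1) * (cmod (coef f (Suc m)))\<^sup>2) sums ?n (B (B f))"
      unfolding B_def by (simp add: coef_mult_z_adj[OF fH])
    from sums_Suc[OF this] show ?thesis by simp
  qed
  \<comment> \<open>The weights (m+1) - 2m + (m-1) cancel for m > 0. At m = 0 truncated subtraction
    leaves the weight 1, and there the coefficient vanishes by assumption.\<close>
  have "(\<lambda>m. real (Suc m) * (cmod (coef f m))\<^sup>2 - 2 * (real m * (cmod (coef f m))\<^sup>2)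
      + real (m - 1) * (cmod (coef f m))\<^sup>2) sums (?n f - 2 * ?n (B f) + ?n (B (B f)))"
    by (intro sums_add sums_diff sums_mult s0 s1 s2)
  moreover have "real (Suc m) * (cmod (coef f m))\<^sup>2 - 2 * (real m * (cmod (coef f m))\<^sup>2)
      + real (m - 1) * (cmod (coef f m))\<^sup>2 = 0" for m
    using f0 by (cases m) (auto simp: algebra_simps)
  ultimately have "(\<lambda>m. 0) sums (?n f - 2 * ?n (B f) + ?n (B (B f)))" by simp
  then have z: "?n f - 2 * ?n (B f) + ?n (B (B f)) = 0" using sums_0 sums_unique2 by blast
  have "?n (f - g) = ?n f - 2 * ?n (B f) + ?n g"
    using l2_norm_diff_sq[OF Q_L2[OF f] Q_L2[OF gQ]] by (simp add: n1)
  then have "dnorm (f - g) = 0" using z n2 by simp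
  then have "f - g = 0"
    using l2_hilbert_eq0[OF Q_hilbert] cfun.subspace_diff[OF l2_hilbert_subspace[OF Q_hilbert] f gQ] by blast
  then have "f = g" by simp
  \<comment> \<open>With f = g the backward shift preserves the norm of f, although it lowers the
    weight m + 1 to m; all coefficients must vanish.\<close>
  then have "?n f = ?n (B f)" 
    using n1 by (simp add: \<open>f = g\<close>[symmetric] l2_inner_self flip: of_real_power)
  then have "(\<lambda>m. real (Suc m) * (cmod (coef f m))\<^sup>2 - real m * (cmod (coef f m))\<^sup>2) sums 0"
    using sums_diff[OF s0 s1] by simp
  then have "(\<lambda>m. (cmod (coef f m))\<^sup>2) sums 0" by (simp add: algebra_simps)
  then have "(cmod (coef f m))\<^sup>2 = 0" for m
    by (subst (asm) sums_iff) (auto dest: suminf_eq_zero_iff[THEN iffD1, rotated 2])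
  then show "f = 0" by (intro bergman_total[OF fH]) simp
qed

text \<open>Taking the coefficient at 0 is an injective linear functional on \<open>Q\<close>, so
  any nonzero element spans.\<close>

theorem normal_imp_dim_1:
  assumes N: "\<And>v. v \<in> Q \<Longrightarrow> T v = 0" and "Q \<noteq> {0}"
  shows "cfun.dim Q = 1"
proof -
  have sub: "cfun.subspace Q" by (rule l2_hilbert_subspace[OF Q_hilbert])
  obtain e where e: "e \<in> Q" "e \<noteq> 0" using assms(2) cfun.subspace_0[OF sub] by blast
  have e0: "coef e 0 \<noteq> 0" using normal_eq0[OF N e(1)] e(2) by blast
  have "Q \<subseteq> cfun.span {e}"
  proof
    fix f assume f: "f \<in> Q"
    define c where "c = coef f 0 / coef e 0"
    have d: "f - (\<lambda>x. c * e x) \<in> Q" using f e by (intro cfun.subspace_diff cfun.subspace_scale sub)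
    have "coef (f - (\<lambda>x. c * e x)) 0 = 0"
    proof -
      have "coef (f - (\<lambda>x. c * e x)) 0 = coef f 0 - coef (\<lambda>x. c * e x) 0"
        by (intro l2_inner_diff_left L2_scale Q_L2 f e bergman_disc_L2 mono_fn_bergman)
      also have "coef (\<lambda>x. c * e x) 0 = coef f 0" using e0
          by (simp only: l2_inner_scale_left) (simp add: c_def)
      finally show ?thesis unfolding diff_self .
    qed
    then have "f - (\<lambda>x. c * e x) = 0" using normal_eq0[OF N d] by blast
    then have "f = (\<lambda>x. c * e x)" by simp
    then show "f \<in> cfun.span {e}" using cfun.span_scale[OF cfun.span_base[of e "{e}"], of c] by simp
  qed
  moreover have "cfun.independent {e}" using e(2) by simp
  ultimately show ?thesis using cfun.dim_unique[of "{e}" Q 1] e(1) by simp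
qed

section \<open>The corner of multiplication by z from the quotient module to its complement\<close>

definition Az :: "(complex \<Rightarrow> complex) \<Rightarrow> complex \<Rightarrow> complex" where "Az q = mult_z q - Cz q"

lemma Az_S: assumes q: "q \<in> Q" shows "Az q \<in> S"
proof -
  have "Az q \<in> bergman_disc"
    unfolding Az_def by (intro cfun.subspace_diff disc.HH_subspace mult_z_bergman Q_bergman Cz_in q)
  moreover have "dip (Az q) g = 0" if "g \<in> Q" for g
    unfolding Az_def compression_def by (rule proj_orth[OF Q_hilbert mult_z_L2(1)[OF Q_L2[OF q]] that])
  ultimately show ?thesis by (simp add: S_eq ominus_def)
qed

lemma mult_z_inner_S:
  assumes q: "q \<in> Q" and s: "s \<in> S"
  shows "dip (mult_z q) s = dip (Az q) s"
  using S_Q_orthogonal(2)[OF s Cz_in[OF q]] q s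
  unfolding Az_def by (subst l2_inner_diff_left) (auto simp: Q_L2 S_L2 mult_z_L2 Cz_in)

lemma mult_z_inner_split:
  assumes q: "q \<in> Q" and x: "x \<in> Q"
  shows "dip (mult_z q) (mult_z x) = dip (Cz q) (Cz x) + dip (Az q) (Az x)"
proof -
  have L: "Cz y \<in> L2 disc_measure" "Az y \<in> L2 disc_measure" if "y \<in> Q" for y
    using that Q_L2 S_L2 Cz_in Az_S by blast+
  have "mult_z y = Cz y + Az y" for y by (simp add: Az_def fun_eq_iff)
  then show ?thesis
    using L[OF q] L[OF x] S_Q_orthogonal[OF Az_S[OF q] Cz_in[OF x]] S_Q_orthogonal[OF Az_S[OF x] Cz_in[OF q]]
    by (simp add: l2_inner_add_left l2_inner_add_right L2_add)
qed

text \<open>Orthogonality of the two parts of z q replaces the form of \<open>Cz\<close> by that of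
  multiplication by z minus that of \<open>Az\<close>. The bracket is the form already known to be
  small up to finitely many coefficients.\<close>

lemma T_inner_Az:
  assumes q: "q \<in> Q" and x: "x \<in> Q"
  shows "dip (T q) x = dip (Az q) (Az x)
     - (dip (mult_z q) (mult_z x) - dip (mult_z_adj q) (mult_z_adj x))"
  unfolding T_inner(1)[OF q x] mult_z_inner_split[OF q x] Cz_adj_eq[OF q] Cz_adj_eq[OF x] by simp

lemma Az_norm_le: "q \<in> Q \<Longrightarrow> dnorm (Az q) \<le> dnorm q"
proof (rule power2_le_imp_le)
  assume q: "q \<in> Q"
  have "complex_of_real ((dnorm (mult_z q))\<^sup>2) = of_real ((dnorm (Cz q))\<^sup>2 + (dnorm (Az q))\<^sup>2)"
    using mult_z_inner_split[OF q q] by (simp add: l2_inner_self)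
  then have "(dnorm (Az q))\<^sup>2 \<le> (dnorm (mult_z q))\<^sup>2"
    unfolding of_real_eq_iff by simp
  also have "\<dots> \<le> (dnorm q)\<^sup>2" by (intro power_mono mult_z_L2 Q_L2 q) simp
  finally show "(dnorm (Az q))\<^sup>2 \<le> (dnorm q)\<^sup>2" .
qed simp

definition E :: "(complex \<Rightarrow> complex) set" where "E = ominus disc_measure S (mult_z ` S)"

lemma E_hilbert: "l2_hilbert disc_measure E"
  unfolding E_def by (rule l2_hilbert_ominus[OF S_hilbert]) (use mult_z_S S_L2 in blast)

lemma E_S: "e \<in> E \<Longrightarrow> e \<in> S" by (simp add: E_def ominus_def)

text \<open>The inner product of the adjoint shift of e with s is that of e with z s, which is 0. So
  the adjoint of \<open>Az\<close> acts on \<open>E\<close> as the plain backward shift.\<close>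

lemma E_adj_Q: 
  assumes e: "e \<in> E" shows "mult_z_adj e \<in> Q"
proof (rule Q_if_orthogonal)
  show "mult_z_adj e \<in> bergman_disc" by (intro mult_z_adj_bergman S_bergman E_S e)
  fix s assume s: "s \<in> S"
  show "dip (mult_z_adj e) s = 0"
    using e s by (simp only: mult_z_adj_inner(1)[OF S_bergman[OF E_S[OF e]] S_bergman[OF s]]) (simp
        add: E_def ominus_def)
qed

text \<open>The backward shifts q k of an orthonormal sequence in \<open>E\<close> are weakly null,
  yet \<open>Az\<close> stays bounded below on them once the index is large. By compactness
  \<open>T\<close> tends to 0 along a subsequence, contradicting \<open>T_inner_Az\<close>.\<close>

theorem compact_imp_finite_dim:
  assumes K: "compact_op disc_measure Q T"
  shows "finite_dim E"
proof (rule ccontr)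
  assume nf: "\<not> finite_dim E"
  obtain e where "\<forall>k::nat. e k \<in> E \<and> dnorm (e k) = 1" and eo: "\<forall>j k. j \<noteq> k \<longrightarrow> dip (e j) (e k) = 0"
    using orthonormal_sequence_exists[OF E_hilbert nf] by (elim exE conjE)
  then have e: "e k \<in> E" "dnorm (e k) = 1" "j \<noteq> k \<Longrightarrow> dip (e j) (e k) = 0" for j k
    by simp_all
  have eS: "e k \<in> S" and eH: "e k \<in> bergman_disc" and eL: "e k \<in> L2 disc_measure" for k
    using e(1) E_S S_bergman S_L2 by blast+
  have weak: "(\<lambda>k. dip (e k) f) \<longlonglongrightarrow> 0" if "f \<in> L2 disc_measure" for f
  proof -
    have "(\<lambda>k. cnj (dip f (e k))) \<longlonglongrightarrow> cnj 0"
      by (intro tendsto_cnj Bessel_tendsto eL e that)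
    then show ?thesis by (simp add: l2_inner_cnj)
  qed
  define q where "q k = mult_z_adj (e k)" for k
  have qQ: "q k \<in> Q" for k unfolding q_def by (rule E_adj_Q[OF e(1)])
  have qH: "q k \<in> bergman_disc" for k using Q_bergman qQ .
  have qle: "dnorm (q k) \<le> 1" for k
    using compression_norm_le[OF bergman_disc_hilbert disc_cnj_ok eH[of k]] e(2) by (simp add: q_def)
  \<comment> \<open>From index 1 on, m + 1 is at most 2m, so the backward shift loses at most half
    of the squared norm beyond the constant term.\<close>
  have qlower: "1 - (cmod (coef (e k) 0))\<^sup>2 \<le> 2 * (dnorm (q k))\<^sup>2" for k
  proof -
    have 1: "(\<lambda>m. 2 * (real m * (cmod (coef (e k) m))\<^sup>2)) sums (2 * (dnorm (q k))\<^sup>2)"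
      using mult_z_adj_inner_sums[OF eH eH, of k k] unfolding l2_inner_self q_def
          by (intro sums_mult sums_norm_sq) simp
    have 2: "(\<lambda>m. real (Suc m) * (cmod (coef (e k) m))\<^sup>2 - (if m
        = 0 then (cmod (coef (e k) m))\<^sup>2 else 0)) sums (1 - (cmod (coef (e k) 0))\<^sup>2)"
      using sums_diff[OF bergman_norm_sums[OF eH[of k]] sums_single[of 0
          "\<lambda>m. (cmod (coef (e k) m))\<^sup>2"]] by (simp add: e(2))
    show ?thesis
    proof (rule sums_le[OF _ 2 1])
      fix m
      have "real (Suc m) * c \<le> 2 * (real m * c)" if "m \<noteq> 0" "0 \<le> c" for c :: real
      proof -
        have "real (Suc m) \<le> 2 * real m" using that by simp
        from mult_right_mono[OF this that(2)] show ?thesis by simp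
      qed
      then show "real (Suc m) * (cmod (coef (e k) m))\<^sup>2 - (if m
          = 0 then (cmod (coef (e k) m))\<^sup>2 else 0) \<le> 2 * (real m * (cmod (coef (e k) m))\<^sup>2)"
        by auto
    qed
  qed
  \<comment> \<open>The squared norm of q k is the inner product of \<open>Az\<close> (q k) with the
    unit vector e k.\<close>
  have Aq: "(dnorm (q k))\<^sup>2 \<le> dnorm (Az (q k))" for k
  proof -
    have "dip (Az (q k)) (e k) = dip (mult_z (q k)) (e k)"
      by (rule mult_z_inner_S[OF qQ eS, symmetric])
    also have "\<dots> = dip (q k) (q k)" unfolding q_def using mult_z_adj_inner(2)[OF eH qH, of k k]
        by (simp add: q_def)
    finally have "(dnorm (q k))\<^sup>2 = cmod (dip (Az (q k)) (e k))"
      by (simp only: l2_inner_self norm_of_real) simp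
    also have "\<dots> \<le> dnorm (Az (q k)) * dnorm (e k)"
      by (intro l2_Cauchy_Schwarz S_L2 Az_S qQ eS)
    finally show ?thesis by (simp add: e(2))
  qed
  obtain r g where r: "strict_mono (r :: nat \<Rightarrow> nat)" and g: "g \<in> Q"
      "l2_tendsto disc_measure (\<lambda>k. T (q (r k))) g"
    using K qQ qle unfolding compact_op_def by blast
  \<comment> \<open>The limit g is 0: its squared norm is a limit of inner products that symmetry of
    \<open>T\<close> turns into pairings of e k with a fixed vector, and these tend to 0.\<close>
  have "(\<lambda>k. dip (T (q (r k))) g) \<longlonglongrightarrow> dip g g"
    by (intro l2_tendsto_inner[OF g(2)] Q_L2 T_in qQ g)
  moreover have "(\<lambda>k. dip (T (q (r k))) g) \<longlonglongrightarrow> 0"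
  proof -
    have "dip (T (q k)) g = dip (e k) (mult_z (T g))" for k
      unfolding T_inner(2)[OF qQ g(1)] unfolding q_def
      by (rule mult_z_adj_inner(1)[OF eH Q_bergman[OF T_in[OF g(1)]]])
    then have "(\<lambda>k. dip (T (q k)) g) \<longlonglongrightarrow> 0"
      using weak[OF mult_z_L2(1)[OF Q_L2[OF T_in[OF g(1)]]]] by simp
    from LIMSEQ_subseq_LIMSEQ[OF this r] show ?thesis by (simp add: o_def)
  qed
  ultimately have "dip g g = 0" using LIMSEQ_unique by blast
  then have "dnorm g = 0" by (simp add: l2_inner_self)
  then have "g = 0" using l2_hilbert_eq0[OF Q_hilbert g(1)] by blast
  then have "(\<lambda>k. dnorm (T (q (r k)))) \<longlonglongrightarrow> 0" using g(2) by (simp add: l2_tendsto_def)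
  \<comment> \<open>The thresholds give |q|^2 at least (1 - 1/4)/2 = 3/8, so |\<open>Az\<close> q|^2
    is at least 9/64. The error is at most 1/32 from \<open>T\<close>, 1/16 from N = 15 and 1/32
    from the coefficients, together 8/64.\<close>
  then have ev1: "\<forall>\<^sub>F k in sequentially. dnorm (T (q (r k))) < 1/32"
    by (rule order_tendstoD) simp
  have "(\<lambda>k. (cmod (coef (e k) 0))\<^sup>2) \<longlonglongrightarrow> (cmod 0)\<^sup>2"
    by (intro tendsto_intros weak bergman_disc_L2 mono_fn_bergman)
  then have "(\<lambda>k. (cmod (coef (e (r k)) 0))\<^sup>2) \<longlonglongrightarrow> 0" using LIMSEQ_subseq_LIMSEQ[OF _ r]
      by (fastforce simp: o_def)
  then have ev2: "\<forall>\<^sub>F k in sequentially. (cmod (coef (e (r k)) 0))\<^sup>2 < 1/4"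
    by (rule order_tendstoD) simp
  have "(\<lambda>k. \<Sum>m<15. cmod (coef (q k) m)) \<longlonglongrightarrow> (\<Sum>m<15::nat. cmod 0)"
    unfolding q_def coef_mult_z_adj[OF eH]
    by (intro tendsto_intros weak bergman_disc_L2 mono_fn_bergman)
  then have "(\<lambda>k. \<Sum>m<15. cmod (coef (q (r k)) m)) \<longlonglongrightarrow> 0" using LIMSEQ_subseq_LIMSEQ[OF _ r]
      by (fastforce simp: o_def)
  then have ev3: "\<forall>\<^sub>F k in sequentially. (\<Sum>m<15. cmod (coef (q (r k)) m)) < 1/32"
    by (rule order_tendstoD) simp
  obtain k where k: "dnorm (T (q (r k))) < 1/32" "(cmod (coef (e (r k)) 0))\<^sup>2 < 1/4"
      "(\<Sum>m<15. cmod (coef (q (r k)) m)) < 1/32"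
    using eventually_happens[OF eventually_conj[OF ev1 eventually_conj[OF ev2 ev3]]] by auto
  define y where "y = q (r k)"
  have y: "y \<in> Q" "y \<in> bergman_disc" "dnorm y \<le> 1" using qQ qH qle by (auto simp: y_def)
  have "3/8 \<le> (dnorm y)\<^sup>2" using qlower[of "r k"] k(2) by (simp add: y_def)
  also have "\<dots> \<le> dnorm (Az y)" using Aq[of "r k"] by (simp add: y_def)
  finally have "(3/8)\<^sup>2 \<le> (dnorm (Az y))\<^sup>2" by (intro power_mono) auto
  also have "\<dots> = cmod (dip (Az y) (Az y))" by (simp only: l2_inner_self norm_of_real) simp
  also have "dip (Az y) (Az y) = dip (T y) y
     + (dip (mult_z y) (mult_z y) - dip (mult_z_adj y) (mult_z_adj y))"
    using T_inner_Az[OF y(1) y(1)] by simp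
  also have "cmod \<dots> \<le> cmod (dip (T y) y) + cmod (dip (mult_z y) (mult_z y) - dip (mult_z_adj y)
      (mult_z_adj y))"
    by (rule norm_triangle_ineq)
  also have "cmod (dip (T y) y) \<le> 1/32 * 1"
    by (rule order_trans[OF l2_Cauchy_Schwarz[OF Q_L2[OF T_in[OF y(1)]] Q_L2[OF y(1)]]])
       (use k(1) y(3) in \<open>intro mult_mono; simp add: y_def\<close>)
  also have "cmod (dip (mult_z y) (mult_z y) - dip (mult_z_adj y) (mult_z_adj y))
      \<le> (dnorm y / real (Suc 15) + (\<Sum>m<15. cmod (coef y m))) * dnorm y"
    by (rule mult_z_inner_near_adj[OF y(2) y(2)])
  also have "\<dots> \<le> (1 / 16 + 1 / 32) * 1"
    using y(3) k(3) by (intro mult_mono add_mono) (auto simp: y_def intro!: add_nonneg_nonneg sum_nonneg)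
  finally show False by (simp add: power2_eq_square)
qed

text \<open>Multiplication by z is bounded below, so Cauchy sequences in the image come from Cauchy
  sequences in \<open>S\<close>. Completeness is what permits projecting onto z
  \<open>S\<close>.\<close>

lemma mult_z_S_hilbert: "l2_hilbert disc_measure (mult_z ` S)"
proof -
  have sub: "cfun.subspace S" by (rule l2_hilbert_subspace[OF S_hilbert])
  have "cfun.subspace (mult_z ` S)"
  proof (rule cfun.subspaceI)
    have "mult_z 0 = 0" by (simp add: mult_op_def fun_eq_iff)
    then show "0 \<in> mult_z ` S" using cfun.subspace_0[OF sub] by force
    fix f g c assume "f \<in> mult_z ` S" "g \<in> mult_z ` S"
    then obtain a b where ab: "a \<in> S" "b \<in> S" "f = mult_z a" "g = mult_z b" by blast
    have "f + g = mult_z (a + b)" by (simp add: ab mult_op_def fun_eq_iff algebra_simps)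
    then show "f + g \<in> mult_z ` S" using cfun.subspace_add[OF sub] ab by blast
    have "(\<lambda>x. c * f x) = mult_z (\<lambda>x. c * a x)" by (simp add: ab mult_op_def fun_eq_iff)
    then show "(\<lambda>x. c * f x) \<in> mult_z ` S" using cfun.subspace_scale[OF sub] ab by blast
  qed
  moreover have "\<exists>f\<in>mult_z ` S. l2_tendsto disc_measure s f"
    if s: "\<And>k. s k \<in> mult_z ` S" and C: "\<And>e. e > 0 \<Longrightarrow> \<exists>N. \<forall>m\<ge>N. \<forall>n\<ge>N. dnorm (s m - s n) < e" for s
  proof -
    have "\<forall>k. \<exists>a\<in>S. s k = mult_z a" using s by (simp add: image_iff)
    then obtain a where "\<forall>k. a k \<in> S \<and> s k = mult_z (a k)" by metis
    then have a: "a k \<in> S" "s k = mult_z (a k)" for k by simp_all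
    have "\<exists>f\<in>S. l2_tendsto disc_measure a f"
    proof (rule l2_hilbert_complete[OF S_hilbert a(1)])
      fix e :: real assume "e > 0"
      then obtain N where N: "\<forall>m\<ge>N. \<forall>n\<ge>N. dnorm (s m - s n) < e / 2" using C[of "e / 2"] by auto
      have "dnorm (a m - a n) < e" if "m \<ge> N" "n \<ge> N" for m n
      proof -
        have "a m - a n \<in> bergman_disc" using cfun.subspace_diff[OF sub a(1) a(1)] S_bergman by blast
        from mult_z_bounded_below[OF this] have "dnorm (a m - a n) \<le> 2 * dnorm (s m - s n)"
          by (simp add: a(2) mult_op_diff)
        moreover have "dnorm (s m - s n) < e / 2" using N that by blast
        ultimately show ?thesis by simp
      qed
      then show "\<exists>N. \<forall>m\<ge>N. \<forall>n\<ge>N. dnorm (a m - a n) < e" by blast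
    qed
    then obtain f where f: "f \<in> S" "l2_tendsto disc_measure a f" by blast
    have "l2_tendsto disc_measure s (mult_z f)"
      unfolding l2_tendsto_def
    proof (rule Lim_null_comparison)
      show "(\<lambda>k. dnorm (a k - f)) \<longlonglongrightarrow> 0" using f(2) by (simp add: l2_tendsto_def)
      have "dnorm (s k - mult_z f) \<le> dnorm (a k - f)" for k
        using mult_z_L2(2)[OF L2_diff[OF S_L2[OF a(1)[of k]] S_L2[OF f(1)]]] by (simp add: a(2) mult_op_diff)
      then show "\<forall>\<^sub>F k in sequentially. norm (dnorm (s k - mult_z f)) \<le> dnorm (a k - f)"
        by simp
    qed
    then show ?thesis using f(1) by blast
  qed
  ultimately show ?thesis
    unfolding l2_hilbert_def using mult_z_S S_L2 l2_hilbert_eq0[OF S_hilbert] by blast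
qed

text \<open>The adjoint of \<open>Az\<close> is compact on \<open>z S\<close>, because \<open>M\<^sub>z\<^sup>* M\<^sub>z\<close> is the identity up to a compact
  operator and \<open>S\<close> is orthogonal to \<open>Q\<close>; and \<open>z S\<close> has finite codimension in \<open>S\<close>.\<close>

lemma Az_bound:
  assumes F: "finite F" "F \<subseteq> E" "\<forall>u\<in>F. dnorm u = 1" "\<forall>f\<in>E. f = (\<Sum>u\<in>F. (\<lambda>x. dip f u * u x))"
    and q: "q \<in> Q"
  shows "dnorm (Az q) \<le> 2 * (dnorm q / real (Suc N) + (\<Sum>m<N. cmod (coef q m)))
     + (\<Sum>u\<in>F. cmod (dip q (mult_z_adj u)))"
proof -
  define a where "a = Az q"
  define n where "n = dnorm a"
  define G where "G = dnorm q / real (Suc N) + (\<Sum>m<N. cmod (coef q m))"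
  have G0: "0 \<le> G" unfolding G_def by (intro add_nonneg_nonneg sum_nonneg) auto
  have aS: "a \<in> S" unfolding a_def by (rule Az_S[OF q])
  \<comment> \<open>Splits \<open>Az\<close> q into p in z \<open>S\<close> and e in
    \<open>E\<close>; the two parts are estimated by different means.\<close>
  define p where "p = proj disc_measure (mult_z ` S) a"
  have pS': "p \<in> mult_z ` S" unfolding p_def by (rule proj_in[OF mult_z_S_hilbert S_L2[OF aS]])
  then obtain s where s: "s \<in> S" "p = mult_z s" by blast
  have pS: "p \<in> S" using s mult_z_S by simp
  have pn: "dnorm p \<le> n" unfolding p_def n_def by (rule proj_norm_le[OF mult_z_S_hilbert S_L2[OF aS]])
  define e where "e = a - p"
  have eS: "e \<in> S" unfolding e_def using cfun.subspace_diff[OF l2_hilbert_subspace[OF S_hilbert] aS pS] .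
  have eo: "dip e g = 0" if "g \<in> mult_z ` S" for g
    unfolding e_def p_def by (rule proj_orth[OF mult_z_S_hilbert S_L2[OF aS] that])
  have eE: "e \<in> E" using eS eo by (simp add: E_def ominus_def)
  have en: "dnorm e \<le> n"
  proof (rule power2_le_imp_le)
    have "a = e + p" by (simp add: e_def)
    then have "n\<^sup>2 = (dnorm e)\<^sup>2 + (dnorm p)\<^sup>2"
      using l2_norm_add_sq[OF S_L2[OF eS] S_L2[OF pS]] eo[OF pS'] by (simp add: n_def)
    then show "(dnorm e)\<^sup>2 \<le> n\<^sup>2" by simp
  qed (simp add: n_def)
  have sn: "dnorm s \<le> 2 * n" using mult_z_bounded_below[OF S_bergman[OF s(1)]] s(2) pn by simp
  have 1: "dip a a = dip (mult_z q) e + dip (mult_z q) p"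
  proof -
    have "dip a a = dip (mult_z q) a" unfolding a_def by (rule mult_z_inner_S[OF q Az_S[OF q], symmetric])
    also have "\<dots> = dip (mult_z q) (e + p)" by (simp add: e_def)
    finally show ?thesis using eS pS q by (simp add: l2_inner_add_right S_L2 mult_z_L2 Q_L2)
  qed
  \<comment> \<open>With p = z s and s orthogonal to q, this inner product is exactly the failure of
    multiplication by z to be isometric. The factor 2 bounds s by p.\<close>
  have 2: "cmod (dip (mult_z q) p) \<le> G * (2 * n)"
  proof -
    have "cmod (dip (mult_z q) p) = cmod (dip q s - dip (mult_z q) (mult_z s))"
      using S_Q_orthogonal(2)[OF s(1) q] s(2) by simp
    also have "\<dots> \<le> G * dnorm s"
      unfolding G_def by (rule mult_z_inner_near_isometric[OF Q_bergman[OF q] S_bergman[OF s(1)]])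
    also have "\<dots> \<le> G * (2 * n)" using sn G0 by (intro mult_left_mono)
    finally show ?thesis .
  qed
  \<comment> \<open>Expanding e in the finite basis leaves finitely many functionals of q, given by
    the adjoint shifts of the basis vectors.\<close>
  have 3: "cmod (dip (mult_z q) e) \<le> (\<Sum>u\<in>F. cmod (dip q (mult_z_adj u))) * n"
  proof -
    have uS: "u \<in> S" "u \<in> L2 disc_measure" "u \<in> bergman_disc" if "u \<in> F" for u
        using that F(2) E_S S_L2 S_bergman by blast+
    have ee: "e = (\<Sum>u\<in>F. (\<lambda>x. dip e u * u x))" using F(4) eE by blast
    have "dip e (mult_z q) = (\<Sum>u\<in>F. dip e u * dip u (mult_z q))"
      by (subst ee, subst l2_inner_sum_left)
        (use F uS q in \<open>auto simp: l2_inner_scale_left mult_z_L2 Q_L2 intro!: L2_scale\<close>)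
    also have "cmod \<dots> \<le> (\<Sum>u\<in>F. n * cmod (dip q (mult_z_adj u)))"
    proof (rule sum_norm_le)
      fix u assume u: "u \<in> F"
      have "cmod (dip e u) \<le> dnorm e * dnorm u"
        by (intro l2_Cauchy_Schwarz S_L2 eS uS u)
      then have c: "cmod (dip e u) \<le> n" using F(3) u en by simp
      have "dip u (mult_z q) = dip (mult_z_adj u) q"
        by (rule mult_z_adj_inner(1)[OF uS(3)[OF u] Q_bergman[OF q], symmetric])
      then have "cmod (dip u (mult_z q)) = cmod (dip q (mult_z_adj u))"
        by (metis complex_mod_cnj l2_inner_cnj)
      then show "cmod (dip e u * dip u (mult_z q)) \<le> n * cmod (dip q (mult_z_adj u))"
        using c by (simp add: norm_mult mult_right_mono)
    qed
    also have "cmod (dip e (mult_z q)) = cmod (dip (mult_z q) e)"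
      by (metis complex_mod_cnj l2_inner_cnj)
    finally show ?thesis by (simp add: sum_distrib_left mult.commute)
  qed
  have "n * n = cmod (dip a a)" unfolding n_def by (simp only: l2_inner_self norm_of_real) (simp
      add: power2_eq_square)
  also have "\<dots> \<le> cmod (dip (mult_z q) e) + cmod (dip (mult_z q) p)"
    unfolding 1 by (rule norm_triangle_ineq)
  also have "\<dots> \<le> (2 * G + (\<Sum>u\<in>F. cmod (dip q (mult_z_adj u)))) * n"
    using 2 3 by (simp add: algebra_simps)
  finally have *: "n * n \<le> (2 * G + (\<Sum>u\<in>F. cmod (dip q (mult_z_adj u)))) * n" .
  have "n \<le> 2 * G + (\<Sum>u\<in>F. cmod (dip q (mult_z_adj u)))"
  proof (cases "n = 0")
    case True
    then show ?thesis using G0 by (simp add: sum_nonneg)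
  next
    case False
    then have "0 < n" using l2_norm_nonneg[of disc_measure a] by (simp add: n_def less_le)
    then show ?thesis using * by simp
  qed
  then show ?thesis by (simp add: n_def a_def G_def)
qed

text \<open>\<open>T_inner_Az\<close> is tested with x = \<open>T\<close> q. The bound on
  \<open>Az\<close> q contributes twice the weighted remainder and the Bergman shift once, hence the
  factor 3 below.\<close>

theorem finite_dim_imp_compact:
  assumes "finite_dim E"
  shows "compact_op disc_measure Q T"
proof (rule compact_opI[OF Q_hilbert T_in])
  fix f g assume "f \<in> Q" "g \<in> Q"
  then show "T (f - g) = T f - T g"
    unfolding T_eq
    by (simp add: compression_diff[OF Q_hilbert disc_id_ok] compression_diff[OF Q_hilbert
        disc_cnj_ok] Cz_in Cz_adj_in)
next
  fix d :: real assume d: "d > 0"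
  obtain F where F: "finite F" "F \<subseteq> E" "\<forall>u\<in>F. dnorm u = 1" "\<forall>f\<in>E. f = (\<Sum>u\<in>F. (\<lambda>x. dip f u * u x))"
    using orthonormal_basis_exists[OF E_hilbert order_refl l2_hilbert_subspace[OF E_hilbert] assms]
        by (elim exE conjE)
  obtain us where us: "set us = F" "distinct us" using finite_distinct_list[OF F(1)] by blast
  \<comment> \<open>Makes 3/(N+1) at most d, for the three copies of the norm term.\<close>
  obtain N where N: "3 / d < real N" using reals_Archimedean2 by blast
  define ms where "ms = map mono_fn [0..<N]"
  \<comment> \<open>Three copies of the low monomials absorb the factor 3; the remaining vectors are
    the functionals coming from the basis of \<open>E\<close>.\<close>
  define xs where "xs = ms @ ms @ ms @ map mult_z_adj us"
  have "set xs \<subseteq> L2 disc_measure"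
  proof -
    have "mult_z_adj u \<in> L2 disc_measure" if "u \<in> set us" for u
      using that us(1) F(2) by (intro bergman_disc_L2 mult_z_adj_bergman S_bergman E_S) auto
    then show ?thesis using bergman_disc_L2[OF mono_fn_bergman] by (auto simp: xs_def ms_def)
  qed
  moreover have "dnorm (T q) \<le> d * dnorm q + (\<Sum>x\<leftarrow>xs. cmod (dip q x))"
    if q: "q \<in> Q" for q
  proof -
    define G where "G = dnorm q / real (Suc N) + (\<Sum>m<N. cmod (coef q m))"
    define W where "W = (\<Sum>u\<in>F. cmod (dip q (mult_z_adj u)))"
    define x where "x = T q"
    define n where "n = dnorm x"
    have n0: "0 \<le> n" by (simp add: n_def)
    have xQ: "x \<in> Q" unfolding x_def by (rule T_in[OF q])
    have "n * n = cmod (dip (T q) x)" unfolding n_def x_def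
        by (simp only: l2_inner_self norm_of_real) (simp add: power2_eq_square)
    also have "\<dots> \<le> cmod (dip (Az q) (Az x)) +
       cmod (dip (mult_z q) (mult_z x) - dip (mult_z_adj q) (mult_z_adj x))"
      unfolding T_inner_Az[OF q xQ] by (rule norm_triangle_ineq4)
    also have "cmod (dip (Az q) (Az x)) \<le> dnorm (Az q) * dnorm (Az x)"
      by (intro l2_Cauchy_Schwarz S_L2 Az_S q xQ)
    also have "\<dots> \<le> (2 * G + W) * n"
      unfolding n_def G_def W_def by (intro mult_mono Az_bound Az_norm_le F q xQ add_nonneg_nonneg
          mult_nonneg_nonneg sum_nonneg) auto
    also have "cmod (dip (mult_z q) (mult_z x) - dip (mult_z_adj q) (mult_z_adj x)) \<le> G * n"
      unfolding n_def G_def by (intro mult_z_inner_near_adj Q_bergman q xQ)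
    finally have *: "n * n \<le> (3 * G + W) * n" by (simp add: algebra_simps)
    have GW: "0 \<le> G" "0 \<le> W" unfolding G_def W_def by (auto intro!: add_nonneg_nonneg sum_nonneg)
    have le: "n \<le> 3 * G + W"
    proof (cases "n = 0")
      case False
      then show ?thesis using * n0 by simp
    qed (use GW in simp)
    have ss: "(\<Sum>x\<leftarrow>xs. cmod (dip q x)) = 3 * (\<Sum>m<N. cmod (coef q m)) + W"
    proof -
      have "(\<Sum>x\<leftarrow>ms. cmod (dip q x)) = (\<Sum>m<N. cmod (coef q m))"
        by (simp add: ms_def o_def interv_sum_list_conv_sum_set_nat atLeast0LessThan)
      moreover have "(\<Sum>x\<leftarrow>map mult_z_adj us. cmod (dip q x)) = W"
        using us by (simp add: W_def o_def sum_list_distinct_conv_sum_set)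
      ultimately show ?thesis by (simp add: xs_def)
    qed
    have "3 * (dnorm q / real (Suc N)) \<le> d * dnorm q"
    proof -
      have "3 / real (Suc N) \<le> d" using N d by (simp add: field_simps)
      from mult_right_mono[OF this l2_norm_nonneg[of disc_measure q]] show ?thesis by simp
    qed
    then show ?thesis using le unfolding ss G_def n_def x_def by simp
  qed
  ultimately show "\<exists>xs. set xs \<subseteq> L2 disc_measure \<and> (\<forall>f\<in>Q. dnorm (T f) \<le> d * dnorm f
      + (\<Sum>x\<leftarrow>xs. cmod (dip f x)))"
    by blast
qed

end

subsection \<open>The Bergman space of the polydisc and elementary tensors\<close>

lemma open_polydisc: "open (polydisc :: (complex ^ 'n) set)"
proof -
  have "open (\<Inter>i\<in>UNIV. (\<lambda>z :: complex ^ 'n. z $ i) -` ball 0 1)"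
    by (intro open_INT ballI finite open_vimage open_ball continuous_intros)
  also have "(\<Inter>i\<in>UNIV. (\<lambda>z :: complex ^ 'n. z $ i) -` ball 0 1) = polydisc" by (auto simp: polydisc_def)
  finally show ?thesis .
qed

lemma bounded_polydisc: "bounded (polydisc :: (complex ^ 'n) set)"
proof (rule boundedI)
  fix z :: "complex ^ 'n" assume z: "z \<in> polydisc"
  have "norm z \<le> (\<Sum>i\<in>UNIV. norm (z $ i))" unfolding norm_vec_def by (rule L2_set_le_sum) simp
  also have "\<dots> \<le> (\<Sum>i\<in>(UNIV :: 'n set). 1)" using z by (intro sum_mono) (auto simp: polydisc_def less_imp_le)
  finally show "norm z \<le> real CARD('n)" by simp
qed

lemma norm_vector_scalar_mult: "norm (c *s v) = cmod c * norm v" for v :: "complex ^ 'n"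
  by (simp add: norm_vec_def L2_set_def norm_mult power_mult_distrib sum_distrib_left[symmetric]
      real_sqrt_mult)

lemma bounded_bilinear_vector_scalar_mult: "bounded_bilinear ((*s) :: complex \<Rightarrow> complex ^ 'n \<Rightarrow> complex ^ 'n)"
proof
  show "\<exists>K. \<forall>a (b :: complex ^ 'n). norm (a *s b) \<le> norm a * norm b * K"
    by (rule exI[of _ 1]) (simp add: norm_vector_scalar_mult)
qed (auto simp: vec_eq_iff algebra_simps)

interpretation poly: holomorphic_L2 "(*s)" "polydisc :: (complex ^ 'n) set"
  rewrites "holomorphic_L2.UM (polydisc :: (complex ^ 'n) set) = polydisc_measure"
    and "holomorphic_L2.HH (*s) (polydisc :: (complex ^ 'n) set) = bergman_polydisc"
proof -
  have "0 \<in> (polydisc :: (complex ^ 'n) set)" by (simp add: polydisc_def)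
  then show i: "holomorphic_L2 (*s) (polydisc :: (complex ^ 'n) set)"
    by (intro holomorphic_L2.intro)
      (auto simp: norm_vector_scalar_mult lborel_rotation_complex_vec
          bounded_bilinear_vector_scalar_mult open_polydisc bounded_polydisc)
  show UM: "holomorphic_L2.UM (polydisc :: (complex ^ 'n) set) = polydisc_measure"
    by (simp add: holomorphic_L2.UM_def[OF i] polydisc_measure_def)
  show "holomorphic_L2.HH (*s) (polydisc :: (complex ^ 'n) set) = bergman_polydisc"
    unfolding holomorphic_L2.HH_def[OF i] bergman_polydisc_def holomorphic_L2.cholo_def[OF i]
        holomorphic_several_on_def UM by simp
qed

abbreviation pip :: "(complex ^ 'n \<Rightarrow> complex) \<Rightarrow> (complex ^ 'n \<Rightarrow> complex) \<Rightarrow> complex" where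
  "pip \<equiv> l2_inner polydisc_measure"

abbreviation pnorm :: "(complex ^ 'n \<Rightarrow> complex) \<Rightarrow> real" where
  "pnorm \<equiv> l2_norm polydisc_measure"

lemma sets_polydisc_measure [measurable_cong, simp]: "sets polydisc_measure = sets borel"
  by (simp add: polydisc_measure_def)

lemma measurable_polydisc_measure: "f \<in> borel_measurable borel \<Longrightarrow> f \<in> borel_measurable polydisc_measure"
  by (simp add: measurable_cong_sets[OF sets_polydisc_measure refl])

lemma measurable_from_disc_measure: "f \<in> borel_measurable disc_measure \<Longrightarrow> f \<in> borel_measurable borel"
  by (simp add: measurable_cong_sets[OF sets_disc_measure refl])

lemma measurable_component [measurable]: "(\<lambda>z :: complex ^ 'n. z $ i) \<in> borel_measurable borel"
  by (intro borel_measurable_continuous_onI continuous_intros)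

text \<open>Fubini's theorem for the product description of Lebesgue measure. The values may be real
  or complex, since both squared moduli and inner products are to be factored.\<close>

lemma lborel_prod_integral:
  fixes g :: "'n::finite \<Rightarrow> complex \<Rightarrow> 'b :: {real_normed_field, banach, second_countable_topology}"
  assumes g: "\<And>i. integrable lborel (g i)"
  shows "integrable lborel (\<lambda>z :: complex ^ 'n. \<Prod>i\<in>UNIV. g i (z $ i))"
    and "(LINT z|lborel. (\<Prod>i\<in>(UNIV :: 'n set). g i (z $ i))) = (\<Prod>i\<in>UNIV. integral\<^sup>L lborel (g i))"
proof -
  interpret product_sigma_finite "\<lambda>_::'n. lborel :: complex measure" ..
  have [measurable]: "g i \<in> borel_measurable borel" for i using g[of i]
      by (auto dest: borel_measurable_integrable)
  have [measurable]: "(\<lambda>f. (\<chi> i. f i) :: complex ^ 'n) \<in> borel_measurable (Pi\<^sub>M UNIV (\<lambda>_. lborel))"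
    by (rule measurable_vec_lambda) measurable
  have [measurable]: "(\<lambda>z :: complex ^ 'n. \<Prod>i\<in>UNIV. g i (z $ i)) \<in> borel_measurable borel" by measurable
  show "integrable lborel (\<lambda>z :: complex ^ 'n. \<Prod>i\<in>UNIV. g i (z $ i))"
    by (subst lborel_complex_vec_PiM, subst integrable_distr_eq) (auto intro: product_integrable_prod g)
  show "(LINT z|lborel. (\<Prod>i\<in>(UNIV :: 'n set). g i (z $ i))) = (\<Prod>i\<in>UNIV. integral\<^sup>L lborel (g i))"
    by (subst lborel_complex_vec_PiM, subst integral_distr) (auto intro: product_integral_prod g)
qed

lemma indicator_polydisc: "indicator polydisc z = (\<Prod>i\<in>UNIV. indicator (ball 0 1) (z $ i) :: real)"
proof (cases "z \<in> polydisc")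
  case False
  then obtain i where "z $ i \<notin> ball 0 1" by (auto simp: polydisc_def)
  then have "(\<Prod>i\<in>UNIV. indicator (ball 0 1) (z $ i) :: real) = 0"
      by (intro prod_zero) (auto intro!: exI[of _ i])
  then show ?thesis using False by simp
qed (auto simp: polydisc_def indicator_def)

lemma poly_V: "measure lborel (polydisc :: (complex ^ 'n) set) = disc.V ^ CARD('n)"
proof -
  have [measurable]: "(polydisc :: (complex ^ 'n) set) \<in> sets borel" by (rule borel_open[OF open_polydisc])
  have i: "integrable lborel (indicator (ball (0::complex) 1) :: _ \<Rightarrow> real)"
    using emeasure_bounded_finite[OF bounded_ball] by (intro integrable_real_indicator) auto
  have "measure lborel (polydisc :: (complex ^ 'n) set)
      = (LINT z|lborel. (indicator (polydisc :: (complex ^ 'n) set) z :: real))" by simp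
  also have "\<dots> = (\<Prod>i\<in>(UNIV :: 'n set). (LINT z|lborel. (indicator (ball (0::complex) 1) z :: real)))"
    unfolding indicator_polydisc by (rule lborel_prod_integral(2)[OF i])
  finally show ?thesis by (simp add: disc.V_def)
qed

text \<open>Indicator and volume of the polydisc both factor, so the density of its normalized
  measure is the product of those of the disc.\<close>

lemma polydisc_prod_integral:
  fixes g :: "'n::finite \<Rightarrow> complex \<Rightarrow> 'b :: {real_normed_field, banach, second_countable_topology}"
  assumes g: "\<And>i. integrable disc_measure (g i)"
  shows "integrable polydisc_measure (\<lambda>z :: complex ^ 'n. \<Prod>i\<in>UNIV. g i (z $ i))"
    and "(LINT z|polydisc_measure. (\<Prod>i\<in>(UNIV :: 'n set). g i (z $ i)))
        = (\<Prod>i\<in>UNIV. integral\<^sup>L disc_measure (g i))"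
proof -
  have gm[measurable]: "g i \<in> borel_measurable borel" for i
    using g[of i] by (intro measurable_from_disc_measure) auto
  define d where "d z = indicator (ball (0::complex) 1) z / disc.V" for z
  have d0: "0 \<le> d z" for z using disc.V_pos by (simp add: d_def)
  have [measurable]: "d \<in> borel_measurable borel" unfolding d_def
      by (intro borel_measurable_divide borel_measurable_indicator) auto
  have dm: "disc_measure = density lborel (\<lambda>x. ennreal (d x))" unfolding d_def by (rule disc.UM_eq)
  have pm: "(polydisc_measure :: (complex ^ 'n) measure) = density lborel (\<lambda>z. ennreal (\<Prod>i\<in>UNIV. d (z $ i)))"
    unfolding poly.UM_eq poly.V_def poly_V indicator_polydisc d_def by (simp add: prod_dividef)
  have pd[measurable]: "(\<lambda>z :: complex ^ 'n. \<Prod>i\<in>UNIV. d (z $ i)) \<in> borel_measurable borel" by measurable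
  have pg[measurable]: "(\<lambda>z :: complex ^ 'n. \<Prod>i\<in>UNIV. g i (z $ i)) \<in> borel_measurable borel" by measurable
  have i: "integrable lborel (\<lambda>z. d z *\<^sub>R g i z)" for i
    using g[of i] d0 unfolding dm by (subst (asm) integrable_density) auto
  have e: "(\<Prod>i\<in>UNIV. d (z $ i)) *\<^sub>R (\<Prod>i\<in>UNIV. g i (z $ i)) = (\<Prod>i\<in>UNIV. d (z $ i) *\<^sub>R g i (z $ i))"
      for z :: "complex ^ 'n"
    by (simp add: scaleR_conv_of_real prod.distrib)
  show "integrable polydisc_measure (\<lambda>z :: complex ^ 'n. \<Prod>i\<in>UNIV. g i (z $ i))"
    unfolding pm by (subst integrable_density) (auto simp: e d0 intro!: prod_nonneg lborel_prod_integral i)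
  have "(LINT z|polydisc_measure. (\<Prod>i\<in>(UNIV :: 'n set). g i (z $ i)))
      = (LINT z|lborel. (\<Prod>i\<in>(UNIV :: 'n set). d (z $ i) *\<^sub>R g i (z $ i)))"
    unfolding pm by (subst integral_density) (auto simp: e d0 intro!: prod_nonneg)
  also have "\<dots> = (\<Prod>i\<in>UNIV. integral\<^sup>L lborel (\<lambda>z. d z *\<^sub>R g i z))" by (rule lborel_prod_integral(2)[OF i])
  also have "\<dots> = (\<Prod>i\<in>UNIV. integral\<^sup>L disc_measure (g i))"
    unfolding dm by (intro prod.cong refl, subst integral_density) (auto simp: d0)
  finally show "(LINT z|polydisc_measure. (\<Prod>i\<in>(UNIV :: 'n set). g i (z $ i)))
      = (\<Prod>i\<in>UNIV. integral\<^sup>L disc_measure (g i))" .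
qed

section \<open>Elementary tensors\<close>

definition tens :: "('n::finite \<Rightarrow> complex \<Rightarrow> complex) \<Rightarrow> complex ^ 'n \<Rightarrow> complex" where
  "tens f = (\<lambda>z. \<Prod>i\<in>UNIV. f i (z $ i))"

text \<open>Isolates one slot; linearity in that slot and the action of multipliers on it follow by
  algebra.\<close>

lemma tens_upd: "tens (f(i := h)) z = h (z $ i) * (\<Prod>j\<in>UNIV - {i}. f j (z $ j))"
proof -
  have "(\<Prod>j\<in>UNIV - {i}. (f(i := h)) j (z $ j)) = (\<Prod>j\<in>UNIV - {i}. f j (z $ j))" by (rule prod.cong) auto
  then show ?thesis unfolding tens_def by (subst prod.remove[of UNIV i]) auto
qed

lemma tens_upd_diff: "tens (f(i := a - b)) = tens (f(i := a)) - tens (f(i := b))"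
  by (simp add: fun_eq_iff tens_upd algebra_simps)

lemma tens_upd_add: "tens (f(i := a + b)) = tens (f(i := a)) + tens (f(i := b))"
  by (simp add: fun_eq_iff tens_upd algebra_simps)

lemma tens_upd_scale: "tens (f(i := (\<lambda>x. c * a x))) = (\<lambda>z. c * tens (f(i := a)) z)"
  by (simp add: fun_eq_iff tens_upd algebra_simps)

lemma tens_upd_mult_op: "mult_op (\<lambda>z. \<phi> (z $ i)) (tens f) = tens (f(i := mult_op \<phi> (f i)))"
proof
  fix z
  have "tens f z = tens (f(i := f i)) z" by simp
  then show "mult_op (\<lambda>z. \<phi> (z $ i)) (tens f) z = tens (f(i := mult_op \<phi> (f i))) z"
    unfolding mult_op_def by (simp add: tens_upd del: fun_upd_triv)
qed

lemma tens_eq0: "f i = 0 \<Longrightarrow> tens f = 0"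
  using tens_upd[of f i 0] by (simp add: fun_eq_iff fun_upd_idem)

lemma tens_L2:
  assumes f: "\<And>i. f i \<in> L2 disc_measure"
  shows "tens f \<in> L2 polydisc_measure"
proof -
  have [measurable]: "f i \<in> borel_measurable borel" for i
    using f[of i] by (auto simp: L2_def intro: measurable_from_disc_measure)
  have "integrable polydisc_measure (\<lambda>z. \<Prod>i\<in>UNIV. (cmod (f i (z $ i)))\<^sup>2)"
    using f by (intro polydisc_prod_integral) (auto simp: L2_def)
  then have "integrable polydisc_measure (\<lambda>z. (cmod (tens f z))\<^sup>2)"
    by (simp add: tens_def prod_norm[symmetric] prod_power_distrib)
  moreover have "tens f \<in> borel_measurable polydisc_measure"
    unfolding tens_def by (intro measurable_polydisc_measure) measurable
  ultimately show ?thesis by (simp add: L2_def)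
qed

lemma tens_inner:
  assumes f: "\<And>i. f i \<in> L2 disc_measure" and g: "\<And>i. g i \<in> L2 disc_measure"
  shows "pip (tens f) (tens g) = (\<Prod>i\<in>UNIV. dip (f i) (g i))"
proof -
  have "pip (tens f) (tens g) = (LINT z|polydisc_measure. (\<Prod>i\<in>UNIV. f i (z $ i) * cnj (g i (z $ i))))"
    by (simp add: l2_inner_def tens_def prod.distrib)
  also have "\<dots> = (\<Prod>i\<in>UNIV. integral\<^sup>L disc_measure (\<lambda>z. f i z * cnj (g i z)))"
    by (rule polydisc_prod_integral(2)) (intro L2_prod_integrable f g)
  finally show ?thesis by (simp add: l2_inner_def)
qed

lemma tens_norm:
  assumes f: "\<And>i. f i \<in> L2 disc_measure"
  shows "pnorm (tens f) = (\<Prod>i\<in>UNIV. dnorm (f i))"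
proof -
  have "complex_of_real ((pnorm (tens f))\<^sup>2) = (\<Prod>i\<in>UNIV. of_real ((dnorm (f i))\<^sup>2))"
    using tens_inner[of f f] f by (simp only: l2_inner_self)
  then have "(pnorm (tens f))\<^sup>2 = (\<Prod>i\<in>UNIV. dnorm (f i))\<^sup>2"
    unfolding of_real_prod[symmetric] of_real_eq_iff by (simp add: prod_power_distrib)
  then show ?thesis by (rule power2_eq_imp_eq) (auto intro: prod_nonneg)
qed

text \<open>Unit vectors in the other slots make the insertion of h an isometry; analytic statements
  pass between a factor and the tensor product through it.\<close>

lemma tens_upd_norm:
  assumes f: "\<And>i. f i \<in> L2 disc_measure" and h: "h \<in> L2 disc_measure" and "\<And>k. k \<noteq> i \<Longrightarrow> dnorm (f k) = 1"
  shows "pnorm (tens (f(i := h))) = dnorm h"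
proof -
  have "pnorm (tens (f(i := h))) = (\<Prod>k\<in>UNIV. dnorm ((f(i := h)) k))"
    by (rule tens_norm) (simp add: f h)
  also have "\<dots> = dnorm h * (\<Prod>k\<in>UNIV - {i}. dnorm ((f(i := h)) k))"
    by (subst prod.remove[of UNIV i]) auto
  also have "(\<Prod>k\<in>UNIV - {i}. dnorm ((f(i := h)) k)) = 1"
    using assms(3) by (intro prod.neutral) auto
  finally show ?thesis unfolding mult_1_right .
qed

lemma tens_bergman:
  assumes f: "\<And>i. f i \<in> bergman_disc"
  shows "tens f \<in> bergman_polydisc"
proof -
  have "holomorphic_several_on (tens f) polydisc"
    unfolding holomorphic_several_on_def
  proof
    fix z :: "complex ^ 'a" assume z: "z \<in> polydisc"
    define d where "d i = deriv (f i) (z $ i)" for i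
    have "(f i has_field_derivative d i) (at (z $ i))" for i
      using f[of i] z unfolding d_def bergman_disc_def polydisc_def by (auto intro: holomorphic_derivI)
    then have 1: "(f i has_derivative (*) (d i)) (at (z $ i))" for i by (simp add: has_field_derivative_def)
    have 2: "((\<lambda>w. w $ i) has_derivative (\<lambda>h. h $ i)) (at z)" for i
      by (rule bounded_linear_imp_has_derivative[OF bounded_linear_vec_nth])
    have "((\<lambda>w. f i (w $ i)) has_derivative (\<lambda>h. d i * h $ i)) (at z)" for i
      by (rule has_derivative_compose[OF 2 1])
    then have "(tens f has_derivative (\<lambda>h. \<Sum>i\<in>UNIV. d i * h $ i * (\<Prod>j\<in>UNIV - {i}. f j (z $ j)))) (at z)"
      unfolding tens_def by (intro has_derivative_prod) auto
    then show "\<exists>D. (tens f has_derivative D) (at z) \<and> (\<forall>c v. D (c *s v) = c * D v)"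
      by (intro exI conjI) (auto simp: sum_distrib_left mult_ac)
  qed
  moreover have "tens f z = 0" if z: "z \<notin> polydisc" for z
  proof -
    obtain i where "z $ i \<notin> ball 0 1" using z by (auto simp: polydisc_def)
    then have "f i (z $ i) = 0" using f[of i] by (simp add: bergman_disc_def)
    then show ?thesis unfolding tens_def by (intro prod_zero) auto
  qed
  moreover have "tens f \<in> L2 polydisc_measure" by (intro tens_L2 bergman_disc_L2 f)
  ultimately show ?thesis by (simp add: bergman_polydisc_def L2_def)
qed

lemma AE_polydisc: "AE z in polydisc_measure. z \<in> polydisc"
  unfolding polydisc_measure_def using borel_open[OF open_polydisc] by (intro AE_uniform_measureI) auto

lemma coord_ok:
  "coord i \<in> borel_measurable polydisc_measure" "AE z in polydisc_measure. cmod (coord i z) \<le> 1"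
  "(\<lambda>z. cnj (coord i z)) \<in> borel_measurable polydisc_measure"
      "AE z in polydisc_measure. cmod (cnj (coord i z)) \<le> 1"
proof -
  show "AE z in polydisc_measure. cmod (coord i z) \<le> 1"
    using AE_polydisc by eventually_elim (auto simp: polydisc_def coord_def less_imp_le)
  then show "AE z in polydisc_measure. cmod (cnj (coord i z)) \<le> 1" by simp
  show "coord i \<in> borel_measurable polydisc_measure" "(\<lambda>z. cnj (coord i z)) \<in> borel_measurable
      polydisc_measure"
    unfolding coord_def by (intro measurable_polydisc_measure; measurable)+
qed

subsection \<open>Tensor products of quotient modules\<close>

locale tensor_quotient =
  fixes Q :: "(complex ^ 'n::finite \<Rightarrow> complex) set"
    and Qs S :: "'n \<Rightarrow> (complex \<Rightarrow> complex) set"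
  assumes Q_quot: "polydisc_quotient_module Q"
    and Q_tensor: "Q = tensor_prod Qs"
    and Qs_quot: "\<And>i. disc_quotient_module (Qs i)"
    and S_def: "\<And>i. S i = ominus disc_measure bergman_disc (Qs i)"
begin

sublocale comp: disc_quotient "Qs i" "S i" for i
  by unfold_locales (rule Qs_quot S_def)+

abbreviation K :: "'n \<Rightarrow> 'n \<Rightarrow> (complex ^ 'n \<Rightarrow> complex) \<Rightarrow> complex ^ 'n \<Rightarrow> complex" where
  "K i j \<equiv> commutator (C_z Q i) (adjoint_on polydisc_measure Q (C_z Q j))"

abbreviation C_adj :: "'n \<Rightarrow> (complex ^ 'n \<Rightarrow> complex) \<Rightarrow> complex ^ 'n \<Rightarrow> complex" where
  "C_adj j \<equiv> compression polydisc_measure Q (\<lambda>z. cnj (coord j z))"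

lemma Q_hilbert: "l2_hilbert polydisc_measure Q"
  by (rule l2_hilbert_closed_subspace[OF poly.HH_hilbert])
    (use Q_quot in \<open>simp add: polydisc_quotient_module_def quotient_module_def\<close>)

lemma Q_L2: "f \<in> Q \<Longrightarrow> f \<in> L2 polydisc_measure"
  by (rule l2_hilbert_L2[OF Q_hilbert])

definition TP :: "(complex ^ 'n \<Rightarrow> complex) set" where "TP = {tens f | f. \<forall>i. f i \<in> Qs i}"

lemma Q_eq: "Q = l2_closure polydisc_measure bergman_polydisc (cfun.span TP)"
  unfolding Q_tensor tensor_prod_def TP_def tens_def ..

lemma TP_bergman: "cfun.span TP \<subseteq> bergman_polydisc"
  by (rule cfun.span_minimal[OF _ poly.HH_subspace]) (auto simp: TP_def intro: tens_bergman comp.Q_bergman)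

lemma tens_Q: assumes f: "\<And>i. f i \<in> Qs i" shows "tens f \<in> Q"
proof -
  have "tens f \<in> cfun.span TP" using f by (intro cfun.span_base) (auto simp: TP_def)
  moreover have "l2_tendsto polydisc_measure (\<lambda>_. tens f) (tens f)" by (simp add: l2_tendsto_def)
  ultimately show ?thesis unfolding Q_eq l2_closure_def using TP_bergman by auto
qed

lemma tens_upd_Q: "(\<And>i. f i \<in> Qs i) \<Longrightarrow> h \<in> Qs i \<Longrightarrow> tens (f(i := h)) \<in> Q"
  by (rule tens_Q) simp

text \<open>The vectors orthogonal to x form a closed subspace, so testing elementary tensors covers
  their spans and limits.\<close>

lemma orthogonal_to_Q:
  assumes x: "x \<in> L2 polydisc_measure" and o: "\<And>g. (\<And>i. g i \<in> Qs i) \<Longrightarrow> pip x (tens g) = 0" and y: "y \<in> Q"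
  shows "pip x y = 0"
proof -
  define W where "W = {w \<in> L2 polydisc_measure. pip w x = 0}"
  have "cfun.subspace W"
    using x by (intro cfun.subspaceI) (auto simp: W_def L2_zero L2_add L2_scale l2_inner_add_left
        l2_inner_scale_left)
  moreover have "TP \<subseteq> W"
  proof
    fix w assume "w \<in> TP"
    then obtain f where f: "w = tens f" "\<And>i. f i \<in> Qs i" by (auto simp: TP_def)
    have "pip (tens f) x = 0" using o[OF f(2)] by (rule l2_inner_commute_zero)
    then show "w \<in> W" unfolding W_def f(1) using tens_L2[OF comp.Q_L2[OF f(2)]] by simp
  qed
  ultimately have span: "cfun.span TP \<subseteq> W" by (rule cfun.span_minimal[rotated])
  obtain s where s: "\<And>k. s k \<in> cfun.span TP" "l2_tendsto polydisc_measure s y" using y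
      unfolding Q_eq l2_closure_def by auto
  have sW: "s k \<in> L2 polydisc_measure" "pip (s k) x = 0" for k using s(1)[of k] span by (auto simp: W_def)
  have "(\<lambda>k. pip (s k) x) \<longlonglongrightarrow> pip y x"
    by (rule l2_tendsto_inner[OF s(2) sW(1) Q_L2[OF y] x])
  then have "pip y x = 0" by (simp add: sW(2) LIMSEQ_const_iff)
  then show ?thesis by (rule l2_inner_commute_zero)
qed

text \<open>In slot i the product and its projection differ by a function orthogonal to
  \<open>Qs i\<close>, so the corresponding tensor is orthogonal to every elementary tensor of
  \<open>Q\<close>. Only square integrability is used, so conjugate symbols are included.\<close>

lemma compression_tens:
  assumes \<phi>: "\<phi> \<in> borel_measurable disc_measure" "AE z in disc_measure. cmod (\<phi> z) \<le> 1"
    and f: "\<And>i. f i \<in> Qs i"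
  shows "compression polydisc_measure Q (\<lambda>z. \<phi> (z $ i)) (tens f)
      = tens (f(i := compression disc_measure (Qs i) \<phi> (f i)))"
proof -
  define a where "a = mult_op \<phi> (f i)"
  define b where "b = compression disc_measure (Qs i) \<phi> (f i)"
  have aL: "a \<in> L2 disc_measure" unfolding a_def by (rule mult_op_L2(1)[OF comp.Q_L2[OF f] \<phi>])
  have bQ: "b \<in> Qs i" unfolding b_def by (rule compression_in[OF comp.Q_hilbert \<phi> f])
  have fL: "(f(i := h)) k \<in> L2 disc_measure" if "h \<in> L2 disc_measure" for h k
      using that comp.Q_L2[OF f] by (cases "k = i") auto
  have "proj polydisc_measure Q (tens (f(i := a))) = tens (f(i := b))"
  proof (rule proj_unique[OF Q_hilbert])
    show "tens (f(i := a)) \<in> L2 polydisc_measure" by (rule tens_L2[OF fL[OF aL]])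
    show "tens (f(i := b)) \<in> Q" by (rule tens_upd_Q[OF f bQ])
    fix g assume "g \<in> Q"
    have abL: "a - b \<in> L2 disc_measure" by (rule L2_diff[OF aL comp.Q_L2[OF bQ]])
    have "pip (tens (f(i := a - b))) g = 0"
    proof (rule orthogonal_to_Q[OF tens_L2[OF fL[OF abL]] _ \<open>g \<in> Q\<close>])
      fix g' :: "'n \<Rightarrow> complex \<Rightarrow> complex" assume g': "\<And>i. g' i \<in> Qs i"
      have "pip (tens (f(i := a - b))) (tens g') = (\<Prod>k\<in>UNIV. dip ((f(i := a - b)) k) (g' k))"
        by (rule tens_inner[OF fL[OF abL] comp.Q_L2[OF g']])
      also have "dip ((f(i := a - b)) i) (g' i) = 0"
        unfolding fun_upd_same a_def b_def compression_def
        by (rule proj_orth[OF comp.Q_hilbert mult_op_L2(1)[OF comp.Q_L2[OF f] \<phi>] g'])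
      then have "(\<Prod>k\<in>UNIV. dip ((f(i := a - b)) k) (g' k)) = 0"
        by (intro prod_zero bexI[of _ i]) auto
      finally show "pip (tens (f(i := a - b))) (tens g') = 0" .
    qed
    then show "pip (tens (f(i := a)) - tens (f(i := b))) g = 0" by (simp add: tens_upd_diff)
  qed
  then show ?thesis unfolding compression_def[of polydisc_measure] tens_upd_mult_op a_def b_def .
qed

lemma C_z_tens: "(\<And>i. f i \<in> Qs i) \<Longrightarrow> C_z Q i (tens f) = tens (f(i := comp.Cz i (f i)))"
  using compression_tens[OF disc_id_ok] by (simp add: coord_def[abs_def])

lemma C_adj_tens: "(\<And>i. f i \<in> Qs i) \<Longrightarrow> C_adj i (tens f) = tens (f(i := comp.Cz_adj i (f i)))"
  using compression_tens[OF disc_cnj_ok] by (simp add: coord_def[abs_def])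

lemma C_z_in: "f \<in> Q \<Longrightarrow> C_z Q i f \<in> Q"
  by (rule compression_in[OF Q_hilbert coord_ok(1,2)])

lemma C_adj_in: "f \<in> Q \<Longrightarrow> C_adj i f \<in> Q"
  by (rule compression_in[OF Q_hilbert coord_ok(3,4)])

lemma K_eq: "f \<in> Q \<Longrightarrow> K i j f = C_z Q i (C_adj j f) - C_adj j (C_z Q i f)"
  by (simp add: commutator_def adjoint_on_compression[OF Q_hilbert coord_ok(1,2)] C_z_in)

lemma K_in: "f \<in> Q \<Longrightarrow> K i j f \<in> Q"
  unfolding K_eq by (intro cfun.subspace_diff[OF l2_hilbert_subspace[OF Q_hilbert]] C_z_in C_adj_in)

text \<open>Operators acting in different slots commute; in a common slot the commutator is that of
  the factor.\<close>

lemma K_tens: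
  assumes f: "\<And>i. f i \<in> Qs i"
  shows "K i j (tens f) = (if i = j then tens (f(i := comp.T i (f i))) else 0)"
proof -
  have 1: "C_z Q i (C_adj j (tens f)) = tens ((f(j := comp.Cz_adj j (f j)))(i := comp.Cz i ((f(j :=
      comp.Cz_adj j (f j))) i)))"
    unfolding C_adj_tens[OF f] by (rule C_z_tens) (use f comp.Cz_adj_in in auto)
  have 2: "C_adj j (C_z Q i (tens f)) = tens ((f(i := comp.Cz i (f i)))(j := comp.Cz_adj j ((f(i :=
      comp.Cz i (f i))) j)))"
    unfolding C_z_tens[OF f] by (rule C_adj_tens) (use f comp.Cz_in in auto)
  show ?thesis
  proof (cases "i = j")
    case True
    then show ?thesis unfolding K_eq[OF tens_Q[OF f]] 1 2 by (simp add: comp.T_eq tens_upd_diff)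
  next
    case False
    then show ?thesis unfolding K_eq[OF tens_Q[OF f]] 1 2 by (simp add: fun_upd_twist)
  qed
qed

section \<open>Finite-dimensional tensor products and choice of unit vectors\<close>

lemma finite_dim_imp_compact_op:
  assumes fd: "finite_dim Q"
  shows "compact_op polydisc_measure Q (K i j)"
proof (rule finite_dim_compact_op[OF Q_hilbert fd K_in])
  fix f g assume fg: "f \<in> Q" "g \<in> Q"
  note cd = compression_diff[OF Q_hilbert coord_ok(1,2)] compression_diff[OF Q_hilbert coord_ok(3,4)]
  have d: "f - g \<in> Q" using cfun.subspace_diff[OF l2_hilbert_subspace[OF Q_hilbert] fg] .
  show "K i j (f - g) = K i j f - K i j g"
    unfolding K_eq[OF d] K_eq[OF fg(1)] K_eq[OF fg(2)] using fg by (simp add: cd C_z_in C_adj_in)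
next
  fix f assume f: "f \<in> Q"
  note cn = compression_norm_le[OF Q_hilbert coord_ok(1,2)] compression_norm_le[OF Q_hilbert coord_ok(3,4)]
  have "pnorm (K i j f) \<le> pnorm (C_z Q i (C_adj j f)) + pnorm (C_adj j (C_z Q i f))"
    unfolding K_eq[OF f]
    using l2_norm_triangle_diff[of "C_z Q i (C_adj j f)" polydisc_measure 0
        "C_adj j (C_z Q i f)"] l2_norm_minus_commute[of polydisc_measure 0 "C_adj j (C_z Q i f)"] f
    by (simp add: Q_L2 C_z_in C_adj_in L2_zero)
  also have "pnorm (C_z Q i (C_adj j f)) \<le> pnorm f"
    using cn(1)[OF C_adj_in[OF f]] cn(2)[OF f] by (rule order_trans)
  also have "pnorm (C_adj j (C_z Q i f)) \<le> pnorm f"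
    using cn(2)[OF C_z_in[OF f]] cn(1)[OF f] by (rule order_trans)
  finally show "pnorm (K i j f) \<le> 2 * pnorm f" by simp
qed

text \<open>A finite-dimensional span is already closed, so taking the closure adds nothing.\<close>

lemma finite_dim_Q_if_span:
  assumes "finite_dim (cfun.span TP)"
  shows "finite_dim Q"
proof -
  have "Q \<subseteq> cfun.span TP"
    using finite_dim_closed[OF poly.HH_hilbert TP_bergman cfun.subspace_span assms] by (simp add: Q_eq)
  then show ?thesis using assms unfolding finite_dim_def by blast
qed

text \<open>Expanding every slot in a finite basis and multiplying out writes an elementary tensor
  as a combination of tensors of basis vectors.\<close>

lemma finite_dim_Q:
  assumes "\<And>i. finite_dim (Qs i)"
  shows "finite_dim Q"
proof (rule finite_dim_Q_if_span)
  define P where "P i F \<longleftrightarrow> finite F \<and> (\<forall>f\<in>Qs i. f = (\<Sum>u\<in>F. (\<lambda>x. dip f u * u x)))" for i F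
  have "\<exists>F. P i F" for i
    using orthonormal_basis_exists[OF comp.Q_hilbert order_refl l2_hilbert_subspace[OF
        comp.Q_hilbert] assms, of i]
    unfolding P_def by (elim exE conjE) (intro exI conjI)
  then obtain F where F0: "P i (F i)" for i by metis
  have F: "finite (F i)" for i using F0[of i] by (simp add: P_def)
  have Fsum: "f = (\<Sum>u\<in>F i. (\<lambda>x. dip f u * u x))" if "f \<in> Qs i" for f i
    using F0[of i] unfolding P_def by (elim conjE) (erule bspec[OF _ that])
  define B where "B = tens ` PiE UNIV F"
  have "finite B" unfolding B_def using F by (intro finite_imageI finite_PiE) auto
  moreover have "TP \<subseteq> cfun.span B"
  proof
    fix x assume "x \<in> TP"
    then obtain f where x: "x = tens f" and f: "\<And>i. f i \<in> Qs i" by (auto simp: TP_def)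
    have "f i w = (\<Sum>u\<in>F i. dip (f i) u * u w)" for i w
      using fun_cong[OF Fsum[OF f[of i]], of w] by (simp add: sum_fun_apply)
    then have "x z = (\<Prod>i\<in>UNIV. \<Sum>u\<in>F i. dip (f i) u * u (z $ i))" for z
      unfolding x tens_def by simp
    then have "x z = (\<Sum>g\<in>PiE UNIV F. (\<Prod>i\<in>UNIV. dip (f i) (g i)) * tens g z)" for z
      by (simp add: prod_sum_PiE F prod.distrib tens_def)
    then have "x = (\<Sum>g\<in>PiE UNIV F. (\<lambda>z. (\<Prod>i\<in>UNIV. dip (f i) (g i)) * tens g z))"
      by (simp add: fun_eq_iff sum_fun_apply)
    also have "\<dots> \<in> cfun.span B"
      by (intro cfun.span_sum cfun.span_scale cfun.span_base) (auto simp: B_def)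
    finally show "x \<in> cfun.span B" .
  qed
  ultimately show "finite_dim (cfun.span TP)"
    unfolding finite_dim_def using cfun.span_minimal[OF _ cfun.subspace_span] by blast
qed

lemma finite_dim_Q_if_zero:
  assumes "Qs i = {0}"
  shows "finite_dim Q"
proof (rule finite_dim_Q_if_span)
  have "TP \<subseteq> cfun.span {}" using assms tens_eq0 by (auto simp: TP_def)
  then show "finite_dim (cfun.span TP)"
    unfolding finite_dim_def using cfun.span_minimal[OF _ cfun.subspace_span] by blast
qed

text \<open>A zero factor would annihilate every elementary tensor and make \<open>Q\<close>
  finite-dimensional.\<close>

lemma unit_vectors_exist:
  assumes "\<not> finite_dim Q"
  shows "\<exists>e. \<forall>i. e i \<in> Qs i \<and> dnorm (e i) = 1"
proof -
  have "\<exists>e\<in>Qs i. dnorm e = 1" for i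
  proof -
    have sub: "cfun.subspace (Qs i)" by (rule l2_hilbert_subspace[OF comp.Q_hilbert])
    have "Qs i \<noteq> {0}" using assms finite_dim_Q_if_zero by blast
    then obtain v where v: "v \<in> Qs i" "v \<noteq> 0" using cfun.subspace_0[OF sub] by blast
    have n: "dnorm v \<noteq> 0" using l2_hilbert_eq0[OF comp.Q_hilbert v(1)] v(2) by blast
    have "dnorm (\<lambda>x. of_real (1 / dnorm v) * v x) = 1"
      using n by (simp only: l2_norm_scale norm_of_real) simp
    then show ?thesis using cfun.subspace_scale[OF sub v(1)] by blast
  qed
  then show ?thesis by metis
qed

text \<open>Each factor embeds isometrically into \<open>Q\<close> once unit vectors are fixed in the other factors.\<close>

lemma compact_factor:
  assumes e: "\<And>k. e k \<in> Qs k" "\<And>k. dnorm (e k) = 1"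
    and cK: "compact_op polydisc_measure Q (K i i)"
  shows "compact_op disc_measure (Qs i) (comp.T i)"
  unfolding compact_op_def
proof (intro allI impI, elim conjE exE)
  fix s B assume s: "\<forall>k::nat. s k \<in> Qs i" and B: "\<forall>k. dnorm (s k) \<le> B"
  note eL = comp.Q_L2[OF e(1)]
  have sQ: "s k \<in> Qs i" for k using s by blast
  have isom: "pnorm (tens (e(i := h))) = dnorm h" if "h \<in> L2 disc_measure" for h
    by (rule tens_upd_norm[OF eL that e(2)])
  define x where "x k = tens (e(i := s k))" for k
  have xQ: "x k \<in> Q" for k unfolding x_def by (rule tens_upd_Q[OF e(1) sQ])
  have Kx: "K i i (x k) = tens (e(i := comp.T i (s k)))" for k
    unfolding x_def using e(1) sQ by (subst K_tens) auto
  have "\<forall>k. pnorm (x k) \<le> B" using B isom[OF comp.Q_L2[OF sQ]] by (simp add: x_def)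
  then obtain r g where r: "strict_mono (r :: nat \<Rightarrow> nat)" and g: "g \<in> Q"
      "l2_tendsto polydisc_measure (\<lambda>k. K i i (x (r k))) g"
    using cK xQ unfolding compact_op_def by blast
  \<comment> \<open>The limit g in \<open>Q\<close> is not known to be an elementary tensor. Only
    the Cauchy property is pulled back by the isometry, and completeness of the factor provides the
    limit.\<close>
  have "\<exists>f\<in>Qs i. l2_tendsto disc_measure (\<lambda>k. comp.T i (s (r k))) f"
  proof (rule l2_hilbert_complete[OF comp.Q_hilbert comp.T_in[OF sQ]])
    fix d :: real assume d: "d > 0"
    have "pnorm (K i i (x (r m)) - K i i (x (r n))) = dnorm (comp.T i (s (r m)) - comp.T i (s (r n)))" for m n
      unfolding Kx tens_upd_diff[symmetric] by (intro isom L2_diff comp.Q_L2[where i = i] comp.T_in sQ)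
    then show "\<exists>N. \<forall>m\<ge>N. \<forall>n\<ge>N. dnorm (comp.T i (s (r m)) - comp.T i (s (r n))) < d"
      using l2_tendsto_Cauchy[OF g(2) Q_L2[OF K_in[OF xQ]] Q_L2[OF g(1)] d] by simp
  qed
  then show "\<exists>r g. strict_mono r \<and> g \<in> Qs i \<and> l2_tendsto disc_measure (\<lambda>k. comp.T i (s (r k))) g"
    using r by blast
qed

text \<open>Tensoring an orthonormal sequence of an infinite-dimensional factor with a vector whose
  self-commutator does not vanish contradicts compactness.\<close>

lemma normal_factor:
  assumes e: "\<And>k. e k \<in> Qs k" "\<And>k. dnorm (e k) = 1"
    and nf: "\<not> finite_dim (Qs i)" and ij: "j \<noteq> i"
    and cK: "compact_op polydisc_measure Q (K j j)" and v: "v \<in> Qs j"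
  shows "comp.T j v = 0"
proof (rule ccontr)
  define w where "w = comp.T j v"
  assume "comp.T j v \<noteq> 0"
  then have w: "w \<in> Qs j" "w \<noteq> 0" unfolding w_def using comp.T_in[OF v] by auto
  define n where "n = dnorm w"
  have "n \<noteq> 0" unfolding n_def using l2_hilbert_eq0[OF comp.Q_hilbert w(1)] w(2) by blast
  then have n: "0 < n" using l2_norm_nonneg[of disc_measure w] by (simp add: n_def less_le)
  obtain u where "\<forall>k::nat. u k \<in> Qs i \<and> dnorm (u k) = 1" and "\<forall>k l. k \<noteq> l \<longrightarrow> dip (u k) (u l) = 0"
    using orthonormal_sequence_exists[OF comp.Q_hilbert nf] by (elim exE conjE)
  then have u: "u k \<in> Qs i" "dnorm (u k) = 1" "k \<noteq> l \<Longrightarrow> dip (u k) (u l) = 0" for k l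
    by simp_all
  have norm2: "pnorm (tens ((e(j := a))(i := h))) = dnorm a * dnorm h"
    if a: "a \<in> L2 disc_measure" and h: "h \<in> L2 disc_measure" for a h
  proof -
    have "pnorm (tens ((e(j := a))(i := h))) = (\<Prod>k\<in>UNIV. dnorm (((e(j := a))(i := h)) k))"
      by (rule tens_norm) (use a h comp.Q_L2[OF e(1)] in auto)
    also have "\<dots> = dnorm h * (dnorm a * (\<Prod>k\<in>UNIV - {i} - {j}. dnorm (((e(j := a))(i := h)) k)))"
      using ij by (subst prod.remove[of UNIV i]; simp; subst prod.remove[of "UNIV - {i}" j]; simp)
    also have "(\<Prod>k\<in>UNIV - {i} - {j}. dnorm (((e(j := a))(i := h)) k)) = 1"
      using e(2) by (intro prod.neutral) auto
    finally show ?thesis by (simp only: mult_1_right mult_1_left mult.commute)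
  qed
  define x where "x k = tens ((e(j := v))(i := u k))" for k
  have ev: "(e(j := v)) k \<in> Qs k" for k using e(1) v by simp
  have xQ: "x k \<in> Q" for k unfolding x_def by (rule tens_upd_Q[OF ev u(1)])
  have Kx: "K j j (x k) = tens ((e(j := w))(i := u k))" for k
  proof -
    have "K j j (x k) = tens (((e(j := v))(i := u k))(j := comp.T j v))"
      unfolding x_def using ev u(1) ij by (subst K_tens) auto
    also have "((e(j := v))(i := u k))(j := comp.T j v) = (e(j := w))(i := u k)"
      using ij by (auto simp: w_def fun_upd_def)
    finally show ?thesis .
  qed
  have "\<forall>k. pnorm (x k) \<le> dnorm v"
    unfolding x_def using norm2[OF comp.Q_L2[OF v] comp.Q_L2[OF u(1)]] u(2) by simp
  then obtain r g where r: "strict_mono (r :: nat \<Rightarrow> nat)" and g: "g \<in> Q"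
      "l2_tendsto polydisc_measure (\<lambda>k. K j j (x (r k))) g"
    using cK xQ unfolding compact_op_def by blast
  obtain N where N: "\<forall>k\<ge>N. \<forall>l\<ge>N. pnorm (K j j (x (r k)) - K j j (x (r l))) < n"
    using l2_tendsto_Cauchy[OF g(2) Q_L2[OF K_in[OF xQ]] Q_L2[OF g(1)] n] ..
  define k l where "k = r N" and "l = r (Suc N)"
  have kl: "k \<noteq> l" using strict_monoD[OF r, of N "Suc N"] by (simp add: k_def l_def)
  \<comment> \<open>Orthonormal vectors are at distance sqrt 2, so the images of the tensors stay at
    distance at least n and no subsequence can be Cauchy.\<close>
  have "(dnorm (u k - u l))\<^sup>2 = 2"
    using l2_norm_diff_sq[OF comp.Q_L2[OF u(1)] comp.Q_L2[OF u(1)], of k l] u kl by simp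
  then have "1 \<le> dnorm (u k - u l)"
    using power2_le_imp_le[of 1 "dnorm (u k - u l)"] by simp
  then have "n \<le> n * dnorm (u k - u l)" using n by simp
  also have "\<dots> = pnorm (K j j (x k) - K j j (x l))"
    unfolding Kx tens_upd_diff[symmetric] n_def
    by (rule norm2[OF comp.Q_L2[OF w(1)] L2_diff[OF comp.Q_L2[OF u(1)] comp.Q_L2[OF u(1)]], symmetric])
  also have "\<dots> < n" unfolding k_def l_def using N by simp
  finally show False by simp
qed

text \<open>With one-dimensional factors elsewhere, inserting h into slot i reaches every elementary
  tensor. The insertion is isometric on a complete space, so its range also contains the
  limits.\<close>

lemma elementary_tensors:
  assumes d: "\<And>j. j \<noteq> i \<Longrightarrow> cfun.dim (Qs j) = 1" and e: "\<And>k. e k \<in> Qs k" "\<And>k. dnorm (e k) = 1"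
    and q: "q \<in> Q"
  shows "\<exists>h\<in>Qs i. q = tens (e(i := h))"
proof -
  define R where "R = (\<lambda>h. tens (e(i := h))) ` Qs i"
  have sub: "cfun.subspace (Qs i)" by (rule l2_hilbert_subspace[OF comp.Q_hilbert])
  have Rsub: "cfun.subspace R"
  proof (rule cfun.subspaceI)
    have "tens (e(i := 0)) = 0" by (rule tens_eq0[of _ i]) simp
    then show "0 \<in> R" unfolding R_def using cfun.subspace_0[OF sub] by force
    fix f g c assume "f \<in> R" "g \<in> R"
    then obtain a b where ab: "a \<in> Qs i" "b \<in> Qs i" "f = tens (e(i := a))" "g = tens (e(i := b))"
        by (auto simp: R_def)
    show "f + g \<in> R" unfolding R_def using ab cfun.subspace_add[OF sub] by (intro image_eqI[of _ _
        "a + b"]) (auto simp: tens_upd_add)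
    show "(\<lambda>x. c * f x) \<in> R" unfolding R_def using ab cfun.subspace_scale[OF sub]
        by (intro image_eqI[of _ _ "\<lambda>x. c * a x"]) (auto simp: tens_upd_scale)
  qed
  have scalar: "\<exists>c. f = (\<lambda>x. c * e j x)" if j: "j \<noteq> i" and f: "f \<in> Qs j" for j f
  proof -
    \<comment> \<open>As \<open>card\<close> is 0 on infinite sets, dimension 1 does provide a
      one-element basis.\<close>
    obtain B where B: "B \<subseteq> Qs j" "cfun.independent B" "Qs j \<subseteq> cfun.span B" "card B = cfun.dim (Qs j)"
      by (rule cfun.basis_exists)
    then obtain b where b: "B = {b}" using d[OF j] by (auto simp: card_1_singleton_iff)
    have "\<exists>c. g = (\<lambda>x. c * b x)" if "g \<in> Qs j" for g
      using B(3) that unfolding b by (auto simp: cfun.span_singleton)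
    then obtain c c' where c: "f = (\<lambda>x. c * b x)" "e j = (\<lambda>x. c' * b x)" using f e(1)[of j] by meson
    have "c' \<noteq> 0"
    proof
      assume "c' = 0"
      then have "e j = 0" using c(2) by (simp add: fun_eq_iff)
      then show False using e(2)[of j] by simp
    qed
    then have "f = (\<lambda>x. (c / c') * e j x)" unfolding c by (simp add: fun_eq_iff)
    then show ?thesis by blast
  qed
  have "TP \<subseteq> R"
  proof
    fix x assume "x \<in> TP"
    then obtain f where x: "x = tens f" and f: "\<And>i. f i \<in> Qs i" by (auto simp: TP_def)
    have "\<forall>j. \<exists>c. j \<noteq> i \<longrightarrow> f j = (\<lambda>x. c * e j x)" using scalar f by meson
    then obtain c where c: "\<And>j. j \<noteq> i \<Longrightarrow> f j = (\<lambda>x. c j * e j x)" by metis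
    \<comment> \<open>Collects the scalars of all other slots so that slot i can absorb
      them.\<close>
    define a where "a = (\<Prod>j\<in>UNIV - {i}. c j)"
    have "x z = tens (e(i := (\<lambda>x. a * f i x))) z" for z
    proof -
      have "(\<Prod>j\<in>UNIV - {i}. f j (z $ j)) = (\<Prod>j\<in>UNIV - {i}. c j * e j (z $ j))"
        by (rule prod.cong) (auto simp: c)
      then show ?thesis
        unfolding x using tens_upd[of f i "f i" z] by (simp add: tens_upd a_def prod.distrib)
    qed
    then have "x = tens (e(i := (\<lambda>x. a * f i x)))" by blast
    then show "x \<in> R" unfolding R_def using cfun.subspace_scale[OF sub f[of i]] by blast
  qed
  then have span: "cfun.span TP \<subseteq> R" using cfun.span_minimal Rsub by blast
  obtain s where s: "\<And>k. s k \<in> cfun.span TP" "l2_tendsto polydisc_measure s q" using q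
      unfolding Q_eq l2_closure_def by auto
  have "\<forall>k. \<exists>h\<in>Qs i. s k = tens (e(i := h))" using s(1) span by (auto simp: R_def)
  then obtain h where "\<forall>k. h k \<in> Qs i \<and> s k = tens (e(i := h k))" by metis
  then have h: "h k \<in> Qs i" "s k = tens (e(i := h k))" for k by simp_all
  have isom: "pnorm (tens (e(i := a))) = dnorm a" if "a \<in> L2 disc_measure" for a
    by (rule tens_upd_norm[OF comp.Q_L2[OF e(1)] that e(2)])
  have sQ: "s k \<in> Q" for k unfolding h(2) by (rule tens_upd_Q[OF e(1) h(1)])
  have "\<exists>f\<in>Qs i. l2_tendsto disc_measure h f"
  proof (rule l2_hilbert_complete[OF comp.Q_hilbert h(1)])
    fix d :: real assume d: "d > 0"
    have "pnorm (s m - s n) = dnorm (h m - h n)" for m n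
      unfolding h(2) tens_upd_diff[symmetric] by (intro isom L2_diff comp.Q_L2[where i = i] h)
    then show "\<exists>N. \<forall>m\<ge>N. \<forall>n\<ge>N. dnorm (h m - h n) < d"
      using l2_tendsto_Cauchy[OF s(2) Q_L2[OF sQ] Q_L2[OF q] d] by simp
  qed
  then obtain f where f: "f \<in> Qs i" "l2_tendsto disc_measure h f" by blast
  define p where "p = tens (e(i := f))"
  have pQ: "p \<in> Q" unfolding p_def by (rule tens_upd_Q[OF e(1) f(1)])
  have "pnorm (s k - p) = dnorm (h k - f)" for k
    unfolding h(2) p_def tens_upd_diff[symmetric] by (intro isom L2_diff comp.Q_L2[where i = i] h f)
  then have sp: "l2_tendsto polydisc_measure s p" using f(2) by (simp add: l2_tendsto_def)
  have "(\<lambda>k. pnorm (s k - q) + pnorm (s k - p)) \<longlonglongrightarrow> 0 + 0"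
    using s(2) sp unfolding l2_tendsto_def by (rule tendsto_add)
  moreover have "pnorm (q - p) \<le> pnorm (s k - q) + pnorm (s k - p)" for k
    using l2_norm_triangle_diff[OF Q_L2[OF q] Q_L2[OF sQ[of k]] Q_L2[OF pQ]]
        by (simp add: l2_norm_minus_commute[of _ q])
  ultimately have "pnorm (q - p) \<le> 0"
    by (intro LIMSEQ_le_const[where X = "\<lambda>k. pnorm (s k - q) + pnorm (s k - p)"]) auto
  then have "pnorm (q - p) = 0" using l2_norm_nonneg[of polydisc_measure "q - p"] by linarith
  then have "q - p = 0"
    using l2_hilbert_eq0[OF Q_hilbert] cfun.subspace_diff[OF l2_hilbert_subspace[OF Q_hilbert] q pQ] by blast
  then show ?thesis using f(1) p_def by auto
qed

text \<open>On a line both operators are scalars, and scalars commute.\<close>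

lemma T_zero_if_dim_1:
  assumes d: "cfun.dim (Qs j) = 1" and f: "f \<in> Qs j"
  shows "comp.T j f = 0"
proof -
  obtain B where B: "B \<subseteq> Qs j" "cfun.independent B" "Qs j \<subseteq> cfun.span B" "card B = cfun.dim (Qs j)"
    by (rule cfun.basis_exists)
  then obtain b where b: "B = {b}" using d by (auto simp: card_1_singleton_iff)
  have bQ: "b \<in> Qs j" using B b by simp
  have sc: "\<exists>c. g = (\<lambda>x. c * b x)" if "g \<in> Qs j" for g
    using B(3) that unfolding b by (auto simp: cfun.span_singleton)
  obtain c1 where c1: "comp.Cz j b = (\<lambda>x. c1 * b x)" using sc[OF comp.Cz_in[OF bQ]] by blast
  obtain c2 where c2: "comp.Cz_adj j b = (\<lambda>x. c2 * b x)" using sc[OF comp.Cz_adj_in[OF bQ]] by blast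
  obtain c where c: "f = (\<lambda>x. c * b x)" using sc[OF f] by blast
  note cs = compression_scale[OF comp.Q_hilbert disc_id_ok] compression_scale[OF comp.Q_hilbert disc_cnj_ok]
  have bs: "(\<lambda>x. a * b x) \<in> Qs j" for a using cfun.subspace_scale[OF l2_hilbert_subspace[OF
      comp.Q_hilbert] bQ] .
  have m: "comp.Cz j (\<lambda>x. a * b x) = (\<lambda>x. (a * c1) * b x)"
      "comp.Cz_adj j (\<lambda>x. a * b x) = (\<lambda>x. (a * c2) * b x)" for a
    unfolding cs(1)[OF bQ, of a] cs(2)[OF bQ, of a] by (simp_all only: c1 c2 mult.assoc)
  have "comp.T j f = comp.Cz j (comp.Cz_adj j (\<lambda>x. c * b x)) - comp.Cz_adj j (comp.Cz j (\<lambda>x. c * b x))"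
    by (simp only: comp.T_eq c)
  also have "\<dots> = (\<lambda>x. (c * c2 * c1) * b x) - (\<lambda>x. (c * c1 * c2) * b x)" by (simp only: m)
  also have "\<dots> = 0" by (simp add: fun_eq_iff)
  finally show ?thesis .
qed

text \<open>Under the identification of \<open>Q\<close> with \<open>Qs i\<close>,
  \<open>K i i\<close> becomes the self-commutator of that factor, which is compact because
  \<open>E\<close> is finite-dimensional. Every other commutator is 0, by different slots or by
  one-dimensionality.\<close>

lemma compact_op_if_one_factor:
  assumes nf: "\<not> finite_dim Q" and E: "finite_dim (comp.E i)" and d: "\<And>j. j \<noteq> i \<Longrightarrow> cfun.dim (Qs j) = 1"
  shows "compact_op polydisc_measure Q (K k l)"
proof -
  obtain e where "\<forall>i. e i \<in> Qs i \<and> dnorm (e i) = 1" using unit_vectors_exist[OF nf] ..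
  then have e: "e k \<in> Qs k" "dnorm (e k) = 1" for k by simp_all
  have et: "\<exists>h\<in>Qs i. q = tens (e(i := h))" if "q \<in> Q" for q by (rule elementary_tensors[OF d e that])
  have eh: "(e(i := h)) k \<in> Qs k" if "h \<in> Qs i" for h k using that e by simp
  have isom: "pnorm (tens (e(i := a))) = dnorm a" if "a \<in> L2 disc_measure" for a
    by (rule tens_upd_norm[OF comp.Q_L2[OF e(1)] that e(2)])
  show ?thesis
  proof (cases "k = i \<and> l = i")
    case False
    have K0: "K k l q = 0" if q: "q \<in> Q" for q
    proof -
      obtain h where h: "h \<in> Qs i" "q = tens (e(i := h))" using et[OF q] by blast
      show ?thesis
      proof (cases "k = l")
        case True
        then have "k \<noteq> i" using False by simp
        then have "comp.T k ((e(i := h)) k) = 0" by (intro T_zero_if_dim_1 d eh h)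
        then show ?thesis unfolding h(2) K_tens[OF eh[OF h(1)]] using True by (simp add: tens_eq0[of _ k])
      next
        case False
        then show ?thesis unfolding h(2) K_tens[OF eh[OF h(1)]] by simp
      qed
    qed
    show ?thesis
      unfolding compact_op_def
    proof (intro allI impI, elim conjE)
      fix s assume s: "\<forall>k::nat. s k \<in> Q"
      show "\<exists>r g. strict_mono r \<and> g \<in> Q \<and> l2_tendsto polydisc_measure (\<lambda>n. K k l (s (r n))) g"
        using s K0 cfun.subspace_0[OF l2_hilbert_subspace[OF Q_hilbert]]
        by (intro exI[of _ "\<lambda>n. n"] exI[of _ 0]) (auto simp: strict_mono_def l2_tendsto_def)
    qed
  next
    case True
    have cT: "compact_op disc_measure (Qs i) (comp.T i)" by (rule comp.finite_dim_imp_compact[OF E])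
    show ?thesis
      unfolding compact_op_def
    proof (intro allI impI, elim conjE exE)
      fix s B assume s: "\<forall>n::nat. s n \<in> Q" and B: "\<forall>n. pnorm (s n) \<le> B"
      have "\<forall>n. \<exists>h\<in>Qs i. s n = tens (e(i := h))" using s et by blast
      then obtain h where "\<forall>n. h n \<in> Qs i \<and> s n = tens (e(i := h n))" by metis
      then have h: "h n \<in> Qs i" "s n = tens (e(i := h n))" for n by simp_all
      have "\<forall>n. dnorm (h n) \<le> B" using B isom[OF comp.Q_L2[OF h(1)]] by (simp add: h(2))
      then obtain r g where r: "strict_mono (r :: nat \<Rightarrow> nat)" and g: "g \<in> Qs i"
          "l2_tendsto disc_measure (\<lambda>n. comp.T i (h (r n))) g"
        using cT h(1) unfolding compact_op_def by blast
      have "K i i (s n) = tens (e(i := comp.T i (h n)))" for n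
        unfolding h(2) K_tens[OF eh[OF h(1)]] by simp
      then have "pnorm (K i i (s n) - tens (e(i := g))) = dnorm (comp.T i (h n) - g)" for n
        using isom[OF L2_diff[OF comp.Q_L2[OF comp.T_in[OF h(1)[of n]]] comp.Q_L2[OF g(1)]]]
            by (simp add: tens_upd_diff)
      then have "l2_tendsto polydisc_measure (\<lambda>n. K k l (s (r n))) (tens (e(i := g)))"
        using g(2) True by (simp add: l2_tendsto_def)
      then show "\<exists>r g. strict_mono r \<and> g \<in> Q \<and> l2_tendsto polydisc_measure (\<lambda>n. K k l (s (r n))) g"
        using r tens_upd_Q[OF e(1) g(1)] by blast
    qed
  qed
qed

theorem essentially_normal_iff:
  "essentially_normal Q \<longleftrightarrow> finite_dim Q \<or>
    (\<exists>i. \<not> finite_dim (Qs i) \<and> finite_dim (comp.E i) \<and> (\<forall>j. j \<noteq> i \<longrightarrow> cfun.dim (Qs j) = 1))"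
proof
  assume en: "essentially_normal Q"
  then have cK: "compact_op polydisc_measure Q (K i i)" for i by (simp add: essentially_normal_def)
  show "finite_dim Q \<or> (\<exists>i. \<not> finite_dim (Qs i) \<and> finite_dim (comp.E i) \<and> (\<forall>j. j \<noteq> i \<longrightarrow> cfun.dim (Qs j) = 1))"
  proof (cases "finite_dim Q")
    case nf: False
    obtain e where "\<forall>i. e i \<in> Qs i \<and> dnorm (e i) = 1" using unit_vectors_exist[OF nf] ..
    then have e: "e k \<in> Qs k" "dnorm (e k) = 1" for k by simp_all
    \<comment> \<open>Finite-dimensional factors alone would give a finite-dimensional
      \<open>Q\<close>. This infinite-dimensional slot then serves to test each of the
      others.\<close>
    obtain i where i: "\<not> finite_dim (Qs i)" using finite_dim_Q nf by blast
    have "finite_dim (comp.E i)" by (rule comp.compact_imp_finite_dim[OF compact_factor[OF e cK]])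
    moreover have "cfun.dim (Qs j) = 1" if j: "j \<noteq> i" for j
    proof (rule comp.normal_imp_dim_1)
      show "comp.T j v = 0" if "v \<in> Qs j" for v by (rule normal_factor[OF e i j cK that])
      show "Qs j \<noteq> {0}" using finite_dim_Q_if_zero nf by blast
    qed
    ultimately show ?thesis using i by blast
  qed simp
next
  assume "finite_dim Q \<or> (\<exists>i. \<not> finite_dim (Qs i) \<and> finite_dim (comp.E i)
      \<and> (\<forall>j. j \<noteq> i \<longrightarrow> cfun.dim (Qs j) = 1))"
  then have "compact_op polydisc_measure Q (K k l)" for k l
    using finite_dim_imp_compact_op compact_op_if_one_factor by blast
  then show "essentially_normal Q" by (simp add: essentially_normal_def)
qed

end

theorem corollary3p4:
  fixes Q :: "(complex ^ 'n::{finite,linorder} \<Rightarrow> complex) set"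
    and Qs :: "'n \<Rightarrow> (complex \<Rightarrow> complex) set"
    and S :: "'n \<Rightarrow> (complex \<Rightarrow> complex) set"
  assumes "CARD('n) \<ge> 2"
    and "polydisc_quotient_module Q"
    and "doubly_commuting Q"
    and "\<And>i. disc_quotient_module (Qs i)"
    and "Q = tensor_prod Qs"
    and "\<And>i. S i = ominus disc_measure bergman_disc (Qs i)"
  shows "essentially_normal Q \<longleftrightarrow>
    finite_dim Q \<or>
    (\<exists>i. \<not> finite_dim (Qs i) \<and>
         finite_dim (ominus disc_measure (S i) (mult_op (\<lambda>z. z) ` S i)) \<and>
         (\<forall>j. j \<noteq> i \<longrightarrow> cfun.dim (Qs j) = 1))"
proof -
  interpret tensor_quotient Q Qs S
    by unfold_locales (rule assms)+
  show ?thesis using essentially_normal_iff unfolding comp.E_def .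
qed

end
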